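(* Let $f:\mathcal E\to[0,\infty]$ be concave and upper semicontinuous with $S_0:=\operatorname{cl}(\operatorname{dom} f)$ bounded, i.e. $D_0:=D(S_0)<\infty$; let $S_1,\dots,S_m\subseteq\mathcal E$ be closed and convex, $\mathcal S:=\bigcap_{j=1}^m S_j$; let $e_0\in\operatorname{int}S_0$, $R_0:=R_{e_0}(S_0)>0$, and let $e_j\in\operatorname{int}S_j$ for $j=1,\dots,m$. Set $\mathtt{fom}=\mathtt{smooth}$ and $$\varphi_{\mathcal S}=\max\{\varphi_{S_1},\dots,\varphi_{S_m}\},\qquad \varphi_{S_j}(x)=\begin{cases}\gamma_{S_j,e_j}(x)&\text{if }\gamma_{S_j,e_j}(x)>1\\ \tfrac12\gamma_{S_j,e_j}^2(x)+\tfrac12&\text{otherwise.}\end{cases}$$ Suppose there exist $x^*\in\mathcal S$ with $f(x^* )=p^*:=\max_{x\in\mathcal S}f(x)>0$ and $x_{SL}\in\operatorname{int}\mathcal S\cap\operatorname{dom}f$ such that $\eta:=(1-\gamma_{S_0,e_0}(x^* ))(1-\varphi_{\mathcal S}(x_{SL}))>0$. Suppose moreover that $f$ is twice continuously differentiable and $\beta$-smooth and that each $S_j$ ($1\le j\le m$) is $\beta$-smooth and compact. Let $x_0\in\operatorname{dom}f\cap\mathcal S$, $\tau_0=1/f(x_0)$, $b\ge2$. Then, for all $\varepsilon>0$, the Parallel MultiRadial Method with integer $N\ge\log_b\!\big(\frac{bp^*}{c_{\tau_0}\rho\,\varepsilon}\big)$, $N>0$, finds a feasible $\varepsilon$-minimizer,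 i.e. $y^{best}_i\in\mathcal S$ with $p^*-f(y^{best}_i)\le\varepsilon$, within $O(1/\varepsilon)$ iterations $i$ (the $O$ is as $\varepsilon\to0$, with constant depending on the problem data, $x_0$, $b$ and the method's constants, but not on $\varepsilon$ or $N$).
   Context: $\mathcal E$ is a finite-dimensional Euclidean space with inner product and induced norm $\|\cdot\|$. For $f:\mathcal E\to[0,\infty]$: $\operatorname{dom}f=\{x: 0<f(x)<\infty\}$, $\operatorname{hypo}f=\{(x,u)\in\mathcal E\times(0,\infty): f(x)\ge u\}$, and $f$ is concave if $\operatorname{hypo}f$ is convex. $f$ twice continuously differentiable means that $\operatorname{dom}f$ is open and $f$ is $C^2$ on it; $f$ is $\beta$-smooth if $\nabla f$ is $\beta$-Lipschitz on $\operatorname{dom}f$. A set $S$ is $\beta$-smooth if any unit vectors $\xi_1\in N_S(x_1)$, $\xi_2\in N_S(x_2)$ at boundary points $x_1,x_2$ of $S$ satisfy $\|\xi_1-\xi_2\|\le\beta\|x_1-x_2\|$, where $N_S(x)=\{\xi:\langle\xi,x'-x\rangle\le0\ \forall x'\in S\}$. For a set $S$ and $e\in S$: $\gamma_{S,e}(x)=\inf\{v>0: e+\frac{x-e}{v}\in S\}$, $R_e(S)=\inf\{\|x-e\|: x\notin S\}$, $D(S)=\sup\{\|x-y\|: x,y\in S\}$. The radial transform is $f^{\Gamma,e}(y)=\sup\{v>0: v f(e+\frac{y-e}{v})\le1\}$, $\sup\emptyset=0$. For $\tau>0$: $\Phi_\tau(y)=\max\{(\tau f)^{\Gamma,e_0}(y),\varphi_{\mathcal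 S}(y)\}$, $\rho=\frac{R_0}{D_0+R_0}$, $c_\tau=\frac{1}{\tau p^*}\frac{R_0}{D_0+R_0}\eta$. Accelerated smoothing method $\mathtt{smooth}$ on $h=\max\{h_0,\dots,h_m\}$, each $h_j$ convex, $L$-smooth and $M$-Lipschitz, with target accuracy $\delta$ started at $x$: let $\theta=\frac{\delta}{2\log(m+1)}$, $h_\theta(y)=\theta\log\big(\sum_{j=0}^m\exp(h_j(y)/\theta)\big)$, $L_\theta=L+M^2/\theta$; set $y_0=z_0=x$, $t_0=\frac{-1+\sqrt5}{2}$ and iterate $y_{i+1}=z_i-\frac1{L_\theta}\nabla h_\theta(z_i)$, $z_{i+1}=y_{i+1}+\beta_i(y_{i+1}-y_i)$, where $t_{i+1}\in(0,1)$ solves $t_{i+1}^2=(1-t_{i+1})t_i^2$ and $\beta_i=t_i(1-t_i)/(t_i^2+t_{i+1})$. Applied to $\Phi_\tau$, the components are $h_0=(\tau f)^{\Gamma,e_0}$, $h_j=\varphi_{S_j}$, and $L,M$ are fixed constants valid for these components for all $\tau\in[1/p^*,\tau_0]$. Parallel MultiRadial Method (inputs $f,e_0,\varphi_{\mathcal S},x_0\in\operatorname{dom}f\cap\mathcal S$, $b\ge2$, integer $N>0$, first-order method $\mathtt{fom}$). Set $\delta^{(l)}=b^{-l}$ and $\tau^{(l)}_0=1/f(x_0)$ for $l=1,\dots,N$, and initialize instance $l$ of $\mathtt{fom}$ on $\Phi_{\tau^{(l)}_0}$ with target accuracy $\delta^{(l)}$ at $y^{(l)}_0=x_0$. For $i=0,1,2,\dots$: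 (1) for each $l$ set $\tau^{(l)}_{i+1}=\tau^{(l)}_i$ and let $y^{(l)}_{i+1}$ be the next iterate of instance $l$ (one step on $\Phi_{\tau^{(l)}_i}$); (2) let $y^{best}_{i+1}$ minimize $1/f$ (i.e. maximize $f$) among all iterates $y^{(l)}_{i'}$, $i'\le i+1$, $1\le l\le N$, produced so far that lie in $\mathcal S$, and $\tau^{best}_{i+1}=1/f(y^{best}_{i+1})$; (3) for each $l$ with $\tau^{best}_{i+1}\le\frac{1}{1+\delta^{(l)}}\tau^{(l)}_i$, set $\tau^{(l)}_{i+1}=\tau^{best}_{i+1}$ and restart (reinitialize all variables of) instance $l$ on $\Phi_{\tau^{(l)}_{i+1}}$ with target accuracy $\delta^{(l)}$ at $y^{(l)}_{i+1}=y^{best}_{i+1}$. *)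

theory Defs
  imports "HOL-Analysis.Analysis"
begin

section \<open>Extended-valued functions\<close>

definition eff_dom :: "('a \<Rightarrow> ennreal) \<Rightarrow> 'a set" where
  "eff_dom f = {x. 0 < f x \<and> f x < \<infinity>}"

definition hypograph :: "('a \<Rightarrow> ennreal) \<Rightarrow> ('a \<times> real) set" where
  "hypograph f = {(x, u). 0 < u \<and> ennreal u \<le> f x}"

definition concave_ennreal :: "('a::real_vector \<Rightarrow> ennreal) \<Rightarrow> bool" where
  "concave_ennreal f \<longleftrightarrow> convex (hypograph f)"

definition upper_semicontinuous :: "('a::topological_space \<Rightarrow> ennreal) \<Rightarrow> bool" where
  "upper_semicontinuous f \<longleftrightarrow> (\<forall>x u. f x < u \<longrightarrow> (\<forall>\<^sub>F y in nhds x. f y < u))"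

section \<open>Smoothness of functions and sets\<close>

definition grad :: "('a::real_inner \<Rightarrow> real) \<Rightarrow> 'a \<Rightarrow> 'a" where
  "grad h x = (THE g. GDERIV h x :> g)"

definition smooth_fun_on :: "real \<Rightarrow> 'a::real_inner set \<Rightarrow> ('a \<Rightarrow> real) \<Rightarrow> bool" where
  "smooth_fun_on L U h \<longleftrightarrow> (\<forall>x\<in>U. h differentiable (at x)) \<and> L-lipschitz_on U (grad h)"

definition C2_on :: "'a::real_inner set \<Rightarrow> ('a \<Rightarrow> real) \<Rightarrow> bool" where
  "C2_on U h \<longleftrightarrow> (\<forall>x\<in>U. h differentiable (at x)) \<and>
     (\<exists>H :: 'a \<Rightarrow> 'a \<Rightarrow>\<^sub>L 'a.
        (\<forall>x\<in>U. (grad h has_derivative blinfun_apply (H x)) (at x)) \<and> continuous_on U H)"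

definition twice_cont_diff :: "('a::real_inner \<Rightarrow> ennreal) \<Rightarrow> bool" where
  "twice_cont_diff f \<longleftrightarrow> open (eff_dom f) \<and> C2_on (eff_dom f) (\<lambda>x. enn2real (f x))"

definition normal_cone :: "'a::real_inner set \<Rightarrow> 'a \<Rightarrow> 'a set" where
  "normal_cone S x = {\<xi>. \<forall>x'\<in>S. \<xi> \<bullet> (x' - x) \<le> 0}"

definition smooth_set :: "real \<Rightarrow> 'a::real_inner set \<Rightarrow> bool" where
  "smooth_set \<beta> S \<longleftrightarrow>
     (\<forall>x1\<in>frontier S. \<forall>x2\<in>frontier S. \<forall>\<xi>1\<in>normal_cone S x1. \<forall>\<xi>2\<in>normal_cone S x2.
        norm \<xi>1 = 1 \<longrightarrow> norm \<xi>2 = 1 \<longrightarrow> norm (\<xi>1 - \<xi>2) \<le> \<beta> * norm (x1 - x2))"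

section \<open>Gauges and radial transform\<close>

text \<open>The infima over the reals below are only meaningful for nonempty index sets. For the gauge
  this holds when \<open>e\<close> is interior to \<open>S\<close>, for the inner radius when \<open>S\<close> is not the whole space.\<close>

definition gauge_at :: "'a::real_vector set \<Rightarrow> 'a \<Rightarrow> 'a \<Rightarrow> real" where
  "gauge_at S e x = Inf {v. 0 < v \<and> e + (x - e) /\<^sub>R v \<in> S}"

definition inner_radius :: "'a::real_normed_vector \<Rightarrow> 'a set \<Rightarrow> real" where
  "inner_radius e S = (INF x\<in>-S. norm (x - e))"

text \<open>In \<^typ>\<open>ennreal\<close> the supremum of the empty set is \<open>0\<close>.\<close>

definition radial_transform :: "('a::real_vector \<Rightarrow> ennreal) \<Rightarrow> 'a \<Rightarrow> 'a \<Rightarrow> ennreal" where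
  "radial_transform f e y =
     Sup {ennreal v | v. 0 < v \<and> ennreal v * f (e + (y - e) /\<^sub>R v) \<le> 1}"

definition phi_set :: "'a::real_vector set \<Rightarrow> 'a \<Rightarrow> 'a \<Rightarrow> real" where
  "phi_set S e x =
     (if gauge_at S e x > 1 then gauge_at S e x else (gauge_at S e x)\<^sup>2 / 2 + 1 / 2)"

definition phi_max :: "nat \<Rightarrow> (nat \<Rightarrow> 'a::real_vector set) \<Rightarrow> (nat \<Rightarrow> 'a) \<Rightarrow> 'a \<Rightarrow> real" where
  "phi_max m S e x = Max ((\<lambda>j. phi_set (S j) (e j) x) ` {1..m})"

text \<open>The components \<open>h\<^sub>0 = (\<tau> f)\<^sup>\<Gamma>\<close> (taken at the centre \<open>e 0\<close>) and \<open>h\<^sub>j = \<phi>\<close> of \<open>S j\<close>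
  for \<open>1 \<le> j \<le> m\<close>, whose pointwise maximum is the function \<open>\<Phi>\<^sub>\<tau>\<close>. The smoothing method below
  accesses \<open>\<Phi>\<^sub>\<tau>\<close> only through them.\<close>

definition radial_components ::
  "('a::real_vector \<Rightarrow> ennreal) \<Rightarrow> (nat \<Rightarrow> 'a set) \<Rightarrow> (nat \<Rightarrow> 'a) \<Rightarrow> real \<Rightarrow> nat \<Rightarrow> 'a \<Rightarrow> real" where
  "radial_components f S e \<tau> j y =
     (if j = 0 then enn2real (radial_transform (\<lambda>x. ennreal \<tau> * f x) (e 0) y)
      else phi_set (S j) (e j) y)"

definition method_constants ::
  "nat \<Rightarrow> ('a::real_inner \<Rightarrow> ennreal) \<Rightarrow> (nat \<Rightarrow> 'a set) \<Rightarrow> (nat \<Rightarrow> 'a) \<Rightarrow> real set \<Rightarrow> real \<Rightarrow> real \<Rightarrow> bool"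
where
  "method_constants m f S e T L M \<longleftrightarrow>
     (\<forall>\<tau>\<in>T. \<forall>j\<in>{0..m}. smooth_fun_on L UNIV (radial_components f S e \<tau> j) \<and>
                           M-lipschitz_on UNIV (radial_components f S e \<tau> j))"

section \<open>Accelerated smoothing method\<close>

definition smooth_theta :: "nat \<Rightarrow> real \<Rightarrow> real" where
  "smooth_theta m \<delta> = \<delta> / (2 * ln (real m + 1))"

definition soft_max :: "nat \<Rightarrow> real \<Rightarrow> (nat \<Rightarrow> 'a \<Rightarrow> real) \<Rightarrow> 'a \<Rightarrow> real" where
  "soft_max m \<theta> h y = \<theta> * ln (\<Sum>j=0..m. exp (h j y / \<theta>))"

definition next_t :: "real \<Rightarrow> real" where
  "next_t t = (THE t'. 0 < t' \<and> t' < 1 \<and> t'\<^sup>2 = (1 - t') * t\<^sup>2)"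

text \<open>The state of the method is the triple \<open>(y\<^sub>i, z\<^sub>i, t\<^sub>i)\<close>.\<close>

type_synonym 'a smooth_state = "'a \<times> 'a \<times> real"

definition smooth_init :: "'a \<Rightarrow> 'a smooth_state" where
  "smooth_init x = (x, x, (-1 + sqrt 5) / 2)"

definition smooth_step ::
  "nat \<Rightarrow> real \<Rightarrow> real \<Rightarrow> (nat \<Rightarrow> 'a::real_inner \<Rightarrow> real) \<Rightarrow> real \<Rightarrow> 'a smooth_state \<Rightarrow> 'a smooth_state"
where
  "smooth_step m L M h \<delta> = (\<lambda>(y, z, t).
     let \<theta> = smooth_theta m \<delta>;
         L\<theta> = L + M\<^sup>2 / \<theta>;
         y' = z - (1 / L\<theta>) *\<^sub>R grad (soft_max m \<theta> h) z;
         t' = next_t t;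
         \<beta> = t * (1 - t) / (t\<^sup>2 + t')
     in (y', y' + \<beta> *\<^sub>R (y' - y), t'))"

section \<open>Parallel MultiRadial Method\<close>

text \<open>A first-order method is given by \<open>init\<close> (start at a point), \<open>step \<tau> \<delta>\<close> (one step on
  \<open>\<Phi>\<^sub>\<tau>\<close> with target accuracy \<open>\<delta>\<close>) and \<open>pt\<close> (the iterate \<open>y\<close> stored in a state).
  In a run, \<open>\<sigma> l i\<close> and \<open>\<tau> l i\<close> are the state and the parameter of instance \<open>l\<close> at the end
  of iteration \<open>i\<close>, i.e. after a possible restart, and \<open>ybest i\<close> is the best iterate,
  relevant for \<open>i \<ge> 1\<close> only. The state reached by the step in iteration \<open>i + 1\<close>, before a
  possible restart, is \<open>step (\<tau> l i) (\<delta> l) (\<sigma> l i)\<close>; a point put in place by a restart is itself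
  such an iterate or \<open>x0\<close>. Ties in the choice of \<open>ybest\<close> may be broken arbitrarily, so a run
  is a relation.\<close>

definition accuracy :: "real \<Rightarrow> nat \<Rightarrow> real" where
  "accuracy b l = 1 / b ^ l"

definition parallel_multiradial_run ::
  "('a \<Rightarrow> 's) \<Rightarrow> (real \<Rightarrow> real \<Rightarrow> 's \<Rightarrow> 's) \<Rightarrow> ('s \<Rightarrow> 'a) \<Rightarrow>
   ('a \<Rightarrow> ennreal) \<Rightarrow> 'a set \<Rightarrow> 'a \<Rightarrow> real \<Rightarrow> nat \<Rightarrow>
   (nat \<Rightarrow> nat \<Rightarrow> 's) \<Rightarrow> (nat \<Rightarrow> nat \<Rightarrow> real) \<Rightarrow> (nat \<Rightarrow> 'a) \<Rightarrow> bool"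
where
  "parallel_multiradial_run init step pt f S x0 b N \<sigma> \<tau> ybest \<longleftrightarrow>
     (\<forall>l\<in>{1..N}. \<sigma> l 0 = init x0 \<and> \<tau> l 0 = 1 / enn2real (f x0)) \<and>
     (\<forall>i.
        let produced = {x0} \<union>
              {pt (step (\<tau> l k) (accuracy b l) (\<sigma> l k)) | l k. l \<in> {1..N} \<and> k \<le> i};
            \<tau>best = 1 / enn2real (f (ybest (Suc i)))
        in is_arg_max f (\<lambda>y. y \<in> produced \<inter> S) (ybest (Suc i)) \<and>
           (\<forall>l\<in>{1..N}.
              if \<tau>best \<le> 1 / (1 + accuracy b l) * \<tau> l i
              then \<tau> l (Suc i) = \<tau>best \<and> \<sigma> l (Suc i) = init (ybest (Suc i))
              else \<tau> l (Suc i) = \<tau> l i \<and>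
                   \<sigma> l (Suc i) = step (\<tau> l i) (accuracy b l) (\<sigma> l i)))"

definition parallel_multiradial_smooth_run where
  "parallel_multiradial_smooth_run m L M f S e =
     parallel_multiradial_run smooth_init
       (\<lambda>\<tau>. smooth_step m L M (radial_components f S e \<tau>)) fst f (\<Inter>j\<in>{1..m}. S j)"

end

theory Submission
  imports Defs "HOL-Probability.Hoeffding"
begin

text \<open>Each component of \<open>\<Phi>\<^sub>\<tau>\<close> is convex with an explicit Lipschitz subgradient selection, which forces
  differentiability: for \<open>x = e + (y - e)/v\<close>, where \<open>v\<close> is the value at \<open>y\<close>, the subgradient of the
  radial transform is \<open>-\<nabla>f(x)/(f(x) - \<langle>\<nabla>f(x), x - e\<rangle>)\<close> and that of a gauge is
  \<open>\<xi>/\<langle>\<xi>, x - e\<rangle>\<close> for the unit normal \<open>\<xi>\<close> at \<open>x\<close>. Hoeffding's lemma gives the smoothed maximum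
  the smoothness constant \<open>L + M\<^sup>2/\<theta>\<close>, so the accelerated method reaches accuracy \<open>\<delta>\<close> in
  \<open>O(1/\<delta>)\<close> steps.

  On the segment from the maximizer to the Slater point \<open>\<Phi>\<^sub>\<tau>\<close> takes a value of at most
  \<open>1 - c (\<tau> p - 1)\<close>. Hence, as long as \<open>c (\<tau> p - 1) \<ge> 2 \<delta>/\<rho>\<close>, instance \<open>l\<close> restarts after
  \<open>O(b\<^sup>l)\<close> steps and every restart decreases \<open>\<tau> p\<close> by at least \<open>\<delta>/2\<close>, where \<open>\<delta> = b\<^sup>-\<^sup>l\<close>. Once
  the previous level has brought \<open>\<tau> p - 1\<close> down to \<open>O(b \<delta>)\<close>, a bounded number of restarts suffices
  for the next one, and the times spent on the levels form a geometric sum.\<close>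

text \<open>One pair of constants has to serve all parameters \<tau> at once. The subgradient at y
  is read off at a point x = e + (y - e)/v, and x moves fast when v is small. For the radial
  transform, \<tau> \<le> 1/f(x0) keeps v away from 0. For a gauge, v does vanish at the centre, and
  the quadratic branch of \<phi> supplies the factor v that compensates for it. The iteration bound
  must be independent of N although all instances share their best point. Sharing can only help: a
  better common point lowers the parameters of the other instances. So it suffices to follow the
  levels up to the first one that is fine enough for \<epsilon>. The restart analysis is therefore
  separated from the first-order method, of which it knows only that enough undisturbed steps from a
  feasible point with f \<ge> f(x0) gain a factor 1 + \<delta>. Such starting points lie in dom f,
  hence within D0 of every comparison point in dom f, which makes the step count uniform over all
  restarts.\<close>

section \<open>Gradients, Lipschitz subgradients and the descent lemma\<close>

lemma gderiv_unique:
  assumes "GDERIV h x :> g" "GDERIV h x :> g'"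
  shows "g = g'"
proof -
  have "(\<lambda>v. v \<bullet> g) = (\<lambda>v. v \<bullet> g')"
    using assms has_derivative_unique unfolding gderiv_def by blast
  from fun_cong[OF this, of "g - g'"] have "(g - g') \<bullet> (g - g') = 0"
    by (simp add: inner_diff_right)
  thus ?thesis by simp
qed

lemma gderiv_imp_grad: "GDERIV h x :> g \<Longrightarrow> grad h x = g"
  unfolding grad_def using gderiv_unique by blast

lemma differentiable_imp_gderiv:
  fixes h :: "'a::euclidean_space \<Rightarrow> real"
  assumes "h differentiable (at x)"
  shows "GDERIV h x :> grad h x"
proof -
  from assms obtain f' where f': "(h has_derivative f') (at x)"
    unfolding differentiable_def by blast
  hence "linear f'" using has_derivative_linear by blast
  hence "f' = (\<lambda>v. v \<bullet> adjoint f' 1)"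
    using adjoint_works[of f' _ 1] by (simp add: fun_eq_iff)
  with f' have "GDERIV h x :> adjoint f' 1"
    unfolding gderiv_def by simp
  thus ?thesis using gderiv_imp_grad by fastforce
qed

lemma smooth_fun_on_gderiv:
  fixes h :: "'a::euclidean_space \<Rightarrow> real"
  shows "smooth_fun_on L U h \<Longrightarrow> x \<in> U \<Longrightarrow> GDERIV h x :> grad h x"
  unfolding smooth_fun_on_def by (blast intro: differentiable_imp_gderiv)

text \<open>The subgradient inequalities at x and at y squeeze the remainder between 0 and (G y - G
  x) \<bullet> (y - x), which is at most L |y - x|^2.\<close>

lemma lipschitz_subgradient_gderiv:
  fixes H :: "'a::euclidean_space \<Rightarrow> real"
  assumes sub: "\<And>x y. H x + G x \<bullet> (y - x) \<le> H y" and lip: "L-lipschitz_on UNIV G"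
  shows "GDERIV H x :> G x"
  unfolding gderiv_def
proof (rule has_derivativeI_sandwich[where e = 1 and H = "\<lambda>y. L * norm (y - x)"])
  show "bounded_linear (\<lambda>v. v \<bullet> G x)" by (rule bounded_linear_inner_left)
  show "norm (H y - H x - (y - x) \<bullet> G x) / norm (y - x) \<le> L * norm (y - x)" if "y \<noteq> x" for y
  proof -
    have "H y - H x - (y - x) \<bullet> G x \<ge> 0"
      using sub[of x y] by (simp add: inner_commute)
    moreover have "H y - H x - (y - x) \<bullet> G x \<le> (G y - G x) \<bullet> (y - x)"
      using sub[of y x] by (simp add: inner_commute inner_diff_left inner_diff_right)
    moreover have "(G y - G x) \<bullet> (y - x) \<le> norm (G y - G x) * norm (y - x)"
      by (rule norm_cauchy_schwarz)
    moreover have "norm (G y - G x) * norm (y - x) \<le> (L * norm (y - x)) * norm (y - x)"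
      by (intro mult_right_mono lipschitz_on_normD[OF lip]) auto
    ultimately have "norm (H y - H x - (y - x) \<bullet> G x) \<le> (L * norm (y - x)) * norm (y - x)" by simp
    thus ?thesis using that by (simp add: divide_le_eq)
  qed
  show "((\<lambda>y. L * norm (y - x)) \<longlongrightarrow> 0) (at x)"
    by (rule tendsto_eq_intros refl | simp)+
qed auto

lemma bounded_subgradient_lipschitz:
  fixes H :: "'a::real_inner \<Rightarrow> real"
  assumes sub: "\<And>x y. H x + G x \<bullet> (y - x) \<le> H y" and bnd: "\<And>x. norm (G x) \<le> M"
  shows "M-lipschitz_on UNIV H"
proof -
  have "H x - H y \<le> M * norm (x - y)" for x y
  proof -
    have "H x - H y \<le> G x \<bullet> (x - y)" using sub[of x y] by (simp add: inner_diff_right)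
    also have "\<dots> \<le> norm (G x) * norm (x - y)" by (rule norm_cauchy_schwarz)
    also have "\<dots> \<le> M * norm (x - y)" by (intro mult_right_mono bnd) auto
    finally show ?thesis .
  qed
  from this[of x y for x y] this[of y x for x y]
  have "\<bar>H x - H y\<bar> \<le> M * norm (x - y)" for x y by (smt (verit) norm_minus_commute)
  thus ?thesis
    by (intro lipschitz_onI) (auto simp: dist_norm intro: order_trans[OF norm_ge_zero bnd])
qed

lemma lipschitz_subgradient_smooth:
  fixes H :: "'a::euclidean_space \<Rightarrow> real"
  assumes sub: "\<And>x y. H x + G x \<bullet> (y - x) \<le> H y" and lip: "L-lipschitz_on UNIV G"
  shows "grad H = G" "smooth_fun_on L UNIV H"
proof -
  have gd: "GDERIV H x :> G x" for x using sub lip by (rule lipschitz_subgradient_gderiv)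
  show G: "grad H = G" using gd gderiv_imp_grad by blast
  show "smooth_fun_on L UNIV H"
    unfolding smooth_fun_on_def G using gd lip by (auto simp: gderiv_def differentiable_def)
qed

text \<open>Along the direction g the derivative is |g|^2, while the difference quotients are at
  most M |g|.\<close>

lemma lipschitz_gderiv_norm_le:
  assumes gd: "GDERIV h x :> g" and lip: "M-lipschitz_on UNIV h"
  shows "norm g \<le> M"
proof (cases "g = 0")
  case True
  thus ?thesis using lipschitz_on_nonneg[OF lip] by simp
next
  case False
  have "((\<lambda>s. h (x + s *\<^sub>R g)) has_derivative (\<lambda>s. (s *\<^sub>R g) \<bullet> g)) (at 0)"
    by (rule has_derivative_compose[of "\<lambda>s. x + s *\<^sub>R g" "\<lambda>s. s *\<^sub>R g" 0 UNIV h])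
       (use gd in \<open>auto simp: gderiv_def intro!: derivative_eq_intros\<close>)
  hence "((\<lambda>s. h (x + s *\<^sub>R g)) has_real_derivative (g \<bullet> g)) (at 0)"
    by (simp add: has_field_derivative_def mult_commute_abs)
  hence lim: "((\<lambda>s. (h (x + s *\<^sub>R g) - h x) / s) \<longlongrightarrow> g \<bullet> g) (at 0)"
    by (simp add: DERIV_def)
  have "g \<bullet> g \<le> M * norm g"
  proof (rule tendsto_upperbound[OF lim])
    have "(h (x + s *\<^sub>R g) - h x) / s \<le> M * norm g" if "s \<noteq> 0" for s
    proof -
      have "\<bar>(h (x + s *\<^sub>R g) - h x) / s\<bar> = \<bar>h (x + s *\<^sub>R g) - h x\<bar> / \<bar>s\<bar>" by simp
      also have "\<dots> \<le> (M * (\<bar>s\<bar> * norm g)) / \<bar>s\<bar>"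
        using lipschitz_on_normD[OF lip, of "x + s *\<^sub>R g" x] by (intro divide_right_mono) auto
      also have "\<dots> = M * norm g" using that by simp
      finally show ?thesis by linarith
    qed
    thus "\<forall>\<^sub>F s in at 0. (h (x + s *\<^sub>R g) - h x) / s \<le> M * norm g"
      by (auto simp: eventually_at_filter)
  qed auto
  hence "norm g * norm g \<le> M * norm g"
    by (simp add: power2_norm_eq_inner[symmetric] power2_eq_square)
  thus ?thesis using False by simp
qed

lemma smooth_descent:
  fixes h :: "'a::euclidean_space \<Rightarrow> real"
  assumes sm: "smooth_fun_on L UNIV h"
  shows "h y \<le> h x + grad h x \<bullet> (y - x) + L / 2 * (norm (y - x))\<^sup>2"
proof -
  define d where "d = y - x"
  \<comment> \<open>The error of the quadratic model along the segment; the Lipschitz gradient makes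
    its derivative nonpositive.\<close>
  define \<psi> where "\<psi> = (\<lambda>s. h (x + s *\<^sub>R d) - s * (grad h x \<bullet> d) - L / 2 * s\<^sup>2 * (norm d)\<^sup>2)"
  have lip: "L-lipschitz_on UNIV (grad h)" using sm by (simp add: smooth_fun_on_def)
  have der: "(\<psi> has_real_derivative
      (d \<bullet> grad h (x + s *\<^sub>R d) - grad h x \<bullet> d - L * s * (norm d)\<^sup>2)) (at s)" for s
  proof -
    have "((\<lambda>s. h (x + s *\<^sub>R d)) has_derivative (\<lambda>u. (u *\<^sub>R d) \<bullet> grad h (x + s *\<^sub>R d))) (at s)"
      by (rule has_derivative_compose[of "\<lambda>s. x + s *\<^sub>R d" "\<lambda>s. s *\<^sub>R d" s UNIV h])
         (use smooth_fun_on_gderiv[OF sm, of "x + s *\<^sub>R d"] in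
           \<open>auto simp: gderiv_def intro!: derivative_eq_intros\<close>)
    hence "((\<lambda>s. h (x + s *\<^sub>R d)) has_real_derivative (d \<bullet> grad h (x + s *\<^sub>R d))) (at s)"
      by (simp add: has_field_derivative_def mult_commute_abs)
    thus ?thesis unfolding \<psi>_def by (auto intro!: derivative_eq_intros)
  qed
  have "\<psi> 1 \<le> \<psi> 0"
  proof (rule DERIV_nonpos_imp_nonincreasing[of 0 1 \<psi>])
    fix s :: real assume s: "0 \<le> s" "s \<le> 1"
    have "d \<bullet> grad h (x + s *\<^sub>R d) - grad h x \<bullet> d = (grad h (x + s *\<^sub>R d) - grad h x) \<bullet> d"
      by (simp add: inner_commute inner_diff_right)
    also have "\<dots> \<le> norm (grad h (x + s *\<^sub>R d) - grad h x) * norm d" by (rule norm_cauchy_schwarz)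
    also have "\<dots> \<le> (L * (s * norm d)) * norm d"
      using lipschitz_on_normD[OF lip, of "x + s *\<^sub>R d" x] s by (intro mult_right_mono) auto
    finally have "d \<bullet> grad h (x + s *\<^sub>R d) - grad h x \<bullet> d - L * s * (norm d)\<^sup>2 \<le> 0"
      by (simp add: power2_eq_square mult.assoc)
    with der show "\<exists>y. DERIV \<psi> s :> y \<and> y \<le> 0" by blast
  qed auto
  thus ?thesis by (simp add: \<psi>_def d_def)
qed

section \<open>The smoothed maximum\<close>

lemma ln_le_of_le_exp: "0 < x \<Longrightarrow> x \<le> exp y \<Longrightarrow> ln x \<le> (y::real)"
  using ln_le_cancel_iff[of x "exp y"] by simp

text \<open>Jensen's inequality for exp, by averaging the tangent at the mean.\<close>

lemma exp_weighted_mean_le: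
  fixes p a :: "'i \<Rightarrow> real"
  assumes "finite J" "\<And>j. j \<in> J \<Longrightarrow> 0 \<le> p j" "(\<Sum>j\<in>J. p j) = 1"
  shows "exp (\<Sum>j\<in>J. p j * a j) \<le> (\<Sum>j\<in>J. p j * exp (a j))"
proof -
  define \<mu> where "\<mu> = (\<Sum>j\<in>J. p j * a j)"
  have "(\<Sum>j\<in>J. p j * (exp \<mu> * (1 + (a j - \<mu>)))) =
      exp \<mu> * (1 - \<mu>) * (\<Sum>j\<in>J. p j) + exp \<mu> * (\<Sum>j\<in>J. p j * a j)"
    by (simp add: sum.distrib[symmetric] sum_distrib_left algebra_simps)
  hence "exp \<mu> = (\<Sum>j\<in>J. p j * (exp \<mu> * (1 + (a j - \<mu>))))"
    unfolding assms(3) \<mu>_def[symmetric] by (simp add: algebra_simps)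
  also have "\<dots> \<le> (\<Sum>j\<in>J. p j * exp (a j))"
  proof (intro sum_mono mult_left_mono assms)
    fix j
    have "exp \<mu> * (1 + (a j - \<mu>)) \<le> exp \<mu> * exp (a j - \<mu>)"
      by (intro mult_left_mono exp_ge_add_one_self) auto
    thus "exp \<mu> * (1 + (a j - \<mu>)) \<le> exp (a j)" by (simp add: exp_diff)
  qed
  finally show ?thesis by (simp add: \<mu>_def)
qed

text \<open>Hoeffding's lemma for a finite distribution on [-A, A], not centred. The chord of exp
  over [-A, A] reduces it to the two-point distribution on the endpoints with the same mean.\<close>

lemma weighted_mean_exp_le:
  fixes p a :: "'i \<Rightarrow> real"
  assumes fin: "finite J" and p: "\<And>j. j \<in> J \<Longrightarrow> 0 \<le> p j" "(\<Sum>j\<in>J. p j) = 1"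
    and a: "\<And>j. j \<in> J \<Longrightarrow> \<bar>a j\<bar> \<le> A" and A0: "A \<ge> 0"
  shows "(\<Sum>j\<in>J. p j * exp (a j)) \<le> exp ((\<Sum>j\<in>J. p j * a j) + A\<^sup>2 / 2)"
proof (cases "A = 0")
  case True
  with a have "a j = 0" if "j \<in> J" for j using that by fastforce
  thus ?thesis by (simp add: True p)
next
  case False
  with A0 have A: "A > 0" by simp
  define \<mu> where "\<mu> = (\<Sum>j\<in>J. p j * a j)"
  \<comment> \<open>The mass of the two-point distribution at A. Its division by A is the reason for
    treating A = 0 apart.\<close>
  define q where "q = (\<mu> + A) / (2 * A)"
  define k where "k = (exp (2 * A) - 1) / (2 * A)"
  have "\<mu> \<ge> (\<Sum>j\<in>J. p j * (- A))"
    unfolding \<mu>_def using a p by (intro sum_mono mult_left_mono) (auto simp: abs_le_iff minus_le_iff)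
  hence \<mu>: "\<mu> \<ge> - A" using p by (simp add: sum_distrib_right[symmetric] sum_negf)
  hence q0: "q \<ge> 0" using A by (simp add: q_def)
  have "exp (a j) \<le> exp (-A) * (1 + (a j + A) / (2 * A) * (exp (2 * A) - 1))" if "j \<in> J" for j
  proof -
    define t where "t = (a j + A) / (2 * A)"
    have t: "0 \<le> t" "t \<le> 1" using a[OF that] A by (auto simp: t_def)
    have aj: "a j = (1 - t) * (-A) + t * A" using A by (simp add: t_def field_simps)
    have "convex_on UNIV (exp :: real \<Rightarrow> real)" using convex_on_exp[of 1] by simp
    from convex_onD[OF this t, of "-A" A]
    have "exp (a j) \<le> (1 - t) * exp (-A) + t * exp A" by (simp add: aj)
    also have "exp A = exp (-A) * exp (2 * A)" by (simp flip: exp_add)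
    also have "(1 - t) * exp (-A) + t * (exp (-A) * exp (2 * A)) =
        exp (-A) * (1 + t * (exp (2 * A) - 1))" by (simp add: algebra_simps)
    finally show ?thesis by (simp add: t_def)
  qed
  hence "(\<Sum>j\<in>J. p j * exp (a j)) \<le>
      (\<Sum>j\<in>J. p j * (exp (-A) * (1 + (a j + A) / (2 * A) * (exp (2 * A) - 1))))"
    by (intro sum_mono mult_left_mono p)
  also have "\<dots> = (\<Sum>j\<in>J. exp (-A) * p j + exp (-A) * k * (p j * a j) + exp (-A) * k * A * p j)"
    by (intro sum.cong) (simp_all add: k_def algebra_simps add_divide_distrib diff_divide_distrib)
  also have "\<dots> = exp (-A) * (\<Sum>j\<in>J. p j) + exp (-A) * k * (\<Sum>j\<in>J. p j * a j)
       + exp (-A) * k * A * (\<Sum>j\<in>J. p j)"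
    by (simp only: sum.distrib sum_distrib_left)
  also have "\<dots> = exp (-A) * (1 + q * (exp (2 * A) - 1))"
    unfolding p(2) \<mu>_def[symmetric] using False by (simp add: q_def k_def field_simps)
  also have "\<dots> \<le> exp (-A) * exp (2 * A * q + A\<^sup>2 / 2)"
  proof (intro mult_left_mono)
    have pos: "1 + q * (exp (2 * A) - 1) > 0"
      using q0 A by (intro add_pos_nonneg mult_nonneg_nonneg) auto
    have "ln (1 + q * (exp (2 * A) - 1)) \<le> 2 * A * q + A\<^sup>2 / 2"
      using Hoeffdings_lemma_aux[of "2 * A" q] q0 A by (simp add: power2_eq_square)
    thus "1 + q * (exp (2 * A) - 1) \<le> exp (2 * A * q + A\<^sup>2 / 2)"
      using pos by (metis exp_le_cancel_iff exp_ln)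
  qed auto
  also have "\<dots> = exp (\<mu> + A\<^sup>2 / 2)"
    using A by (simp flip: exp_add add: q_def)
  finally show ?thesis by (simp add: \<mu>_def)
qed

text \<open>These weights are the coefficients with which the component gradients enter the gradient
  of \<open>soft_max\<close>, which is thus a convex combination of them.\<close>

definition soft_weight :: "nat \<Rightarrow> real \<Rightarrow> (nat \<Rightarrow> 'a \<Rightarrow> real) \<Rightarrow> 'a \<Rightarrow> nat \<Rightarrow> real" where
  "soft_weight m \<theta> h y j = exp (h j y / \<theta>) / (\<Sum>i=0..m. exp (h i y / \<theta>))"

lemma sum_exp_pos: "(\<Sum>j=0..m::nat. exp (f j :: real)) > 0"
  by (intro sum_pos) auto

lemma soft_weight_nonneg: "soft_weight m \<theta> h y j \<ge> 0"
  unfolding soft_weight_def using sum_exp_pos[of "\<lambda>i. h i y / \<theta>" m] by simp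

lemma sum_soft_weight: "(\<Sum>j=0..m. soft_weight m \<theta> h y j) = 1"
  unfolding soft_weight_def using sum_exp_pos[of "\<lambda>i. h i y / \<theta>" m]
  by (simp flip: sum_divide_distrib)

lemma le_soft_max:
  assumes "\<theta> > 0" "j \<le> m"
  shows "h j y \<le> soft_max m \<theta> h y"
proof -
  have "exp (h j y / \<theta>) \<le> (\<Sum>j=0..m. exp (h j y / \<theta>))"
    using assms by (intro member_le_sum) auto
  hence "h j y / \<theta> \<le> ln (\<Sum>j=0..m. exp (h j y / \<theta>))"
    using sum_exp_pos by (simp add: ln_ge_iff)
  thus ?thesis using assms by (simp add: soft_max_def field_simps)
qed

lemma soft_max_le:
  assumes "\<theta> > 0" "\<And>j. j \<le> m \<Longrightarrow> h j y \<le> B"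
  shows "soft_max m \<theta> h y \<le> B + \<theta> * ln (real m + 1)"
proof -
  have "(\<Sum>j=0..m. exp (h j y / \<theta>)) \<le> (\<Sum>j=0..m. exp (B / \<theta>))"
    using assms by (intro sum_mono) (auto simp: divide_right_mono)
  also have "\<dots> = (real m + 1) * exp (B / \<theta>)" by simp
  finally have "ln (\<Sum>j=0..m. exp (h j y / \<theta>)) \<le> ln ((real m + 1) * exp (B / \<theta>))"
    using sum_exp_pos by (subst ln_le_cancel_iff) auto
  also have "\<dots> = ln (real m + 1) + B / \<theta>" by (simp add: ln_mult)
  finally show ?thesis using assms unfolding soft_max_def
    by (simp add: field_simps)
qed

text \<open>An exact increment formula. Bounding the weighted exponential mean from below (Jensen)
  yields convexity, and from above (Hoeffding) yields the quadratic upper model.\<close>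

lemma soft_max_diff:
  assumes "\<theta> > 0"
  shows "soft_max m \<theta> h w = soft_max m \<theta> h z +
    \<theta> * ln (\<Sum>j=0..m. soft_weight m \<theta> h z j * exp ((h j w - h j z) / \<theta>))"
proof -
  define s where "s = (\<Sum>j=0..m. exp (h j z / \<theta>))"
  have s: "s > 0" unfolding s_def by (rule sum_exp_pos)
  have "soft_weight m \<theta> h z j * exp ((h j w - h j z) / \<theta>) = exp (h j w / \<theta>) / s" for j
    by (simp add: soft_weight_def s_def[symmetric] diff_divide_distrib exp_diff)
  hence "(\<Sum>j=0..m. soft_weight m \<theta> h z j * exp ((h j w - h j z) / \<theta>)) = (\<Sum>j=0..m. exp (h j w / \<theta>)) / s"
    by (simp add: sum_divide_distrib)
  thus ?thesis using s sum_exp_pos[of "\<lambda>i. h i w / \<theta>" m]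
    by (simp add: soft_max_def s_def[symmetric] ln_div algebra_simps)
qed

lemma soft_max_gderiv:
  assumes "\<theta> > 0" "\<And>j. j \<le> m \<Longrightarrow> GDERIV (h j) y :> grad (h j) y"
  shows "GDERIV (soft_max m \<theta> h) y :> (\<Sum>j=0..m. soft_weight m \<theta> h y j *\<^sub>R grad (h j) y)"
proof -
  define s where "s = (\<Sum>j=0..m. exp (h j y / \<theta>))"
  have s: "(\<Sum>j=0..m. exp (h j y / \<theta>)) > 0" by (rule sum_exp_pos)
  have "((\<lambda>y. exp (h j y / \<theta>)) has_derivative (\<lambda>v. exp (h j y / \<theta>) * ((v \<bullet> grad (h j) y) / \<theta>))) (at y)"
    if "j \<le> m" for j
    using assms(2)[OF that] assms(1) unfolding gderiv_def
    by (auto intro!: derivative_eq_intros)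
  hence der: "((\<lambda>y. \<Sum>j=0..m. exp (h j y / \<theta>)) has_derivative
      (\<lambda>v. \<Sum>j=0..m. exp (h j y / \<theta>) * ((v \<bullet> grad (h j) y) / \<theta>))) (at y)"
    by (intro has_derivative_sum) auto
  have "(soft_max m \<theta> h has_derivative
      (\<lambda>v. \<theta> * ((\<Sum>j=0..m. exp (h j y / \<theta>) * ((v \<bullet> grad (h j) y) / \<theta>)) * inverse s))) (at y)"
    unfolding soft_max_def[abs_def] s_def
    by (rule has_derivative_mult_right[OF has_derivative_ln[OF s der]])
  moreover have "(\<lambda>v. \<theta> * ((\<Sum>j=0..m. exp (h j y / \<theta>) * ((v \<bullet> grad (h j) y) / \<theta>)) * inverse s)) =
     (\<lambda>v. v \<bullet> (\<Sum>j=0..m. soft_weight m \<theta> h y j *\<^sub>R grad (h j) y))"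
    using assms(1)
    by (simp add: fun_eq_iff inner_sum_right soft_weight_def flip: s_def)
      (auto simp: sum_distrib_left sum_distrib_right field_simps intro!: sum.cong)
  ultimately show ?thesis by (simp add: gderiv_def)
qed

lemma soft_max_above_tangent:
  assumes \<theta>: "\<theta> > 0" and gd: "\<And>j y. j \<le> m \<Longrightarrow> GDERIV (h j) y :> grad (h j) y"
    and cvx: "\<And>j y. j \<le> m \<Longrightarrow> h j z + grad (h j) z \<bullet> (w - z) \<le> h j w"
  shows "soft_max m \<theta> h z + grad (soft_max m \<theta> h) z \<bullet> (w - z) \<le> soft_max m \<theta> h w"
proof -
  let ?p = "soft_weight m \<theta> h z"
  have g: "grad (soft_max m \<theta> h) z \<bullet> (w - z) = (\<Sum>j=0..m. ?p j * (grad (h j) z \<bullet> (w - z)))"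
    using gderiv_imp_grad[OF soft_max_gderiv[OF \<theta> gd]] by (simp add: inner_sum_left)
  have "exp (\<Sum>j=0..m. ?p j * ((grad (h j) z \<bullet> (w - z)) / \<theta>)) \<le>
     (\<Sum>j=0..m. ?p j * exp ((grad (h j) z \<bullet> (w - z)) / \<theta>))"
    by (intro exp_weighted_mean_le soft_weight_nonneg sum_soft_weight) auto
  also have "\<dots> \<le> (\<Sum>j=0..m. ?p j * exp ((h j w - h j z) / \<theta>))"
    using cvx \<theta> by (intro sum_mono mult_left_mono soft_weight_nonneg)
      (auto intro!: divide_right_mono simp: algebra_simps)
  finally have "(\<Sum>j=0..m. ?p j * ((grad (h j) z \<bullet> (w - z)) / \<theta>)) \<le>
      ln (\<Sum>j=0..m. ?p j * exp ((h j w - h j z) / \<theta>))"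
    using less_le_trans[OF exp_gt_zero] by (subst ln_ge_iff) blast+
  hence "\<theta> * (\<Sum>j=0..m. ?p j * ((grad (h j) z \<bullet> (w - z)) / \<theta>)) \<le>
     \<theta> * ln (\<Sum>j=0..m. ?p j * exp ((h j w - h j z) / \<theta>))" using \<theta> by simp
  also have "\<theta> * (\<Sum>j=0..m. ?p j * ((grad (h j) z \<bullet> (w - z)) / \<theta>)) = grad (soft_max m \<theta> h) z \<bullet> (w - z)"
    using \<theta> by (simp add: g sum_distrib_left)
  finally show ?thesis using soft_max_diff[OF \<theta>, of m h w z] by simp
qed

text \<open>The components have only Lipschitz gradients, so no Hessian is used. Their linear parts,
  divided by \<theta>, lie in [-M d/\<theta>, M d/\<theta>]; Hoeffding's lemma turns this range into
  the curvature M^2/\<theta>.\<close>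

lemma soft_max_descent:
  fixes h :: "nat \<Rightarrow> 'a::euclidean_space \<Rightarrow> real"
  assumes \<theta>: "\<theta> > 0"
    and sm: "\<And>j. j \<le> m \<Longrightarrow> smooth_fun_on L UNIV (h j)"
    and lip: "\<And>j. j \<le> m \<Longrightarrow> M-lipschitz_on UNIV (h j)"
  shows "soft_max m \<theta> h w \<le> soft_max m \<theta> h z + grad (soft_max m \<theta> h) z \<bullet> (w - z)
           + (L + M\<^sup>2 / \<theta>) / 2 * (norm (w - z))\<^sup>2"
proof -
  let ?p = "soft_weight m \<theta> h z"
  define d where "d = norm (w - z)"
  have M: "M \<ge> 0" using lip[of 0] lipschitz_on_nonneg by blast
  have d: "d \<ge> 0" by (simp add: d_def)
  define a where "a = (\<lambda>j. grad (h j) z \<bullet> (w - z))"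
  have g: "grad (soft_max m \<theta> h) z \<bullet> (w - z) = (\<Sum>j=0..m. ?p j * a j)"
    using gderiv_imp_grad[OF soft_max_gderiv[OF \<theta> smooth_fun_on_gderiv[OF sm]]]
    by (simp add: inner_sum_left a_def)
  have ab: "\<bar>a j / \<theta>\<bar> \<le> M * d / \<theta>" if "j \<le> m" for j
  proof -
    have "norm (grad (h j) z) \<le> M"
      using lipschitz_gderiv_norm_le smooth_fun_on_gderiv[OF sm[OF that]] lip[OF that] by blast
    hence "norm (grad (h j) z) * norm (w - z) \<le> M * d"
      unfolding d_def by (intro mult_right_mono) auto
    moreover have "\<bar>a j\<bar> \<le> norm (grad (h j) z) * norm (w - z)"
      unfolding a_def by (rule Cauchy_Schwarz_ineq2)
    ultimately show ?thesis using \<theta> by (simp add: divide_right_mono)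
  qed
  \<comment> \<open>The curvature of the components, the same for all j, so that it factors out of
    the weighted mean.\<close>
  define B where "B = L / 2 * d\<^sup>2 / \<theta>"
  have "(\<Sum>j=0..m. ?p j * exp ((h j w - h j z) / \<theta>)) \<le> (\<Sum>j=0..m. ?p j * (exp B * exp (a j / \<theta>)))"
  proof (intro sum_mono mult_left_mono soft_weight_nonneg)
    fix j assume "j \<in> {0..m}"
    hence "h j w - h j z \<le> L / 2 * d\<^sup>2 + a j"
      using smooth_descent[OF sm, of j w z] by (simp add: a_def d_def)
    hence "(h j w - h j z) / \<theta> \<le> B + a j / \<theta>"
      using divide_right_mono[of "h j w - h j z" "L / 2 * d\<^sup>2 + a j" \<theta>] \<theta>
      unfolding B_def by (simp add: add_divide_distrib)
    thus "exp ((h j w - h j z) / \<theta>) \<le> exp B * exp (a j / \<theta>)" by (simp flip: exp_add)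
  qed
  also have "\<dots> = exp B * (\<Sum>j=0..m. ?p j * exp (a j / \<theta>))"
    by (simp add: sum_distrib_left mult_ac)
  also have "\<dots> \<le> exp B * exp ((\<Sum>j=0..m. ?p j * (a j / \<theta>)) + (M * d / \<theta>)\<^sup>2 / 2)"
    using M d \<theta> by (intro mult_left_mono weighted_mean_exp_le soft_weight_nonneg sum_soft_weight)
      (use ab in simp_all)
  also have "\<dots> = exp (B + (\<Sum>j=0..m. ?p j * (a j / \<theta>)) + (M * d / \<theta>)\<^sup>2 / 2)"
    by (simp flip: exp_add)
  finally have le: "(\<Sum>j=0..m. ?p j * exp ((h j w - h j z) / \<theta>)) \<le>
    exp (B + (\<Sum>j=0..m. ?p j * (a j / \<theta>)) + (M * d / \<theta>)\<^sup>2 / 2)" .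
  have "exp (\<Sum>j=0..m. ?p j * ((h j w - h j z) / \<theta>)) \<le> (\<Sum>j=0..m. ?p j * exp ((h j w - h j z) / \<theta>))"
    by (intro exp_weighted_mean_le soft_weight_nonneg sum_soft_weight) auto
  hence "(\<Sum>j=0..m. ?p j * exp ((h j w - h j z) / \<theta>)) > 0"
    using exp_gt_zero less_le_trans by blast
  hence "ln (\<Sum>j=0..m. ?p j * exp ((h j w - h j z) / \<theta>)) \<le>
    B + (\<Sum>j=0..m. ?p j * (a j / \<theta>)) + (M * d / \<theta>)\<^sup>2 / 2"
    using le by (rule ln_le_of_le_exp)
  hence "\<theta> * ln (\<Sum>j=0..m. ?p j * exp ((h j w - h j z) / \<theta>)) \<le>
    \<theta> * (B + (\<Sum>j=0..m. ?p j * (a j / \<theta>)) + (M * d / \<theta>)\<^sup>2 / 2)"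
    using \<theta> by simp
  also have "\<dots> = (\<Sum>j=0..m. ?p j * a j) + (L + M\<^sup>2 / \<theta>) / 2 * d\<^sup>2"
  proof -
    have "\<theta> * (\<Sum>j=0..m. ?p j * (a j / \<theta>)) = (\<Sum>j=0..m. ?p j * a j)"
      using \<theta> by (simp add: sum_distrib_left)
    moreover have "\<theta> * B = L / 2 * d\<^sup>2" "\<theta> * ((M * d / \<theta>)\<^sup>2 / 2) = M\<^sup>2 / \<theta> / 2 * d\<^sup>2"
      using \<theta> by (simp_all add: B_def power2_eq_square)
    ultimately show ?thesis by (simp add: distrib_left distrib_right add_divide_distrib)
  qed
  finally show ?thesis
    using soft_max_diff[OF \<theta>, of m h w z] by (simp add: g d_def)
qed

section \<open>The radial transform of a concave function\<close>

text \<open>Here x is the point e + (y - e)/v. The identity v (x - x') = (y - y') - (v - v') (x' -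
  e) controls its movement only after multiplication by v.\<close>

lemma perspective_lipschitz:
  fixes x x' y y' e :: "'a::real_normed_vector"
  assumes x: "v *\<^sub>R (x - e) = y - e" and x': "v' *\<^sub>R (x' - e) = y' - e" and v: "v \<ge> 0"
    and vv: "\<bar>v - v'\<bar> \<le> c * norm (y - y')" and \<Delta>: "norm (x' - e) \<le> \<Delta>"
  shows "v * norm (x - x') \<le> (1 + c * \<Delta>) * norm (y - y')"
proof -
  have "v *\<^sub>R (x - x') = v *\<^sub>R (x - e) - v *\<^sub>R (x' - e)" by (simp add: algebra_simps)
  also have "\<dots> = (y - y') - (v - v') *\<^sub>R (x' - e)"
    using x x' by (simp add: scaleR_left_diff_distrib)
  finally have "v * norm (x - x') = norm ((y - y') - (v - v') *\<^sub>R (x' - e))"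
    using v by (metis abs_of_nonneg norm_scaleR)
  also have "\<dots> \<le> norm (y - y') + norm ((v - v') *\<^sub>R (x' - e))" by (rule norm_triangle_ineq4)
  also have "norm ((v - v') *\<^sub>R (x' - e)) \<le> (c * norm (y - y')) * \<Delta>"
    unfolding norm_scaleR using vv \<Delta> by (intro mult_mono) auto
  finally show ?thesis by (simp add: algebra_simps)
qed

text \<open>For subgradients of the form g/q: the bound on g'/q' is what leaves a single division by
  q.\<close>

lemma norm_scaled_diff_le:
  fixes g g' :: "'a::real_normed_vector"
  assumes q: "q > 0" "q' > 0" and k: "norm g' \<le> k * q'"
  shows "norm ((1 / q) *\<^sub>R g - (1 / q') *\<^sub>R g') \<le> (norm (g - g') + k * \<bar>q - q'\<bar>) / q"
proof -
  have "(1 / q) *\<^sub>R g - (1 / q') *\<^sub>R g' = (1 / q) *\<^sub>R ((g - g') - ((q - q') / q') *\<^sub>R g')"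
    using q by (simp add: algebra_simps diff_divide_distrib)
  hence "norm ((1 / q) *\<^sub>R g - (1 / q') *\<^sub>R g') = norm ((g - g') - ((q - q') / q') *\<^sub>R g') / q"
    using q by simp
  also have "\<dots> \<le> (norm (g - g') + k * \<bar>q - q'\<bar>) / q"
  proof (intro divide_right_mono)
    have "norm ((g - g') - ((q - q') / q') *\<^sub>R g') \<le> norm (g - g') + \<bar>q - q'\<bar> * (norm g' / q')"
      using norm_triangle_ineq4[of "g - g'" "((q - q') / q') *\<^sub>R g'"] q by simp
    also have "\<bar>q - q'\<bar> * (norm g' / q') \<le> \<bar>q - q'\<bar> * k"
      using k q by (intro mult_left_mono) (auto simp: divide_le_eq)
    finally show "norm ((g - g') - ((q - q') / q') *\<^sub>R g') \<le> norm (g - g') + k * \<bar>q - q'\<bar>"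
      by (simp add: mult.commute)
  qed (use q in auto)
  finally show ?thesis .
qed

lemma convex_Collect_pos:
  fixes F :: "'a::real_vector \<Rightarrow> real"
  assumes "\<And>x y s. F x > 0 \<Longrightarrow> F y > 0 \<Longrightarrow> 0 \<le> s \<Longrightarrow> s \<le> 1 \<Longrightarrow>
            (1 - s) * F x + s * F y \<le> F ((1 - s) *\<^sub>R x + s *\<^sub>R y)"
  shows "convex {x. F x > 0}"
  unfolding convex_alt
proof safe
  fix x y :: 'a and u :: real assume *: "F x > 0" "F y > 0" "0 \<le> u" "u \<le> 1"
  have "0 < (1 - u) * F x + u * F y"
    using * by (cases "u = 0") (auto intro: add_nonneg_pos)
  thus "0 < F ((1 - u) *\<^sub>R x + u *\<^sub>R y)" using assms[OF *] by linarith
qed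

text \<open>The concavity inequality is restricted to points with positive values because a
  hypograph contains only positive heights; F vanishes outside a bounded set and is not concave on
  the whole space.\<close>

locale concave_profile =
  fixes F :: "'a::euclidean_space \<Rightarrow> real" and e :: 'a and R \<Delta> :: real
  assumes nonneg: "\<And>x. F x \<ge> 0"
    and concave: "\<And>x y s. F x > 0 \<Longrightarrow> F y > 0 \<Longrightarrow> 0 \<le> s \<Longrightarrow> s \<le> 1 \<Longrightarrow>
            (1 - s) * F x + s * F y \<le> F ((1 - s) *\<^sub>R x + s *\<^sub>R y)"
    and cont: "continuous_on UNIV F"
    and R_pos: "R > 0" and ball_pos: "\<And>x. norm (x - e) < R \<Longrightarrow> F x > 0"
    and diam: "\<And>x y. F x > 0 \<Longrightarrow> F y > 0 \<Longrightarrow> norm (x - y) \<le> \<Delta>"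
begin

definition rad :: "real \<Rightarrow> 'a \<Rightarrow> real" where
  "rad \<tau> y = enn2real (radial_transform (\<lambda>x. ennreal \<tau> * ennreal (F x)) e y)"

definition pt :: "'a \<Rightarrow> real \<Rightarrow> 'a" where
  "pt y v = e + (y - e) /\<^sub>R v"

lemma Fe_pos: "F e > 0"
  using ball_pos[of e] R_pos by simp

lemma \<Delta>_nonneg: "\<Delta> \<ge> 0"
  using diam[OF Fe_pos Fe_pos] by simp

lemma convex_pos: "convex {x. F x > 0}"
  using concave by (rule convex_Collect_pos)

lemma open_pos: "open {x. F x > 0}"
  using open_Collect_less[OF continuous_on_const cont] by simp

lemma pt_scale: "v > 0 \<Longrightarrow> v *\<^sub>R (pt y v - e) = y - e"
  by (simp add: pt_def)

lemma pt_1 [simp]: "pt y 1 = y"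
  by (simp add: pt_def)

text \<open>The point \<open>pt y w\<close> divides the segment from e to \<open>pt y v\<close> with
  weight v/w. The perspective v F(\<open>pt y v\<close>) thus grows at rate at least F e once it is
  positive; this gives uniqueness of the transform's value and, later, the gain in the
  objective.\<close>

lemma perspective_mono:
  assumes v: "0 < v" "v \<le> w" and F: "F (pt y v) > 0"
  shows "v * F (pt y v) + (w - v) * F e \<le> w * F (pt y w)"
proof -
  have "(1 - v / w) * F e + (v / w) * F (pt y v) \<le> F ((1 - v / w) *\<^sub>R e + (v / w) *\<^sub>R pt y v)"
    using v F Fe_pos by (intro concave) auto
  also have "(1 - v / w) *\<^sub>R e + (v / w) *\<^sub>R pt y v = pt y w"
    using v by (simp add: pt_def algebra_simps inverse_eq_divide)
  finally have "w * ((1 - v / w) * F e + (v / w) * F (pt y v)) \<le> w * F (pt y w)"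
    using v by (intro mult_left_mono) auto
  thus ?thesis using v by (simp add: algebra_simps)
qed

lemma rad_eqI:
  assumes v: "v > 0" and \<tau>: "\<tau> > 0" and eq: "\<tau> * v * F (pt y v) = 1"
  shows "rad \<tau> y = v"
proof -
  have "radial_transform (\<lambda>x. ennreal \<tau> * ennreal (F x)) e y = ennreal v"
    unfolding radial_transform_def
  proof (rule Sup_eqI)
    fix x assume "x \<in> {ennreal w |w. 0 < w \<and>
        ennreal w * (ennreal \<tau> * ennreal (F (e + (y - e) /\<^sub>R w))) \<le> 1}"
    then obtain w where w: "x = ennreal w" "0 < w"
      "ennreal w * (ennreal \<tau> * ennreal (F (pt y w))) \<le> 1" by (auto simp: pt_def)
    have "ennreal (w * (\<tau> * F (pt y w))) \<le> ennreal 1"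
      using w \<tau> nonneg by (simp add: ennreal_mult)
    hence le: "w * (\<tau> * F (pt y w)) \<le> 1" by (subst (asm) ennreal_le_iff) auto
    have "w \<le> v"
    proof (rule ccontr)
      assume "\<not> w \<le> v"
      hence "v < w" by simp
      have "F (pt y v) > 0" using eq nonneg[of "pt y v"] by (cases "F (pt y v) = 0") auto
      from perspective_mono[OF v _ this, of w] \<open>v < w\<close>
      have "v * F (pt y v) + (w - v) * F e \<le> w * F (pt y w)" by simp
      moreover have "(w - v) * F e > 0" using \<open>v < w\<close> Fe_pos by simp
      ultimately have "\<tau> * (v * F (pt y v)) < \<tau> * (w * F (pt y w))" using \<tau> by simp
      with eq le show False by (simp add: mult_ac)
    qed
    thus "x \<le> ennreal v" using w by (simp add: ennreal_leI)
  next
    fix u assume u: "\<And>x. x \<in> {ennreal w |w. 0 < w \<and>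
        ennreal w * (ennreal \<tau> * ennreal (F (e + (y - e) /\<^sub>R w))) \<le> 1} \<Longrightarrow> x \<le> u"
    have "ennreal v * (ennreal \<tau> * ennreal (F (pt y v))) = ennreal (\<tau> * v * F (pt y v))"
      using v \<tau> nonneg by (simp add: ennreal_mult mult_ac)
    hence "ennreal v * (ennreal \<tau> * ennreal (F (e + (y - e) /\<^sub>R v))) \<le> 1"
      unfolding eq by (simp add: pt_def)
    thus "ennreal v \<le> u" using v by (intro u) blast
  qed
  thus ?thesis using v by (simp add: rad_def)
qed

text \<open>Continue the segment from x through e to a point w of the ball. Then e is a convex
  combination of w and x, and F w \<ge> 0 leaves a fixed share of F x at e.\<close>

lemma F_le_center: "F x * R \<le> F e * (\<Delta> + R)"
proof (cases "F x > 0")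
  case True
  define n where "n = norm (x - e)"
  have n: "0 \<le> n" "n \<le> \<Delta>" using diam[OF True Fe_pos] by (auto simp: n_def)
  have "R * (F x - F e) \<le> F e * \<Delta>"
  \<comment> \<open>F is known to be positive only on the open ball, so radii z R with z < 1 are
    used.\<close>
  proof (rule field_le_mult_one_interval)
    fix z :: real assume z: "0 < z" "z < 1"
    define r where "r = z * R"
    have r: "0 < r" "r < R" using z R_pos by (auto simp: r_def)
    have "r * (F x - F e) \<le> F e * \<Delta>"
    proof (cases "n = 0")
      case True
      thus ?thesis using Fe_pos \<Delta>_nonneg by (simp add: n_def)
    next
      case False
      hence n0: "n > 0" using n by simp
      define w where "w = e - (r / n) *\<^sub>R (x - e)"
      have "norm (w - e) = r" using n0 r by (simp add: w_def n_def[symmetric])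
      hence w: "F w > 0" using ball_pos r by simp
      define s where "s = r / (r + n)"
      have s: "0 \<le> s" "s \<le> 1" using r n by (auto simp: s_def)
      have "(1 - s) * (r / n) = s" using r n0 by (simp add: s_def field_simps)
      moreover have "(1 - s) *\<^sub>R w = (1 - s) *\<^sub>R e - ((1 - s) * (r / n)) *\<^sub>R (x - e)"
        by (simp add: w_def scaleR_right_diff_distrib)
      ultimately have "(1 - s) *\<^sub>R w = (1 - s) *\<^sub>R e - s *\<^sub>R (x - e)" by simp
      hence "(1 - s) *\<^sub>R w + s *\<^sub>R x = e" by (simp add: algebra_simps)
      with concave[OF w \<open>F x > 0\<close> s] have "(1 - s) * F w + s * F x \<le> F e" by simp
      moreover have "(1 - s) * F w \<ge> 0" using s w by simp
      ultimately have "s * F x \<le> F e" by linarith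
      hence "r * F x \<le> F e * (r + n)" using r n by (simp add: s_def divide_le_eq)
      also have "\<dots> \<le> F e * (r + \<Delta>)" using n Fe_pos by simp
      finally show ?thesis by (simp add: algebra_simps)
    qed
    thus "z * (R * (F x - F e)) \<le> F e * \<Delta>" by (simp add: r_def mult_ac)
  qed
  thus ?thesis by (simp add: algebra_simps)
next
  case False
  hence "F x = 0" using nonneg[of x] by simp
  thus ?thesis using Fe_pos R_pos \<Delta>_nonneg by simp
qed

definition Fmax :: real where "Fmax = F e * (\<Delta> + R) / R"

lemma F_le_Fmax: "F x \<le> Fmax"
  using F_le_center[of x] R_pos by (simp add: Fmax_def pos_le_divide_eq)

lemma Fmax_pos: "Fmax > 0"
  using F_le_Fmax[of e] Fe_pos by simp

lemma rad_solution:
  assumes \<tau>: "\<tau> > 0"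
  shows "rad \<tau> y > 0" "\<tau> * rad \<tau> y * F (pt y (rad \<tau> y)) = 1"
proof -
  \<comment> \<open>Large enough to bring \<open>pt y v1\<close> into the ball around e.\<close>
  define v1 where "v1 = 2 * norm (y - e) / R + 1"
  have v1: "v1 \<ge> 1" using R_pos by (simp add: v1_def)
  have "norm (y - e) < v1 * R"
    using R_pos unfolding v1_def by (simp add: distrib_right add_nonneg_pos)
  moreover have "norm (pt y v1 - e) = norm (y - e) / v1"
    using v1 by (simp add: pt_def divide_inverse mult.commute)
  ultimately have "norm (pt y v1 - e) < R" using v1 by (simp add: pos_divide_less_eq mult.commute)
  hence F1: "F (pt y v1) > 0" by (rule ball_pos)
  \<comment> \<open>From v1 on, the perspective grows at rate at least F e, so it has reached
    1/\<tau> at b.\<close>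
  define b where "b = v1 + 1 / (\<tau> * F e)"
  have b: "b \<ge> v1" using \<tau> Fe_pos by (simp add: b_def)
  have "(b - v1) * F e \<le> b * F (pt y b)"
    using perspective_mono[OF _ b F1] v1 F1 by (smt (verit) mult_pos_pos)
  moreover have "(b - v1) * F e = 1 / \<tau>" using \<tau> Fe_pos by (simp add: b_def)
  ultimately have hi: "\<tau> * b * F (pt y b) \<ge> 1" using \<tau> by (simp add: divide_le_eq mult_ac)
  \<comment> \<open>Up to 1/(\<tau> \<open>Fmax\<close>) the product cannot exceed 1; this is the
    lower end for the intermediate value theorem.\<close>
  define a where "a = min b (1 / (\<tau> * Fmax))"
  have a: "0 < a" "a \<le> b" using b v1 \<tau> Fmax_pos by (auto simp: a_def)
  have "\<tau> * a * F (pt y a) \<le> \<tau> * (1 / (\<tau> * Fmax)) * Fmax"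
    using \<tau> a F_le_Fmax nonneg Fmax_pos by (intro mult_mono) (auto simp: a_def)
  hence lo: "\<tau> * a * F (pt y a) \<le> 1" using \<tau> Fmax_pos by simp
  have "continuous_on {a..b} (\<lambda>v. \<tau> * v * F (pt y v))"
    using a unfolding pt_def
    by (intro continuous_intros continuous_on_compose2[OF cont]) auto
  from IVT'[OF lo hi a(2) this] obtain v where v: "a \<le> v" "\<tau> * v * F (pt y v) = 1" by auto
  have "rad \<tau> y = v" using v a \<tau> by (intro rad_eqI) auto
  thus "rad \<tau> y > 0" "\<tau> * rad \<tau> y * F (pt y (rad \<tau> y)) = 1" using v a by auto
qed

lemma F_pt_rad_pos: "\<tau> > 0 \<Longrightarrow> F (pt y (rad \<tau> y)) > 0"
  using rad_solution[of \<tau> y] nonneg[of "pt y (rad \<tau> y)"]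
  by (cases "F (pt y (rad \<tau> y)) = 0") auto

lemma rad_ge: "\<tau> > 0 \<Longrightarrow> 1 \<le> rad \<tau> y * (\<tau> * Fmax)"
  using rad_solution[of \<tau> y] F_le_Fmax[of "pt y (rad \<tau> y)"]
  by (smt (verit) mult.assoc mult.commute mult_left_mono mult_pos_pos)

lemma rad_leI:
  assumes \<tau>: "\<tau> > 0" and v: "v > 0" and ge: "\<tau> * v * F (pt y v) \<ge> 1"
  shows "rad \<tau> y \<le> v"
proof (rule ccontr)
  assume "\<not> rad \<tau> y \<le> v"
  hence lt: "v < rad \<tau> y" by simp
  have "F (pt y v) > 0" using ge nonneg[of "pt y v"] by (cases "F (pt y v) = 0") auto
  from perspective_mono[OF v _ this, of "rad \<tau> y"] lt
  have "v * F (pt y v) + (rad \<tau> y - v) * F e \<le> rad \<tau> y * F (pt y (rad \<tau> y))" by simp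
  moreover have "(rad \<tau> y - v) * F e > 0" using lt Fe_pos by simp
  ultimately have "\<tau> * (v * F (pt y v)) < \<tau> * (rad \<tau> y * F (pt y (rad \<tau> y)))" using \<tau> by simp
  thus False using ge rad_solution(2)[OF \<tau>, of y] by (simp add: mult_ac)
qed

text \<open>Follows the perspective from \<open>rad \<tau> y\<close>, where it equals 1/\<tau>, up
  to 1, where it equals F y. This is how a margin in the transform becomes an increase of the
  objective.\<close>

lemma rad_gain:
  assumes \<tau>: "\<tau> > 0" and le: "rad \<tau> y \<le> 1"
  shows "1 + (1 - rad \<tau> y) * (\<tau> * F e) \<le> \<tau> * F y"
proof -
  have "rad \<tau> y * F (pt y (rad \<tau> y)) + (1 - rad \<tau> y) * F e \<le> F y"
    using perspective_mono[OF rad_solution(1)[OF \<tau>] le F_pt_rad_pos[OF \<tau>]] by simp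
  hence "\<tau> * (rad \<tau> y * F (pt y (rad \<tau> y)) + (1 - rad \<tau> y) * F e) \<le> \<tau> * F y"
    using \<tau> by simp
  thus ?thesis using rad_solution(2)[OF \<tau>, of y] by (simp add: algebra_simps)
qed

lemma pos_towards_center:
  assumes w: "w \<in> closure {x. F x > 0}" and s: "0 \<le> s" "s < 1"
  shows "F (e + s *\<^sub>R (w - e)) > 0"
proof (cases "s = 0 \<or> w = e")
  case True
  thus ?thesis using Fe_pos by auto
next
  case False
  have "e \<in> interior {x. F x > 0}" using Fe_pos open_pos by (simp add: interior_open)
  from in_interior_closure_convex_segment[OF convex_pos this w]
  have "open_segment e w \<subseteq> {x. F x > 0}" by (simp add: interior_open open_pos)
  moreover have "e + s *\<^sub>R (w - e) \<in> open_segment e w"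
    using False s by (auto simp: in_segment algebra_simps intro!: exI[of _ s])
  ultimately show ?thesis by blast
qed

text \<open>Along the ray through x the perspective is concave in v, nonnegative just above \<gamma>
  and equal to F x at v = 1. Its chord reaches the height 1/\<tau> at the stated bound.\<close>

lemma rad_le_of_gauge:
  assumes \<tau>: "\<tau> > 0" and x: "F x > 0" "1 \<le> \<tau> * F x"
    and \<gamma>: "\<gamma> = gauge_at (closure {x. F x > 0}) e x" "\<gamma> < 1"
  shows "rad \<tau> x \<le> \<gamma> + (1 - \<gamma>) / (\<tau> * F x)"
proof -
  define a where "a = 1 / (\<tau> * F x)"
  have a: "0 < a" "a \<le> 1" "a * (\<tau> * F x) = 1" using x by (auto simp: a_def)
  \<comment> \<open>The gauge refers to the closure, on whose boundary F may vanish; strictly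
    inside, at \<gamma>' > \<gamma>, it is positive. The limit \<gamma>' to \<gamma> follows
    below.\<close>
  have gap: "rad \<tau> x \<le> \<gamma>' + (1 - \<gamma>') * a" if \<gamma>': "\<gamma> < \<gamma>'" "\<gamma>' < 1" "0 < \<gamma>'" for \<gamma>'
  proof -
    let ?A = "{v. 0 < v \<and> e + (x - e) /\<^sub>R v \<in> closure {x. F x > 0}}"
    have "x \<in> closure {x. F x > 0}" using x(1) closure_subset[of "{x. F x > 0}"] by auto
    hence "1 \<in> ?A" by simp
    hence "?A \<noteq> {}" by blast
    then obtain w where w: "w \<in> ?A" "w < \<gamma>'"
      using cInf_lessD[of ?A \<gamma>'] \<gamma>' unfolding \<gamma>(1) gauge_at_def by blast
    have "F (e + (w / \<gamma>') *\<^sub>R ((e + (x - e) /\<^sub>R w) - e)) > 0"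
      using w \<gamma>' by (intro pos_towards_center) auto
    hence z: "F (pt x \<gamma>') > 0" using w by (simp add: pt_def inverse_eq_divide)
    define v where "v = \<gamma>' + (1 - \<gamma>') * a"
    have v: "v > 0" using \<gamma>' a by (simp add: v_def add_pos_nonneg)
    have v_alt: "v = a + (1 - a) * \<gamma>'" by (simp add: v_def algebra_simps)
    define s where "s = a / v"
    have s1: "1 - s = (1 - a) * \<gamma>' / v" using v v_alt by (simp add: s_def field_simps)
    have "0 \<le> 1 - s" unfolding s1 using \<gamma>' a v by simp
    hence s: "0 \<le> s" "s \<le> 1" using a v by (auto simp: s_def)
    have "(1 - s) * F (pt x \<gamma>') + s * F x \<le> F ((1 - s) *\<^sub>R pt x \<gamma>' + s *\<^sub>R x)"
      using s z x by (intro concave) auto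
    also have "(1 - s) *\<^sub>R pt x \<gamma>' + s *\<^sub>R x = pt x v"
    proof -
      have "(1 - s) / \<gamma>' + s = 1 / v"
        unfolding s1 using v \<gamma>' by (simp add: s_def diff_divide_distrib)
      hence "((1 - s) / \<gamma>') *\<^sub>R (x - e) + s *\<^sub>R (x - e) = (1 / v) *\<^sub>R (x - e)"
        by (simp flip: scaleR_left_distrib)
      thus ?thesis by (simp add: pt_def inverse_eq_divide algebra_simps)
    qed
    finally have "s * F x \<le> F (pt x v)" using s z by (smt (verit) mult_nonneg_nonneg)
    hence "\<tau> * v * (s * F x) \<le> \<tau> * v * F (pt x v)" using \<tau> v by (intro mult_left_mono) auto
    moreover have "\<tau> * v * (s * F x) = 1" using v a(3) by (simp add: s_def mult_ac)
    ultimately have "rad \<tau> x \<le> v" using \<tau> v by (intro rad_leI) auto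
    thus ?thesis by (simp add: v_def)
  qed
  have "rad \<tau> x \<le> \<gamma> + (1 - \<gamma>) * a"
  \<comment> \<open>For a = 1 the bound is 1 for every \<gamma>'; the limit argument divides by 1 -
    a.\<close>
  proof (cases "a = 1")
    case True
    have "max \<gamma> 0 < 1" using \<gamma> by simp
    then obtain \<gamma>' where "max \<gamma> 0 < \<gamma>'" "\<gamma>' < 1" using dense by blast
    with gap[of \<gamma>'] True show ?thesis by simp
  next
    case False
    with a have a1: "1 - a > 0" by simp
    have "0 \<le> \<gamma>"
      unfolding \<gamma>(1) gauge_at_def
    proof (rule cInf_greatest)
      have "x \<in> closure {x. F x > 0}" using x(1) closure_subset[of "{x. F x > 0}"] by auto
      hence "1 \<in> {v. 0 < v \<and> e + (x - e) /\<^sub>R v \<in> closure {x. F x > 0}}" by simp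
      thus "{v. 0 < v \<and> e + (x - e) /\<^sub>R v \<in> closure {x. F x > 0}} \<noteq> {}" by blast
    qed auto
    have "(rad \<tau> x - a) / (1 - a) \<le> \<gamma>"
    proof (rule dense_ge_bounded[OF \<gamma>(2)])
      fix w assume w: "\<gamma> < w" "w < 1"
      hence "rad \<tau> x - a \<le> w * (1 - a)" using gap[of w] \<open>0 \<le> \<gamma>\<close> by (simp add: algebra_simps)
      thus "(rad \<tau> x - a) / (1 - a) \<le> w" using a1 by (simp add: pos_divide_le_eq)
    qed
    thus ?thesis using a1 by (simp add: pos_divide_le_eq algebra_simps)
  qed
  thus ?thesis by (simp add: a_def)
qed

end

section \<open>Subgradients of the radial transform\<close>

locale smooth_concave_profile = concave_profile +
  fixes g :: "'a \<Rightarrow> 'a" and \<beta> :: real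
  assumes gderiv: "\<And>x. F x > 0 \<Longrightarrow> GDERIV F x :> g x"
    and g_lipschitz: "\<And>x y. F x > 0 \<Longrightarrow> F y > 0 \<Longrightarrow> norm (g x - g y) \<le> \<beta> * norm (x - y)"
    and \<beta>_nonneg: "\<beta> \<ge> 0"
begin

lemma below_tangent:
  assumes "F x > 0" "F y > 0"
  shows "F y \<le> F x + g x \<bullet> (y - x)"
proof -
  define d where "d = y - x"
  have "((\<lambda>s. F (x + s *\<^sub>R d)) has_derivative (\<lambda>s. (s *\<^sub>R d) \<bullet> g x)) (at 0)"
    by (rule has_derivative_compose[of "\<lambda>s. x + s *\<^sub>R d" "\<lambda>s. s *\<^sub>R d" 0 UNIV F])
       (use gderiv[OF assms(1)] in \<open>auto simp: gderiv_def intro!: derivative_eq_intros\<close>)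
  hence "((\<lambda>s. F (x + s *\<^sub>R d)) has_real_derivative (d \<bullet> g x)) (at 0)"
    by (simp add: has_field_derivative_def mult_commute_abs)
  hence "((\<lambda>s. (F (x + s *\<^sub>R d) - F x) / s) \<longlongrightarrow> d \<bullet> g x) (at 0)"
    by (simp add: DERIV_def)
  hence lim: "((\<lambda>s. (F (x + s *\<^sub>R d) - F x) / s) \<longlongrightarrow> d \<bullet> g x) (at_right 0)"
    by (rule filterlim_mono) (auto simp: at_le)
  have "F y - F x \<le> d \<bullet> g x"
  proof (rule tendsto_lowerbound[OF lim])
    have "F y - F x \<le> (F (x + s *\<^sub>R d) - F x) / s" if s: "0 < s" "s < 1" for s
    proof -
      have "(1 - s) * F x + s * F y \<le> F ((1 - s) *\<^sub>R x + s *\<^sub>R y)"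
        using s assms by (intro concave) auto
      also have "(1 - s) *\<^sub>R x + s *\<^sub>R y = x + s *\<^sub>R d" by (simp add: d_def algebra_simps)
      finally show ?thesis using s by (simp add: le_divide_eq algebra_simps)
    qed
    moreover have "\<forall>\<^sub>F s in at_right (0::real). 0 < s \<and> s < 1"
      using eventually_at_right_real[of 0 "1::real"] by simp
    ultimately show "\<forall>\<^sub>F s in at_right 0. F y - F x \<le> (F (x + s *\<^sub>R d) - F x) / s"
      by (auto elim: eventually_mono)
  qed auto
  thus ?thesis by (simp add: d_def inner_commute)
qed

text \<open>The value at e of the tangent to F at x, hence at least F e. It is also the derivative
  in v of the perspective v F(\<open>pt y v\<close>) at x = \<open>pt y v\<close>, which explains
  its place in the denominator of \<open>rad_slope\<close> by implicit differentiation.\<close>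

definition q :: "'a \<Rightarrow> real" where "q x = F x - g x \<bullet> (x - e)"

lemma q_ge: "F x > 0 \<Longrightarrow> F e \<le> q x"
  using below_tangent[of x e] Fe_pos by (simp add: q_def inner_diff_right)

text \<open>The tangent at x dominates F > 0 on the ball around e, in particular at the point of the
  ball where its linear part is smallest.\<close>

lemma R_norm_g_le:
  assumes x: "F x > 0"
  shows "R * norm (g x) \<le> q x"
proof (rule field_le_mult_one_interval)
  fix z :: real assume z: "0 < z" "z < 1"
  show "z * (R * norm (g x)) \<le> q x"
  proof (cases "g x = 0")
    case True
    thus ?thesis using q_ge[OF x] Fe_pos by simp
  next
    case False
    define w where "w = e - (z * R / norm (g x)) *\<^sub>R g x"
    have "norm (w - e) = z * R" using z R_pos False by (simp add: w_def)
    hence w: "F w > 0" using z R_pos by (intro ball_pos) simp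
    have "F w \<le> q x + g x \<bullet> (w - e)"
      using below_tangent[OF x w] by (simp add: q_def inner_diff_right)
    also have "g x \<bullet> (w - e) = - (z * R * norm (g x))"
      using False by (simp add: w_def power2_norm_eq_inner[symmetric] power2_eq_square)
    finally show ?thesis using w by (simp add: mult.assoc)
  qed
qed

definition g_max :: real where "g_max = norm (g e) + \<beta> * \<Delta>"

lemma norm_g_le: "F x > 0 \<Longrightarrow> norm (g x) \<le> g_max"
proof -
  assume x: "F x > 0"
  have "norm (g x) \<le> norm (g e) + norm (g x - g e)" by (rule norm_triangle_sub)
  also have "norm (g x - g e) \<le> \<beta> * norm (x - e)" by (rule g_lipschitz[OF x Fe_pos])
  also have "\<dots> \<le> \<beta> * \<Delta>" using diam[OF x Fe_pos] \<beta>_nonneg by (rule mult_left_mono)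
  finally show ?thesis by (simp add: g_max_def)
qed

lemma F_lipschitz:
  assumes "F x > 0" "F y > 0"
  shows "\<bar>F x - F y\<bar> \<le> g_max * norm (x - y)"
proof -
  have *: "F y - F x \<le> g_max * norm (x - y)" if "F x > 0" "F y > 0" for x y
  proof -
    have "F y - F x \<le> g x \<bullet> (y - x)" using below_tangent[OF that] by simp
    also have "\<dots> \<le> norm (g x) * norm (y - x)" by (rule norm_cauchy_schwarz)
    also have "\<dots> \<le> g_max * norm (y - x)" using norm_g_le[OF that(1)] by (intro mult_right_mono) auto
    finally show ?thesis by (simp add: norm_minus_commute)
  qed
  show ?thesis using *[OF assms] *[OF assms(2,1)] by (simp add: norm_minus_commute)
qed

lemma q_lipschitz:
  assumes x: "F x > 0" and y: "F y > 0"
  shows "\<bar>q x - q y\<bar> \<le> (2 * g_max + \<beta> * \<Delta>) * norm (x - y)"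
proof -
  have "q x - q y = (F x - F y) - (g x - g y) \<bullet> (x - e) - g y \<bullet> (x - y)"
    by (simp add: q_def inner_diff_left inner_diff_right)
  hence "\<bar>q x - q y\<bar> \<le> \<bar>F x - F y\<bar> + \<bar>(g x - g y) \<bullet> (x - e)\<bar> + \<bar>g y \<bullet> (x - y)\<bar>" by linarith
  also have "\<bar>(g x - g y) \<bullet> (x - e)\<bar> \<le> norm (g x - g y) * norm (x - e)" by (rule Cauchy_Schwarz_ineq2)
  also have "\<dots> \<le> (\<beta> * norm (x - y)) * \<Delta>"
    using g_lipschitz[OF x y] diam[OF x Fe_pos] \<beta>_nonneg by (intro mult_mono) auto
  also have "\<bar>g y \<bullet> (x - y)\<bar> \<le> norm (g y) * norm (x - y)" by (rule Cauchy_Schwarz_ineq2)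
  also have "\<dots> \<le> g_max * norm (x - y)" using norm_g_le[OF y] by (intro mult_right_mono) auto
  also note F_lipschitz[OF x y]
  finally show ?thesis by (simp add: algebra_simps)
qed

definition rad_slope :: "real \<Rightarrow> 'a \<Rightarrow> 'a" where
  "rad_slope \<tau> y = - ((1 / q (pt y (rad \<tau> y))) *\<^sub>R g (pt y (rad \<tau> y)))"

text \<open>Multiply the tangent inequality between x and x' by v'. Both perspectives equal
  1/\<tau>, so only v q and v' q remain besides the linear term.\<close>

lemma rad_subgradient:
  assumes \<tau>: "\<tau> > 0"
  shows "rad \<tau> y + rad_slope \<tau> y \<bullet> (y' - y) \<le> rad \<tau> y'"
proof -
  define v x v' x' where "v = rad \<tau> y" "x = pt y v" "v' = rad \<tau> y'" "x' = pt y' v'"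
  note defs = this
  have v: "v > 0" "\<tau> * v * F x = 1" and v': "v' > 0" "\<tau> * v' * F x' = 1"
    using rad_solution[OF \<tau>] by (auto simp: defs)
  have x: "F x > 0" "F x' > 0" using F_pt_rad_pos[OF \<tau>] by (auto simp: defs)
  have q: "q x > 0" using q_ge[OF x(1)] Fe_pos by linarith
  have "g x \<bullet> (v' *\<^sub>R (x' - e)) = g x \<bullet> (y' - e)" "g x \<bullet> (v *\<^sub>R (x - e)) = g x \<bullet> (y - e)"
    using v v' by (simp_all add: defs pt_scale)
  hence e: "v' * (g x \<bullet> (x' - e)) = g x \<bullet> (y' - e)" "v * (g x \<bullet> (x - e)) = g x \<bullet> (y - e)"
    by simp_all
  have "F x' \<le> q x + g x \<bullet> (x' - e)"
    using below_tangent[OF x] by (simp add: q_def inner_diff_right)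
  hence "v' * F x' \<le> v' * (q x + g x \<bullet> (x' - e))" using v' by (intro mult_left_mono) auto
  hence "v' * F x' \<le> v' * q x + g x \<bullet> (y' - e)" using e by (simp add: algebra_simps)
  moreover have "v * F x = v * q x + g x \<bullet> (y - e)" using e by (simp add: q_def algebra_simps)
  moreover have "v * F x = v' * F x'"
  proof -
    have "\<tau> * (v * F x) = \<tau> * (v' * F x')" using v(2) v'(2) by (simp add: mult.assoc)
    thus ?thesis using \<tau> by simp
  qed
  moreover have "g x \<bullet> (y' - y) = g x \<bullet> (y' - e) - g x \<bullet> (y - e)" by (simp add: inner_diff_right)
  ultimately have "v * q x - g x \<bullet> (y' - y) \<le> v' * q x" by linarith
  hence "(v * q x - g x \<bullet> (y' - y)) / q x \<le> v'" using q by (simp add: pos_divide_le_eq)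
  thus ?thesis using q by (simp add: rad_slope_def defs diff_divide_distrib)
qed

lemma norm_rad_slope_le: "\<tau> > 0 \<Longrightarrow> norm (rad_slope \<tau> y) \<le> 1 / R"
  using R_norm_g_le[OF F_pt_rad_pos, of \<tau> y] q_ge[OF F_pt_rad_pos, of \<tau> y] Fe_pos R_pos
  by (simp add: rad_slope_def field_simps)

lemma rad_lipschitz: "\<tau> > 0 \<Longrightarrow> (1 / R)-lipschitz_on UNIV (rad \<tau>)"
  using bounded_subgradient_lipschitz[of "rad \<tau>" "rad_slope \<tau>"] rad_subgradient norm_rad_slope_le by blast

text \<open>The slope is Lipschitz in x, and x is Lipschitz in y with a factor 1/v, bounded by T
  \<open>Fmax\<close> through \<open>rad_ge\<close>. The constant depends on T but not on
  \<tau>.\<close>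

lemma rad_slope_lipschitz:
  assumes \<tau>: "0 < \<tau>" "\<tau> \<le> T"
  shows "((\<beta> + (2 * g_max + \<beta> * \<Delta>) / R) / F e * (1 + \<Delta> / R) * (T * Fmax))-lipschitz_on UNIV (rad_slope \<tau>)"
proof (rule lipschitz_onI)
  define C where "C = (\<beta> + (2 * g_max + \<beta> * \<Delta>) / R) / F e"
  have "g_max \<ge> 0" using norm_g_le[OF Fe_pos] norm_ge_zero order_trans by blast
  hence C: "C \<ge> 0" using \<beta>_nonneg \<Delta>_nonneg R_pos Fe_pos by (simp add: C_def)
  show "0 \<le> (\<beta> + (2 * g_max + \<beta> * \<Delta>) / R) / F e * (1 + \<Delta> / R) * (T * Fmax)"
    using C \<Delta>_nonneg R_pos \<tau> Fmax_pos by (simp add: C_def[symmetric])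
  fix y y' :: 'a
  define v x v' x' where "v = rad \<tau> y" "x = pt y v" "v' = rad \<tau> y'" "x' = pt y' v'"
  note defs = this
  have v: "v > 0" and v': "v' > 0" using rad_solution[OF \<tau>(1)] by (auto simp: defs)
  have x: "F x > 0" "F x' > 0" using F_pt_rad_pos[OF \<tau>(1)] by (auto simp: defs)
  have q: "q x > 0" "q x' > 0" using q_ge[OF x(1)] q_ge[OF x(2)] Fe_pos by linarith+
  have "\<bar>v - v'\<bar> \<le> 1 / R * norm (y - y')"
    using lipschitz_on_normD[OF rad_lipschitz[OF \<tau>(1)], of y y'] by (simp add: defs)
  hence "v * norm (x - x') \<le> (1 + 1 / R * \<Delta>) * norm (y - y')"
    using v v' diam[OF x(2) Fe_pos] by (intro perspective_lipschitz) (auto simp: defs pt_scale)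
  hence xx: "(T * Fmax) * (v * norm (x - x')) \<le> (T * Fmax) * ((1 + 1 / R * \<Delta>) * norm (y - y'))"
    using \<tau> Fmax_pos by (intro mult_left_mono) auto
  have "1 \<le> v * (\<tau> * Fmax)" using rad_ge[OF \<tau>(1)] by (simp add: defs)
  also have "\<dots> \<le> v * (T * Fmax)" using v \<tau> Fmax_pos by (intro mult_left_mono mult_right_mono) auto
  finally have "norm (x - x') \<le> (T * Fmax) * (v * norm (x - x'))"
    using mult_right_mono[of 1 "v * (T * Fmax)" "norm (x - x')"] by (simp add: mult_ac)
  with xx have xx: "norm (x - x') \<le> (1 + \<Delta> / R) * (T * Fmax) * norm (y - y')" by (simp add: mult_ac)
  have "norm (rad_slope \<tau> y - rad_slope \<tau> y') = norm ((1 / q x) *\<^sub>R g x - (1 / q x') *\<^sub>R g x')"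
    by (simp add: rad_slope_def flip: defs norm_minus_cancel[of "(1 / q x) *\<^sub>R g x - (1 / q x') *\<^sub>R g x'"])
  also have "\<dots> \<le> (norm (g x - g x') + (1 / R) * \<bar>q x - q x'\<bar>) / q x"
    using q R_norm_g_le[OF x(2)] R_pos by (intro norm_scaled_diff_le) (auto simp: field_simps)
  also have "\<dots> \<le> (\<beta> * norm (x - x') + (1 / R) * ((2 * g_max + \<beta> * \<Delta>) * norm (x - x'))) / F e"
    using g_lipschitz[OF x] q_lipschitz[OF x] q_ge[OF x(1)] Fe_pos R_pos
      \<beta>_nonneg \<Delta>_nonneg \<open>g_max \<ge> 0\<close>
    by (intro frac_le add_mono mult_left_mono) auto
  also have "\<dots> = C * norm (x - x')" by (simp add: C_def add_divide_distrib algebra_simps)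
  also have "\<dots> \<le> C * ((1 + \<Delta> / R) * (T * Fmax) * norm (y - y'))" using xx C by (rule mult_left_mono)
  finally show "dist (rad_slope \<tau> y) (rad_slope \<tau> y') \<le>
      (\<beta> + (2 * g_max + \<beta> * \<Delta>) / R) / F e * (1 + \<Delta> / R) * (T * Fmax) * dist y y'"
    by (simp add: dist_norm C_def mult.assoc)
qed

end

section \<open>Gauges of smooth convex bodies\<close>

locale convex_body =
  fixes S :: "'a::euclidean_space set" and e :: 'a and r \<Delta> :: real
  assumes compact: "compact S" and convex: "convex S"
    and r_pos: "r > 0" and ball_subset: "cball e r \<subseteq> S"
    and \<Delta>_pos: "\<Delta> > 0" and radius: "\<And>x. x \<in> S \<Longrightarrow> norm (x - e) \<le> \<Delta>"
begin

definition \<gamma> :: "'a \<Rightarrow> real" where "\<gamma> = gauge_at S e"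

definition levels :: "'a \<Rightarrow> real set" where
  "levels y = {v. 0 < v \<and> e + (y - e) /\<^sub>R v \<in> S}"

lemma \<gamma>_eq: "\<gamma> y = Inf (levels y)"
  by (simp add: \<gamma>_def gauge_at_def levels_def)

lemma e_in: "e \<in> S"
  using ball_subset r_pos by (auto intro: less_imp_le)

lemma bdd_levels: "bdd_below (levels y)"
  by (rule bdd_belowI[of _ 0]) (simp add: levels_def)

lemma levels_nonempty: "norm (y - e) / r + 1 \<in> levels y"
proof -
  define v where "v = norm (y - e) / r + 1"
  have v: "v > 0" using r_pos by (simp add: v_def add_nonneg_pos)
  have "norm (y - e) \<le> v * r" using r_pos by (simp add: v_def distrib_right)
  hence "norm (y - e) / v \<le> r" using v by (simp add: pos_divide_le_eq mult.commute)
  hence "e + (y - e) /\<^sub>R v \<in> cball e r" using v by (simp add: dist_norm divide_inverse mult.commute)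
  thus ?thesis using v ball_subset unfolding levels_def v_def[symmetric] by blast
qed

lemma \<gamma>_nonneg: "\<gamma> y \<ge> 0"
  unfolding \<gamma>_eq by (rule cInf_greatest) (use levels_nonempty in \<open>auto simp: levels_def\<close>)

lemma levels_upward:
  assumes "v \<in> levels y" "v \<le> w"
  shows "w \<in> levels y"
proof -
  have v: "0 < v" "e + (y - e) /\<^sub>R v \<in> S" using assms by (auto simp: levels_def)
  have "(1 - v / w) *\<^sub>R e + (v / w) *\<^sub>R (e + (y - e) /\<^sub>R v) \<in> S"
    using v assms e_in by (intro convexD_alt[OF convex]) auto
  also have "(1 - v / w) *\<^sub>R e + (v / w) *\<^sub>R (e + (y - e) /\<^sub>R v) = e + (y - e) /\<^sub>R w"
    using v assms by (simp add: algebra_simps inverse_eq_divide)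
  finally show ?thesis using v assms by (simp add: levels_def)
qed

lemma levels_norm_le: "v \<in> levels y \<Longrightarrow> norm (y - e) \<le> v * \<Delta>"
  using radius[of "e + (y - e) /\<^sub>R v"]
  by (simp add: levels_def inverse_eq_divide pos_divide_le_eq mult.commute)

lemma \<gamma>_attained:
  assumes "y \<noteq> e"
  shows "\<gamma> y \<in> levels y"
proof -
  \<comment> \<open>S lies within \<Delta> of e, so no level is below this number. Away from 0 the
    levels form a closed set, and the infimum is attained.\<close>
  define \<epsilon> where "\<epsilon> = norm (y - e) / \<Delta>"
  have \<epsilon>: "\<epsilon> > 0" using assms \<Delta>_pos by (simp add: \<epsilon>_def)
  have "levels y = {\<epsilon>..} \<inter> (\<lambda>v. e + (y - e) /\<^sub>R v) -` S"
  proof safe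
    fix v assume "v \<in> levels y"
    thus "\<epsilon> \<le> v" using levels_norm_le \<Delta>_pos by (simp add: \<epsilon>_def divide_le_eq)
  qed (use \<epsilon> in \<open>auto simp: levels_def\<close>)
  moreover have "closed ({\<epsilon>..} \<inter> (\<lambda>v. e + (y - e) /\<^sub>R v) -` S)"
    using \<epsilon> compact by (intro continuous_closed_preimage continuous_intros compact_imp_closed) auto
  ultimately show ?thesis
    unfolding \<gamma>_eq using levels_nonempty[of y] bdd_levels by (intro closed_contains_Inf) (blast | simp)+
qed

text \<open>The radial projection of y to the boundary. At the centre the formula degenerates to e,
  hence the assumption \<open>y \<noteq> e\<close> in what follows.\<close>

definition bd :: "'a \<Rightarrow> 'a" where "bd y = e + (y - e) /\<^sub>R \<gamma> y"

lemma \<gamma>_pos: "y \<noteq> e \<Longrightarrow> \<gamma> y > 0"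
  using \<gamma>_attained by (simp add: levels_def)

lemma bd_in: "y \<noteq> e \<Longrightarrow> bd y \<in> S"
  using \<gamma>_attained by (simp add: levels_def bd_def)

lemma bd_scale: "y \<noteq> e \<Longrightarrow> \<gamma> y *\<^sub>R (bd y - e) = y - e"
  using \<gamma>_pos[of y] by (simp add: bd_def)

lemma \<gamma>_center: "\<gamma> e = 0"
proof -
  have "levels e = {0<..}" using e_in by (auto simp: levels_def)
  thus ?thesis by (simp add: \<gamma>_eq)
qed

lemma \<gamma>_le_1_iff: "\<gamma> y \<le> 1 \<longleftrightarrow> y \<in> S"
proof
  assume "y \<in> S"
  hence "1 \<in> levels y" by (simp add: levels_def)
  thus "\<gamma> y \<le> 1" unfolding \<gamma>_eq using bdd_levels by (rule cInf_lower)
next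
  assume "\<gamma> y \<le> 1"
  show "y \<in> S"
  proof (cases "y = e")
    case False
    from levels_upward[OF \<gamma>_attained[OF this] \<open>\<gamma> y \<le> 1\<close>] show ?thesis by (simp add: levels_def)
  qed (simp add: e_in)
qed

text \<open>If the projection were interior, it could be pushed outwards by the factor 1 + s and
  still lie in S, and \<gamma> y/(1 + s) would be a smaller level. With s = t/\<Delta> the push has
  length at most t.\<close>

lemma bd_frontier:
  assumes "y \<noteq> e"
  shows "bd y \<in> frontier S"
proof -
  have "bd y \<notin> interior S"
  proof
    assume "bd y \<in> interior S"
    then obtain t where t: "t > 0" "cball (bd y) t \<subseteq> S"
      by (meson mem_interior_cball)
    define s where "s = t / \<Delta>"
    have s: "s > 0" using t \<Delta>_pos by (simp add: s_def)
    have "s * norm (bd y - e) \<le> s * \<Delta>" using s radius[OF bd_in[OF assms]] by (intro mult_left_mono) auto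
    moreover have "s * \<Delta> = t" using \<Delta>_pos by (simp add: s_def)
    ultimately have "bd y + s *\<^sub>R (bd y - e) \<in> cball (bd y) t" using s by (simp add: dist_norm)
    moreover have "bd y + s *\<^sub>R (bd y - e) = e + (y - e) /\<^sub>R (\<gamma> y / (1 + s))"
      by (simp add: bd_def algebra_simps inverse_eq_divide add_divide_distrib)
    ultimately have "\<gamma> y / (1 + s) \<in> levels y"
      using t s \<gamma>_pos[OF assms] by (auto simp: levels_def)
    hence "\<gamma> y \<le> \<gamma> y / (1 + s)" unfolding \<gamma>_eq[of y, symmetric]
      using cInf_lower[OF _ bdd_levels] by (simp add: \<gamma>_eq)
    moreover have "\<gamma> y / (1 + s) < \<gamma> y" using s \<gamma>_pos[OF assms] by (simp add: divide_less_eq)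
    ultimately show False by simp
  qed
  thus ?thesis using bd_in[OF assms] closure_subset by (auto simp: frontier_def)
qed

lemma ex_unit_normal:
  assumes "x \<in> frontier S"
  shows "\<exists>\<xi>. norm \<xi> = 1 \<and> \<xi> \<in> normal_cone S x"
proof -
  have "interior S \<noteq> {}" using ball_subset r_pos mem_interior_cball by blast
  hence "x \<notin> rel_interior S" using assms by (simp add: rel_interior_nonempty_interior frontier_def)
  moreover have "x \<in> closure S" using assms by (simp add: frontier_def)
  ultimately obtain a where a: "a \<noteq> 0" "\<And>y. y \<in> closure S \<Longrightarrow> a \<bullet> x \<le> a \<bullet> y"
    using supporting_hyperplane_relative_frontier[OF convex] by metis
  define \<xi> where "\<xi> = (- 1 / norm a) *\<^sub>R a"
  have "norm \<xi> = 1" using a by (simp add: \<xi>_def)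
  moreover have "\<xi> \<bullet> (x' - x) \<le> 0" if "x' \<in> S" for x'
  proof -
    have "a \<bullet> x \<le> a \<bullet> x'" using a that closure_subset by blast
    thus ?thesis using a by (simp add: \<xi>_def inner_diff_right divide_right_mono)
  qed
  ultimately show ?thesis by (auto simp: normal_cone_def)
qed

definition normal :: "'a \<Rightarrow> 'a" where
  "normal y = (SOME \<xi>. norm \<xi> = 1 \<and> \<xi> \<in> normal_cone S (bd y))"

lemma
  assumes "y \<noteq> e"
  shows norm_normal: "norm (normal y) = 1" and normal_in: "normal y \<in> normal_cone S (bd y)"
  using someI_ex[OF ex_unit_normal[OF bd_frontier[OF assms]]] unfolding normal_def by blast+

text \<open>The distance from e to the supporting hyperplane at \<open>bd y\<close>; it is at least
  r because the ball lies on one side.\<close>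

definition q :: "'a \<Rightarrow> real" where "q y = normal y \<bullet> (bd y - e)"

lemma normal_le_q: "y \<noteq> e \<Longrightarrow> x \<in> S \<Longrightarrow> normal y \<bullet> (x - e) \<le> q y"
  using normal_in[of y] by (auto simp: normal_cone_def q_def inner_diff_right)

lemma q_ge: "y \<noteq> e \<Longrightarrow> r \<le> q y"
proof -
  assume y: "y \<noteq> e"
  have "e + r *\<^sub>R normal y \<in> cball e r" using norm_normal[OF y] r_pos by (simp add: dist_norm)
  hence "normal y \<bullet> (e + r *\<^sub>R normal y - e) \<le> q y" using ball_subset normal_le_q[OF y] by blast
  thus ?thesis using norm_normal[OF y] by (simp add: norm_eq_1)
qed

text \<open>The gauge has its minimum at e, so 0 is a valid choice there, but the slope is bounded
  away from 0 elsewhere and jumps at e.\<close>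

definition slope :: "'a \<Rightarrow> 'a" where
  "slope y = (if y = e then 0 else (1 / q y) *\<^sub>R normal y)"

text \<open>The supporting hyperplane at \<open>bd y\<close> gives \<langle>\<open>normal y\<close>,
  y' - e\<rangle> \<le> \<gamma> y' * q y, with equality for y' = y.\<close>

lemma \<gamma>_subgradient: "\<gamma> y + slope y \<bullet> (y' - y) \<le> \<gamma> y'"
proof (cases "y = e")
  case True
  thus ?thesis by (simp add: slope_def \<gamma>_center \<gamma>_nonneg)
next
  case False
  have q: "q y > 0" using q_ge[OF False] r_pos by linarith
  have a: "normal y \<bullet> (y - e) = \<gamma> y * q y"
    unfolding bd_scale[OF False, symmetric] by (simp add: q_def)
  have b: "normal y \<bullet> (y' - e) \<le> \<gamma> y' * q y"
  proof (cases "y' = e")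
    case True
    thus ?thesis by (simp add: \<gamma>_center)
  next
    case False': False
    show ?thesis unfolding bd_scale[OF False', symmetric]
      using normal_le_q[OF False bd_in[OF False']] \<gamma>_nonneg by (simp add: mult_left_mono)
  qed
  have "normal y \<bullet> (y' - y) \<le> (\<gamma> y' - \<gamma> y) * q y"
    using a b by (simp add: inner_diff_right left_diff_distrib)
  hence "normal y \<bullet> (y' - y) / q y \<le> \<gamma> y' - \<gamma> y" using q by (simp add: pos_divide_le_eq)
  thus ?thesis using False by (simp add: slope_def)
qed

lemma norm_slope_le: "norm (slope y) \<le> 1 / r"
proof (cases "y = e")
  case False
  thus ?thesis using q_ge[OF False] r_pos norm_normal[OF False] by (simp add: slope_def frac_le)
qed (use r_pos in \<open>simp add: slope_def\<close>)

lemma \<gamma>_lipschitz: "\<bar>\<gamma> y - \<gamma> y'\<bar> \<le> (1 / r) * norm (y - y')"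
  using lipschitz_on_normD[OF bounded_subgradient_lipschitz[OF \<gamma>_subgradient norm_slope_le]]
  by simp

text \<open>The chain rule: min t 1 is the derivative of the scalar function that turns \<gamma>
  into \<phi>. This factor removes the jump of \<open>slope\<close> at the centre.\<close>

definition phi_slope :: "'a \<Rightarrow> 'a" where "phi_slope y = min (\<gamma> y) 1 *\<^sub>R slope y"

lemma phi_subgradient: "phi_set S e y + phi_slope y \<bullet> (y' - y) \<le> phi_set S e y'"
proof -
  define v v' where "v = \<gamma> y" "v' = \<gamma> y'"
  have v: "v \<ge> 0" "v' \<ge> 0" by (simp_all add: v_v'_def \<gamma>_nonneg)
  have phi: "phi_set S e y = (if v > 1 then v else v\<^sup>2 / 2 + 1 / 2)"
    "phi_set S e y' = (if v' > 1 then v' else v'\<^sup>2 / 2 + 1 / 2)"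
    by (simp_all add: phi_set_def v_v'_def \<gamma>_def)
  have "min v 1 * (slope y \<bullet> (y' - y)) \<le> min v 1 * (v' - v)"
    using \<gamma>_subgradient[of y y'] v by (intro mult_left_mono) (auto simp: v_v'_def)
  moreover have "phi_set S e y + min v 1 * (v' - v) \<le> phi_set S e y'"
  proof -
    have sq: "0 \<le> (v' - v)\<^sup>2" "0 \<le> (v' - 1)\<^sup>2" "0 \<le> (1 - v)\<^sup>2" by simp_all
    consider "v \<le> 1" "v' \<le> 1" | "v \<le> 1" "v' > 1" | "v > 1" "v' \<le> 1" | "v > 1" "v' > 1" by linarith
    thus ?thesis
    proof cases
      case 2
      hence "0 \<le> (v' - 1) * (1 - v)" by simp
      thus ?thesis using 2 sq by (simp add: phi power2_eq_square algebra_simps)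
    qed (use sq in \<open>simp_all add: phi power2_eq_square algebra_simps\<close>)
  qed
  ultimately show ?thesis by (simp add: phi_slope_def v_v'_def)
qed

lemma norm_phi_slope_le: "norm (phi_slope y) \<le> 1 / r"
proof -
  have "min (\<gamma> y) 1 * norm (slope y) \<le> 1 * (1 / r)"
    using \<gamma>_nonneg[of y] norm_slope_le[of y] by (intro mult_mono) auto
  thus ?thesis using \<gamma>_nonneg[of y] by (simp add: phi_slope_def)
qed

lemma phi_lipschitz: "(1 / r)-lipschitz_on UNIV (phi_set S e)"
  using bounded_subgradient_lipschitz[OF phi_subgradient norm_phi_slope_le] .

lemma phi_le_1_iff: "phi_set S e y \<le> 1 \<longleftrightarrow> y \<in> S"
proof -
  have "(\<gamma> y)\<^sup>2 \<le> 1" if "\<gamma> y \<le> 1" using that \<gamma>_nonneg[of y] by (simp add: power_le_one)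
  thus ?thesis using \<gamma>_le_1_iff[of y] by (auto simp: phi_set_def \<gamma>_def)
qed

lemma phi_center: "phi_set S e e = 1 / 2"
  using \<gamma>_center by (simp add: phi_set_def \<gamma>_def)

text \<open>Used to exclude M = 0, so that the step size 1/\<open>L\<theta>\<close> of the method is
  meaningful.\<close>

lemma phi_nonconstant: "\<not> 0-lipschitz_on UNIV (phi_set S e)"
proof
  assume "0-lipschitz_on UNIV (phi_set S e)"
  hence "phi_set S e y = phi_set S e e" for y by (auto simp: lipschitz_on_def)
  hence "phi_set S e y \<le> 1" for y using phi_center by (metis divide_le_eq_1_pos one_le_numeral zero_less_numeral)
  hence "y \<in> S" for y using phi_le_1_iff by blast
  hence "S = UNIV" by blast
  thus False using compact_imp_bounded[OF compact] not_bounded_UNIV by metis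
qed

end

section \<open>Lipschitz slopes for smooth bodies\<close>

locale smooth_convex_body = convex_body +
  fixes \<beta> :: real
  assumes smooth: "smooth_set \<beta> S" and \<beta>_nonneg: "\<beta> \<ge> 0"
begin

lemma normal_lipschitz:
  assumes "y \<noteq> e" "y' \<noteq> e"
  shows "norm (normal y - normal y') \<le> \<beta> * norm (bd y - bd y')"
  using smooth bd_frontier norm_normal normal_in assms unfolding smooth_set_def by blast

lemma q_lipschitz:
  assumes "y \<noteq> e" "y' \<noteq> e"
  shows "\<bar>q y - q y'\<bar> \<le> (1 + \<beta> * \<Delta>) * norm (bd y - bd y')"
proof -
  have "q y - q y' = (normal y - normal y') \<bullet> (bd y - e) + normal y' \<bullet> (bd y - bd y')"
    by (simp add: q_def inner_diff_left inner_diff_right)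
  hence "\<bar>q y - q y'\<bar> \<le> \<bar>(normal y - normal y') \<bullet> (bd y - e)\<bar> + \<bar>normal y' \<bullet> (bd y - bd y')\<bar>" by linarith
  also have "\<bar>(normal y - normal y') \<bullet> (bd y - e)\<bar> \<le> norm (normal y - normal y') * norm (bd y - e)"
    by (rule Cauchy_Schwarz_ineq2)
  also have "\<dots> \<le> (\<beta> * norm (bd y - bd y')) * \<Delta>"
    using normal_lipschitz[OF assms] radius[OF bd_in[OF assms(1)]] \<beta>_nonneg by (intro mult_mono) auto
  also have "\<bar>normal y' \<bullet> (bd y - bd y')\<bar> \<le> norm (normal y') * norm (bd y - bd y')"
    by (rule Cauchy_Schwarz_ineq2)
  finally show ?thesis using norm_normal[OF assms(2)] by (simp add: algebra_simps)
qed

text \<open>The projection \<open>bd\<close> is not Lipschitz near e; the factor \<gamma> y is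
  exactly what \<open>perspective_lipschitz\<close> requires.\<close>

lemma \<gamma>_slope_diff:
  assumes "y \<noteq> e" "y' \<noteq> e"
  shows "\<gamma> y * norm (slope y - slope y') \<le>
    (\<beta> + (1 + \<beta> * \<Delta>) / r) / r * (1 + \<Delta> / r) * norm (y - y')"
proof -
  define C where "C = (\<beta> + (1 + \<beta> * \<Delta>) / r) / r"
  have C: "C \<ge> 0" using \<beta>_nonneg \<Delta>_pos r_pos by (simp add: C_def)
  have q: "q y \<ge> r" "q y' \<ge> r" using q_ge assms by auto
  define d where "d = norm (bd y - bd y')"
  have "norm (slope y - slope y') = norm ((1 / q y) *\<^sub>R normal y - (1 / q y') *\<^sub>R normal y')"
    using assms by (simp add: slope_def)
  also have "\<dots> \<le> (norm (normal y - normal y') + (1 / r) * \<bar>q y - q y'\<bar>) / q y"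
    using q r_pos norm_normal[OF assms(2)] by (intro norm_scaled_diff_le) (auto simp: field_simps)
  also have "\<dots> \<le> (\<beta> * d + (1 / r) * ((1 + \<beta> * \<Delta>) * d)) / r"
    using normal_lipschitz[OF assms] q_lipschitz[OF assms] q r_pos \<beta>_nonneg \<Delta>_pos
    by (intro frac_le add_mono mult_left_mono) (auto simp: d_def)
  also have "\<dots> = C * d" by (simp add: C_def add_divide_distrib algebra_simps)
  finally have "\<gamma> y * norm (slope y - slope y') \<le> \<gamma> y * (C * d)" using \<gamma>_nonneg by (rule mult_left_mono)
  also have "\<dots> = C * (\<gamma> y * norm (bd y - bd y'))" by (simp add: d_def)
  also have "\<dots> \<le> C * ((1 + 1 / r * \<Delta>) * norm (y - y'))"
    using \<gamma>_lipschitz radius[OF bd_in[OF assms(2)]] C \<gamma>_nonneg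
    by (intro mult_left_mono perspective_lipschitz[where e = e and v' = "\<gamma> y'"]) (auto simp: bd_scale assms)
  finally show ?thesis by (simp add: C_def mult.assoc)
qed

lemma phi_slope_lipschitz:
  "((\<beta> + (1 + \<beta> * \<Delta>) / r) / r * (1 + \<Delta> / r) + 1 / r\<^sup>2)-lipschitz_on UNIV phi_slope"
proof (rule lipschitz_onI)
  define C where "C = (\<beta> + (1 + \<beta> * \<Delta>) / r) / r * (1 + \<Delta> / r)"
  have C: "C \<ge> 0" using \<beta>_nonneg \<Delta>_pos r_pos by (simp add: C_def)
  show "0 \<le> (\<beta> + (1 + \<beta> * \<Delta>) / r) / r * (1 + \<Delta> / r) + 1 / r\<^sup>2" using C r_pos by (simp add: C_def)
  \<comment> \<open>Covers the case that one of the two points is e, where no projection is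
    available.\<close>
  have center: "norm (phi_slope y) \<le> (1 / r\<^sup>2) * norm (y - e)" for y
  proof -
    have "min (\<gamma> y) 1 * norm (slope y) \<le> ((1 / r) * norm (y - e)) * (1 / r)"
      using \<gamma>_lipschitz[of y e] norm_slope_le[of y] \<gamma>_nonneg[of y] r_pos
      by (intro mult_mono) (auto simp: \<gamma>_center)
    thus ?thesis using \<gamma>_nonneg[of y] by (simp add: phi_slope_def power2_eq_square)
  qed
  have e0: "phi_slope e = 0" by (simp add: phi_slope_def slope_def)
  fix y y' :: 'a
  have "norm (phi_slope y - phi_slope y') \<le> (C + 1 / r\<^sup>2) * norm (y - y')"
  proof (cases "y = e \<or> y' = e")
    case True
    have "norm (phi_slope y - phi_slope y') \<le> (1 / r\<^sup>2) * norm (y - y')"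
      using True center[of y] center[of y'] by (auto simp: e0 norm_minus_commute)
    also have "\<dots> \<le> (C + 1 / r\<^sup>2) * norm (y - y')" using C by (intro mult_right_mono) auto
    finally show ?thesis .
  next
    case False
    hence ne: "y \<noteq> e" "y' \<noteq> e" by auto
    define w w' where "w = min (\<gamma> y) 1" "w' = min (\<gamma> y') 1"
    \<comment> \<open>A product rule: w \<le> \<gamma> y lets \<open>\<gamma>_slope_diff\<close>
      bound the first term; the second needs only the Lipschitz gauge and bounded slopes.\<close>
    have "phi_slope y - phi_slope y' = w *\<^sub>R (slope y - slope y') + (w - w') *\<^sub>R slope y'"
      by (simp add: phi_slope_def w_w'_def algebra_simps)
    hence "norm (phi_slope y - phi_slope y') \<le>
        norm (w *\<^sub>R (slope y - slope y')) + norm ((w - w') *\<^sub>R slope y')"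
      by (metis norm_triangle_ineq)
    also have "norm (w *\<^sub>R (slope y - slope y')) \<le> \<gamma> y * norm (slope y - slope y')"
      using \<gamma>_nonneg[of y] by (auto simp: w_w'_def intro: mult_right_mono)
    also have "\<dots> \<le> C * norm (y - y')" unfolding C_def by (rule \<gamma>_slope_diff[OF ne])
    also have "norm ((w - w') *\<^sub>R slope y') \<le> ((1 / r) * norm (y - y')) * (1 / r)"
      unfolding norm_scaleR
    proof (intro mult_mono)
      show "\<bar>w - w'\<bar> \<le> 1 / r * norm (y - y')" using \<gamma>_lipschitz[of y y'] unfolding w_w'_def by linarith
    qed (use norm_slope_le r_pos in auto)
    finally show ?thesis by (simp add: algebra_simps power2_eq_square)
  qed
  thus "dist (phi_slope y) (phi_slope y') \<le>
    ((\<beta> + (1 + \<beta> * \<Delta>) / r) / r * (1 + \<Delta> / r) + 1 / r\<^sup>2) * dist y y'"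
    by (simp add: C_def dist_norm)
qed

end

section \<open>Accelerated gradient descent\<close>

lemma next_t_props:
  assumes "0 < t"
  shows "0 < next_t t" "next_t t < 1" "(next_t t)\<^sup>2 = (1 - next_t t) * t\<^sup>2"
proof -
  let ?P = "\<lambda>t'. 0 < t' \<and> t' < 1 \<and> t'\<^sup>2 = (1 - t') * t\<^sup>2"
  \<comment> \<open>The positive root of s^2 + t^2 s - t^2 = 0.\<close>
  define s where "s = (sqrt (t^4 + 4 * t\<^sup>2) - t\<^sup>2) / 2"
  have s2: "(2 * s + t\<^sup>2)\<^sup>2 = t^4 + 4 * t\<^sup>2" 
  proof -
    have "2 * s + t\<^sup>2 = sqrt (t^4 + 4 * t\<^sup>2)" unfolding s_def by (simp add: field_simps)
    thus ?thesis by simp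
  qed
  have "t\<^sup>2 < sqrt (t^4 + 4 * t\<^sup>2)"
    using assms by (intro real_less_rsqrt) simp
  hence s0: "s > 0" by (simp add: s_def)
  have eq: "s\<^sup>2 = (1 - s) * t\<^sup>2" using s2 by (simp add: power2_eq_square power4_eq_xxxx algebra_simps)
  have "(1 - s) * t\<^sup>2 > 0" using s0 eq by (metis zero_less_power)
  hence "s < 1" using assms by (simp add: zero_less_mult_iff)
  hence ex: "?P s" using s0 eq by blast
  have le: "a \<le> b" if "?P a" "?P b" for a b
  proof (rule ccontr)
    assume "\<not> a \<le> b"
    hence "b < a" by simp
    hence "b\<^sup>2 < a\<^sup>2" using that by (intro power_strict_mono) auto
    moreover have "(1 - a) * t\<^sup>2 < (1 - b) * t\<^sup>2" using \<open>b < a\<close> assms by simp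
    ultimately show False using that by linarith
  qed
  have "\<exists>!t'. ?P t'" using ex le by (metis antisym)
  from theI'[OF this] show "0 < next_t t" "next_t t < 1" "(next_t t)\<^sup>2 = (1 - next_t t) * t\<^sup>2"
    unfolding next_t_def by blast+
qed

text \<open>For the reciprocals \<lambda> = 1/t the recursion reads \<lambda>'^2 - \<lambda>' =
  \<lambda>^2. Completing the square shows that \<lambda> grows by at least 1/2 per step.\<close>

lemma inverse_next_t:
  assumes "0 < t"
  shows "(1 / next_t t)\<^sup>2 - 1 / next_t t = (1 / t)\<^sup>2" "1 / next_t t \<ge> 1 / t + 1 / 2"
proof -
  note p = next_t_props[OF assms]
  show eq: "(1 / next_t t)\<^sup>2 - 1 / next_t t = (1 / t)\<^sup>2"
    using p assms by (simp add: field_simps power2_eq_square)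
  have "(1 / next_t t - 1 / 2)\<^sup>2 = (1 / t)\<^sup>2 + 1 / 4"
    using eq by (simp add: power2_eq_square algebra_simps)
  hence "(1 / t)\<^sup>2 \<le> (1 / next_t t - 1 / 2)\<^sup>2" by simp
  moreover have "1 / next_t t - 1 / 2 \<ge> 0" using p by (simp add: field_simps)
  ultimately have "1 / t \<le> 1 / next_t t - 1 / 2" by (rule power2_le_imp_le)
  thus "1 / next_t t \<ge> 1 / t + 1 / 2" by simp
qed

lemma golden_t:
  fixes t :: real
  assumes "t = (-1 + sqrt 5) / 2"
  shows "t > 0" "(1 / t)\<^sup>2 - 1 / t = 1" "1 / t \<ge> 3 / 2"
proof -
  have s: "sqrt 5 > 2" "sqrt 5 < 7/3" 
    by (rule real_less_rsqrt, simp, rule real_less_lsqrt, simp_all add: power2_eq_square)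
  show t: "t > 0" using s assms by simp
  have "t\<^sup>2 = 1 - t" by (simp add: assms power2_eq_square field_simps)
  thus "(1 / t)\<^sup>2 - 1 / t = 1" using t by (simp add: field_simps power2_eq_square)
  have "t \<le> 2 / 3" using s assms by simp
  thus "1 / t \<ge> 3 / 2" using t by (simp add: field_simps)
qed

text \<open>The Lyapunov function is
  \<open>(\<lambda>\<^sub>k\<^sup>2 - \<lambda>\<^sub>k) (h(y\<^sub>k) - h(u)) + \<Lambda>/2 \<parallel>w\<^sub>k - u\<parallel>\<^sup>2\<close> with
  \<open>\<lambda>\<^sub>k = 1/t\<^sub>k\<close> and \<open>w\<^sub>k = \<lambda>\<^sub>k z\<^sub>k - (\<lambda>\<^sub>k - 1) y\<^sub>k\<close>; the momentum coefficient equals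
  \<open>(\<lambda>\<^sub>k - 1)/\<lambda>\<^sub>k\<^sub>+\<^sub>1\<close>, which makes \<open>w\<^sub>k\<^sub>+\<^sub>1 - w\<^sub>k = \<lambda>\<^sub>k (y\<^sub>k\<^sub>+\<^sub>1 - z\<^sub>k)\<close>. Since
  \<open>\<lambda>\<^sub>0\<^sup>2 - \<lambda>\<^sub>0 = 1\<close>, its initial value contains \<open>h(x) - h(u)\<close>.\<close>

lemma accelerated_rate:
  fixes y z :: "nat \<Rightarrow> 'a::real_inner"
  assumes tangent: "\<And>a w. h a + g a \<bullet> (w - a) \<le> h w"
    and descent: "\<And>a. h (a - (1 / \<Lambda>) *\<^sub>R g a) \<le> h a - (norm (g a))\<^sup>2 / (2 * \<Lambda>)"
    and \<Lambda>: "\<Lambda> > 0"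
    and init: "y 0 = x" "z 0 = x" "t 0 = (-1 + sqrt 5) / 2"
    and y: "\<And>k. y (Suc k) = z k - (1 / \<Lambda>) *\<^sub>R g (z k)"
    and z: "\<And>k. z (Suc k) = y (Suc k) +
             (t k * (1 - t k) / ((t k)\<^sup>2 + t (Suc k))) *\<^sub>R (y (Suc k) - y k)"
    and t: "\<And>k. t (Suc k) = next_t (t k)"
    and E: "h x - h u + \<Lambda> / 2 * (norm (x - u))\<^sup>2 \<le> E" "E \<ge> 0"
  shows "h (y k) - h u \<le> 4 * E / (real k + 1)\<^sup>2"
proof -
  define l where "l = (\<lambda>k. 1 / t k)"
  define W where "W = (\<lambda>k. l k *\<^sub>R z k - (l k - 1) *\<^sub>R y k)"
  have t0: "t k > 0" for k
    by (induction k) (use init golden_t(1) t next_t_props in auto)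
  have lgrow: "l k \<ge> 3 / 2 + real k / 2" for k
  proof (induction k)
    case 0
    show ?case using golden_t(3)[OF init(3)] by (simp add: l_def)
  next
    case (Suc k)
    thus ?case using inverse_next_t(2)[OF t0, of k] by (simp add: l_def t add_divide_distrib)
  qed
  have lrec: "(l (Suc k))\<^sup>2 - l (Suc k) = (l k)\<^sup>2" for k
    using inverse_next_t(1)[OF t0, of k] by (simp add: l_def t)
  have mom: "t k * (1 - t k) / ((t k)\<^sup>2 + t (Suc k)) = (l k - 1) / l (Suc k)" for k
  proof -
    have p: "t (Suc k) > 0" "t k > 0" using t0 by auto
    have "(t (Suc k))\<^sup>2 = (1 - t (Suc k)) * (t k)\<^sup>2" using next_t_props[OF t0, of k] by (simp add: t)
    hence "((t k)\<^sup>2 + t (Suc k)) * t (Suc k) = (t k)\<^sup>2" by (simp add: algebra_simps power2_eq_square)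
    hence e: "(t k)\<^sup>2 + t (Suc k) = (t k)\<^sup>2 / t (Suc k)" using p by (simp add: field_simps)
    show ?thesis unfolding e using p by (simp add: l_def field_simps power2_eq_square)
  qed
  have W_Suc: "W (Suc k) = W k - (l k / \<Lambda>) *\<^sub>R g (z k)" for k
  proof -
    have l0: "l (Suc k) \<noteq> 0" using lgrow[of "Suc k"] by linarith
    have "l (Suc k) *\<^sub>R z (Suc k) = l (Suc k) *\<^sub>R y (Suc k) + (l k - 1) *\<^sub>R (y (Suc k) - y k)"
      using l0 by (simp add: z mom scaleR_right_distrib)
    hence "W (Suc k) = l k *\<^sub>R y (Suc k) - (l k - 1) *\<^sub>R y k"
      by (simp add: W_def algebra_simps)
    also have "\<dots> = W k - (l k / \<Lambda>) *\<^sub>R g (z k)"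
      by (simp add: W_def y algebra_simps)
    finally show ?thesis .
  qed
  have inv: "((l k)\<^sup>2 - l k) * (h (y k) - h u) + \<Lambda> / 2 * (norm (W k - u))\<^sup>2 \<le> E" for k
  proof (induction k)
    case 0
    have "(l 0)\<^sup>2 - l 0 = 1" using golden_t(2)[OF init(3)] by (simp add: l_def)
    moreover have "W 0 = x" by (simp add: W_def init algebra_simps)
    ultimately show ?case using E init by simp
  next
    case (Suc k)
    define G where "G = g (z k)"
    have l1: "l k \<ge> 1" using lgrow[of k] by linarith
    have step: "h (y (Suc k)) \<le> h (z k) - (norm G)\<^sup>2 / (2 * \<Lambda>)"
      using descent[of "z k"] by (simp add: y G_def)
    have a: "h (z k) - h (y k) \<le> G \<bullet> (z k - y k)" "h (z k) - h u \<le> G \<bullet> (z k - u)"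
      using tangent[of "z k" "y k"] tangent[of "z k" u] by (simp_all add: G_def inner_diff_right)
    \<comment> \<open>The weights \<open>l k - 1\<close> and 1 are those for which the two linear
      terms combine to the inner product of G with \<open>W k - u\<close>.\<close>
    have "(l k - 1) * (h (z k) - h (y k)) + (h (z k) - h u) \<le>
        (l k - 1) * (G \<bullet> (z k - y k)) + G \<bullet> (z k - u)"
      using a l1 by (intro add_mono mult_left_mono) auto
    also have "\<dots> = G \<bullet> (W k - u)"
      by (simp add: W_def inner_diff_right algebra_simps)
    finally have b: "l k * h (z k) \<le> (l k - 1) * h (y k) + h u + G \<bullet> (W k - u)"
      by (simp add: algebra_simps)
    have "l k * (l k * h (y (Suc k))) \<le> l k * (l k * h (z k) - l k * ((norm G)\<^sup>2 / (2 * \<Lambda>)))"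
      using step l1 unfolding right_diff_distrib[symmetric] by (intro mult_left_mono) auto
    also have "\<dots> \<le> l k * ((l k - 1) * h (y k) + h u + G \<bullet> (W k - u) - l k * ((norm G)\<^sup>2 / (2 * \<Lambda>)))"
      using b l1 by (intro mult_left_mono) auto
    finally have c: "(l k)\<^sup>2 * h (y (Suc k)) \<le> ((l k)\<^sup>2 - l k) * h (y k) + l k * h u
        + l k * (G \<bullet> (W k - u)) - (l k)\<^sup>2 * ((norm G)\<^sup>2 / (2 * \<Lambda>))"
      by (simp add: algebra_simps power2_eq_square)
    have "(norm (W (Suc k) - u))\<^sup>2 = (norm ((W k - u) - (l k / \<Lambda>) *\<^sub>R G))\<^sup>2"
      by (simp add: W_Suc G_def algebra_simps)
    also have "\<dots> = (norm (W k - u))\<^sup>2 - 2 * (l k / \<Lambda>) * (G \<bullet> (W k - u)) + (l k / \<Lambda>)\<^sup>2 * (norm G)\<^sup>2"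
    proof -
      have "(norm (p - c *\<^sub>R q))\<^sup>2 = (norm p)\<^sup>2 - 2 * c * (q \<bullet> p) + c\<^sup>2 * (norm q)\<^sup>2" for p q :: 'a and c
        unfolding power2_norm_eq_inner
        by (simp add: inner_diff_left inner_diff_right inner_commute power2_eq_square algebra_simps)
      thus ?thesis .
    qed
    finally have "\<Lambda> / 2 * (norm (W (Suc k) - u))\<^sup>2 = \<Lambda> / 2 * (norm (W k - u))\<^sup>2
        - l k * (G \<bullet> (W k - u)) + (l k)\<^sup>2 * ((norm G)\<^sup>2 / (2 * \<Lambda>))"
      using \<Lambda> by (simp add: power2_eq_square field_simps)
    moreover have "(l k)\<^sup>2 * (h (y (Suc k)) - h u) = (l k)\<^sup>2 * h (y (Suc k)) - (l k)\<^sup>2 * h u"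
      "((l k)\<^sup>2 - l k) * (h (y k) - h u) = ((l k)\<^sup>2 - l k) * h (y k) - (l k)\<^sup>2 * h u + l k * h u"
      by (simp_all add: algebra_simps)
    ultimately have "(l k)\<^sup>2 * (h (y (Suc k)) - h u) + \<Lambda> / 2 * (norm (W (Suc k) - u))\<^sup>2 \<le>
        ((l k)\<^sup>2 - l k) * (h (y k) - h u) + \<Lambda> / 2 * (norm (W k - u))\<^sup>2"
      using c by linarith
    thus ?case using Suc by (simp add: lrec)
  qed
  show ?thesis
  proof (cases "h (y k) - h u \<ge> 0")
    case True
    \<comment> \<open>Linear growth of \<open>l\<close> makes the coefficient of the objective gap
      quadratic in k.\<close>
    have "(real k + 1)\<^sup>2 / 4 \<le> (3 / 2 + real k / 2) * (3 / 2 + real k / 2 - 1)"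
      by (simp add: power2_eq_square algebra_simps)
    also have "\<dots> \<le> l k * (l k - 1)"
      using lgrow[of k] by (intro mult_mono) auto
    finally have "(real k + 1)\<^sup>2 / 4 * (h (y k) - h u) \<le> ((l k)\<^sup>2 - l k) * (h (y k) - h u)"
      using True by (intro mult_right_mono) (auto simp: power2_eq_square algebra_simps)
    also have "\<dots> \<le> E"
    proof -
      have "0 \<le> \<Lambda> / 2 * (norm (W k - u))\<^sup>2" using \<Lambda> by simp
      with inv[of k] show ?thesis by linarith
    qed
    finally show ?thesis by (simp add: field_simps)
  next
    case False
    moreover have "4 * E / (real k + 1)\<^sup>2 \<ge> 0" using E by simp
    ultimately show ?thesis by linarith
  qed
qed

section \<open>Step count of the smoothing method\<close>

text \<open>Half of \<delta> is spent on smoothing, since \<theta> ln(m + 1) = \<delta>/2, and half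
  on optimization. As \<delta> \<le> 1, the initial energy is at most A/\<delta>, so 4 A/(\<delta>
  (k + 1)^2) \<le> \<delta>/2 suffices, and k is of order 1/\<delta>. The point u is any comparison
  point, not a minimizer.\<close>

lemma smooth_accuracy:
  fixes h :: "nat \<Rightarrow> 'a::euclidean_space \<Rightarrow> real"
  assumes sm: "\<And>j. j \<le> m \<Longrightarrow> smooth_fun_on L UNIV (h j)"
    and lip: "\<And>j. j \<le> m \<Longrightarrow> M-lipschitz_on UNIV (h j)"
    and cvx: "\<And>j z w. j \<le> m \<Longrightarrow> h j z + grad (h j) z \<bullet> (w - z) \<le> h j w"
    and m: "m \<ge> 1" and M: "M > 0" and \<delta>: "0 < \<delta>" "\<delta> \<le> 1"
    and u: "norm (x - u) \<le> D" "\<And>j. j \<le> m \<Longrightarrow> h j u \<le> B"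
    and k: "8 * (M * D + (L + 2 * M\<^sup>2 * ln (real m + 1)) / 2 * D\<^sup>2) \<le> ((real k + 1) * \<delta>)\<^sup>2"
    and j: "j \<le> m"
  shows "h j (fst ((smooth_step m L M h \<delta> ^^ k) (smooth_init x))) \<le> B + \<delta>"
proof -
  define \<theta> where "\<theta> = smooth_theta m \<delta>"
  define \<Lambda> where "\<Lambda> = L + M\<^sup>2 / \<theta>"
  define H where "H = soft_max m \<theta> h"
  have lnm: "ln (real m + 1) > 0" using m by simp
  have \<theta>: "\<theta> > 0" using \<delta> lnm by (simp add: \<theta>_def smooth_theta_def)
  have L: "L \<ge> 0" using sm[of 0] lipschitz_on_nonneg by (auto simp: smooth_fun_on_def)
  have D: "D \<ge> 0" using u(1) norm_ge_zero order_trans by blast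
  have \<Lambda>: "\<Lambda> > 0" using L M \<theta> by (simp add: \<Lambda>_def add_nonneg_pos)
  have tangent: "H a + grad H a \<bullet> (w - a) \<le> H w" for a w
    unfolding H_def using \<theta> smooth_fun_on_gderiv[OF sm] cvx by (intro soft_max_above_tangent) auto
  have descent: "H (a - (1 / \<Lambda>) *\<^sub>R grad H a) \<le> H a - (norm (grad H a))\<^sup>2 / (2 * \<Lambda>)" for a
  proof -
    have "H (a - (1 / \<Lambda>) *\<^sub>R grad H a) \<le> H a + grad H a \<bullet> ((a - (1 / \<Lambda>) *\<^sub>R grad H a) - a)
        + \<Lambda> / 2 * (norm ((a - (1 / \<Lambda>) *\<^sub>R grad H a) - a))\<^sup>2"
      unfolding H_def \<Lambda>_def using \<theta> sm lip by (rule soft_max_descent)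
    also have "\<dots> = H a - (norm (grad H a))\<^sup>2 / (2 * \<Lambda>)"
      using \<Lambda> by (simp add: power2_norm_eq_inner[symmetric] power_mult_distrib field_simps power2_eq_square)
    finally show ?thesis .
  qed
  have grad_le: "norm (grad H a) \<le> M" for a
  proof -
    have "norm (grad (h i) a) \<le> M" if "i \<le> m" for i
      using lipschitz_gderiv_norm_le smooth_fun_on_gderiv[OF sm[OF that]] lip[OF that] by blast
    hence "norm (\<Sum>i=0..m. soft_weight m \<theta> h a i *\<^sub>R grad (h i) a) \<le>
        (\<Sum>i=0..m. soft_weight m \<theta> h a i * M)"
      by (intro sum_norm_le) (auto simp: soft_weight_nonneg intro!: mult_left_mono)
    also have "\<dots> = M" by (simp add: sum_soft_weight flip: sum_distrib_right)
    also have "(\<Sum>i=0..m. soft_weight m \<theta> h a i *\<^sub>R grad (h i) a) = grad H a"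
      unfolding H_def using gderiv_imp_grad[OF soft_max_gderiv[OF \<theta> smooth_fun_on_gderiv[OF sm]]] by simp
    finally show ?thesis .
  qed
  define s where "s = (\<lambda>k. (smooth_step m L M h \<delta> ^^ k) (smooth_init x))"
  define A where "A = M * D + (L + 2 * M\<^sup>2 * ln (real m + 1)) / 2 * D\<^sup>2"
  have A0: "A \<ge> 0" unfolding A_def using M D L lnm by simp
  have st: "s (Suc k) = smooth_step m L M h \<delta> (s k)" for k by (simp add: s_def)
  have "H (fst (s k)) - H u \<le> 4 * (A / \<delta>) / (real k + 1)\<^sup>2"
  proof (rule accelerated_rate[where h = H and g = "grad H" and \<Lambda> = \<Lambda> and x = x and
        z = "\<lambda>k. fst (snd (s k))" and t = "\<lambda>k. snd (snd (s k))" and y = "\<lambda>k. fst (s k)", OF tangent descent \<Lambda>])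
    show "H x - H u + \<Lambda> / 2 * (norm (x - u))\<^sup>2 \<le> A / \<delta>"
    proof -
      have "H x - H u \<le> grad H x \<bullet> (x - u)" using tangent[of x u] by (simp add: inner_diff_right)
      also have "\<dots> \<le> norm (grad H x) * norm (x - u)" by (rule norm_cauchy_schwarz)
      also have "\<dots> \<le> M * D" using M u grad_le by (intro mult_mono) auto
      also have "\<dots> \<le> M * D / \<delta>" using \<delta> M D mult_left_le[of \<delta> "M * D"] by (simp add: field_simps)
      finally have 1: "H x - H u \<le> M * D / \<delta>" .
      have "\<Lambda> = L + 2 * M\<^sup>2 * ln (real m + 1) / \<delta>"
        using \<delta> by (simp add: \<Lambda>_def \<theta>_def smooth_theta_def)
      also have "\<dots> \<le> L / \<delta> + 2 * M\<^sup>2 * ln (real m + 1) / \<delta>"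
        using \<delta> L mult_left_le[of \<delta> L] by (simp add: pos_le_divide_eq)
      finally have "\<Lambda> / 2 * (norm (x - u))\<^sup>2 \<le> (L / \<delta> + 2 * M\<^sup>2 * ln (real m + 1) / \<delta>) / 2 * D\<^sup>2"
        using \<Lambda> u by (intro mult_mono power_mono) auto
      also have "\<dots> = (L + 2 * M\<^sup>2 * ln (real m + 1)) / 2 * D\<^sup>2 / \<delta>"
        by (simp add: add_divide_distrib algebra_simps)
      finally show ?thesis using 1 unfolding A_def add_divide_distrib[of "M * D"] by linarith
    qed
  qed (use A0 \<delta> in \<open>auto simp: st smooth_step_def Let_def case_prod_beta H_def \<Lambda>_def \<theta>_def s_def smooth_init_def\<close>)
  also have "4 * (A / \<delta>) / (real k + 1)\<^sup>2 \<le> \<delta> / 2"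
  proof -
    have "8 * A \<le> (real k + 1)\<^sup>2 * \<delta>\<^sup>2" using k by (simp add: A_def power_mult_distrib)
    thus ?thesis using \<delta> by (simp add: divide_le_eq power2_eq_square mult_ac)
  qed
  finally have 1: "H (fst (s k)) \<le> H u + \<delta> / 2" by simp
  have "H u \<le> B + \<theta> * ln (real m + 1)" unfolding H_def using \<theta> u by (intro soft_max_le) auto
  also have "\<theta> * ln (real m + 1) = \<delta> / 2" using lnm by (simp add: \<theta>_def smooth_theta_def)
  finally have "H u \<le> B + \<delta> / 2" .
  moreover have "h j (fst (s k)) \<le> H (fst (s k))" unfolding H_def using \<theta> j by (rule le_soft_max)
  ultimately have "h j (fst (s k)) \<le> B + \<delta>" using 1 by linarith
  thus ?thesis by (simp add: s_def)
qed

section \<open>Restarts of the parallel method\<close>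

text \<open>The interface to the first-order method is \<open>progress\<close>: while the relative
  gap t p - 1 is at least a times the accuracy, \<open>K l\<close> steps produce a point good enough
  to trigger a restart. The bound on p/f(x0) - 1 settles level 0 without any instance.\<close>

locale multiradial_run =
  fixes init :: "'a \<Rightarrow> 's" and step :: "real \<Rightarrow> real \<Rightarrow> 's \<Rightarrow> 's" and out :: "'s \<Rightarrow> 'a"
    and f :: "'a \<Rightarrow> ennreal" and S :: "'a set" and x0 :: 'a and b :: real and N :: nat
    and \<sigma> :: "nat \<Rightarrow> nat \<Rightarrow> 's" and \<tau> :: "nat \<Rightarrow> nat \<Rightarrow> real" and ybest :: "nat \<Rightarrow> 'a"
    and p a \<kappa> :: real and K :: "nat \<Rightarrow> nat"
  assumes run: "parallel_multiradial_run init step out f S x0 b N \<sigma> \<tau> ybest"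
    and b: "b \<ge> 2"
    and x0: "x0 \<in> S" "f x0 > 0"
    and p: "p > 0" "\<And>x. x \<in> S \<Longrightarrow> f x \<le> ennreal p"
    and a: "a > 0" "p / enn2real (f x0) - 1 \<le> a"
    and K: "\<And>l. 1 \<le> K l" "\<And>l. real (K l) \<le> \<kappa> * b ^ l"
    and progress: "\<And>l t x. 1 \<le> l \<Longrightarrow> 1 / p \<le> t \<Longrightarrow> t \<le> 1 / enn2real (f x0) \<Longrightarrow>
        x \<in> S \<Longrightarrow> f x \<ge> f x0 \<Longrightarrow> a * accuracy b l \<le> t * p - 1 \<Longrightarrow>
        out ((step t (accuracy b l) ^^ K l) (init x)) \<in> S \<and>
        1 + accuracy b l \<le> t * enn2real (f (out ((step t (accuracy b l) ^^ K l) (init x))))"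
begin

definition tbest :: "nat \<Rightarrow> real" where "tbest i = 1 / enn2real (f (ybest i))"

definition produced :: "nat \<Rightarrow> 'a set" where
  "produced i = {x0} \<union> {out (step (\<tau> l k) (accuracy b l) (\<sigma> l k)) | l k. l \<in> {1..N} \<and> k \<le> i}"

definition restart :: "nat \<Rightarrow> nat \<Rightarrow> bool" where
  "restart l i \<longleftrightarrow> tbest (Suc i) \<le> 1 / (1 + accuracy b l) * \<tau> l i"

lemma accuracy_bounds: "0 < accuracy b l" "accuracy b l \<le> 1"
  using b by (auto simp: accuracy_def intro: one_le_power)

lemma init_run: "l \<in> {1..N} \<Longrightarrow> \<sigma> l 0 = init x0" "l \<in> {1..N} \<Longrightarrow> \<tau> l 0 = 1 / enn2real (f x0)"
  using run by (auto simp: parallel_multiradial_run_def)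

lemma best_run: "is_arg_max f (\<lambda>y. y \<in> produced i \<inter> S) (ybest (Suc i))"
  using run unfolding parallel_multiradial_run_def Let_def produced_def by blast

lemma restart_run:
  "l \<in> {1..N} \<Longrightarrow> restart l i \<Longrightarrow> \<tau> l (Suc i) = tbest (Suc i) \<and> \<sigma> l (Suc i) = init (ybest (Suc i))"
  using run unfolding parallel_multiradial_run_def Let_def restart_def tbest_def by presburger

lemma continue_run:
  "l \<in> {1..N} \<Longrightarrow> \<not> restart l i \<Longrightarrow>
     \<tau> l (Suc i) = \<tau> l i \<and> \<sigma> l (Suc i) = step (\<tau> l i) (accuracy b l) (\<sigma> l i)"
  using run unfolding parallel_multiradial_run_def Let_def restart_def tbest_def by presburger

lemma ybest_in: "ybest (Suc i) \<in> S"
  using best_run[of i] by (simp add: is_arg_max_linorder)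

lemma f_le_ybest: "y \<in> produced i \<Longrightarrow> y \<in> S \<Longrightarrow> f y \<le> f (ybest (Suc i))"
  using best_run[of i] by (simp add: is_arg_max_linorder)

lemma f_x0_le: "f x0 \<le> f (ybest (Suc i))"
  using f_le_ybest[of x0 i] x0 by (simp add: produced_def)

lemma finite_on_S: "x \<in> S \<Longrightarrow> f x < \<infinity>"
  using p(2)[of x] by (metis ennreal_less_top infinity_ennreal_def le_less_trans)

lemma enn2real_le_p: "x \<in> S \<Longrightarrow> enn2real (f x) \<le> p"
  using p by (intro enn2real_leI) auto

lemma enn2real_mono_S: "x \<in> S \<Longrightarrow> f y \<le> f x \<Longrightarrow> enn2real (f y) \<le> enn2real (f x)"
  using finite_on_S by (simp add: enn2real_mono)

lemma x0_pos: "enn2real (f x0) > 0"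
  using x0 finite_on_S[OF x0(1)] by (simp add: enn2real_positive_iff)

lemma ybest_pos: "enn2real (f (ybest (Suc i))) > 0"
  using enn2real_mono_S[OF ybest_in f_x0_le, of i] x0_pos by linarith

lemma tbest_bounds: "1 / p \<le> tbest (Suc i)" "tbest (Suc i) \<le> 1 / enn2real (f x0)" "0 < tbest (Suc i)"
  using enn2real_mono_S[OF ybest_in f_x0_le, of i] x0_pos enn2real_le_p[OF ybest_in, of i] ybest_pos[of i]
  by (auto simp: tbest_def intro!: frac_le)

lemma tbest_Suc_le: "tbest (Suc (Suc i)) \<le> tbest (Suc i)"
proof -
  have "ybest (Suc i) \<in> produced i" using best_run[of i] by (simp add: is_arg_max_linorder)
  hence "ybest (Suc i) \<in> produced (Suc i)" by (auto simp: produced_def intro: le_SucI)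
  hence "f (ybest (Suc i)) \<le> f (ybest (Suc (Suc i)))" using ybest_in by (rule f_le_ybest)
  hence "enn2real (f (ybest (Suc i))) \<le> enn2real (f (ybest (Suc (Suc i))))"
    using ybest_in by (rule enn2real_mono_S[rotated])
  thus ?thesis using ybest_pos[of i] by (auto simp: tbest_def intro!: frac_le)
qed

lemma tbest_Suc_le_\<tau>: "l \<in> {1..N} \<Longrightarrow> tbest (Suc i) \<le> \<tau> l i"
proof (induction i)
  case 0
  thus ?case using tbest_bounds(2)[of 0] init_run by simp
next
  case (Suc i)
  thus ?case using restart_run[OF Suc.prems, of i] continue_run[OF Suc.prems, of i] tbest_Suc_le[of i]
    by (cases "restart l i") auto
qed

lemma \<tau>_bounds: "l \<in> {1..N} \<Longrightarrow> 1 / p \<le> \<tau> l i" "l \<in> {1..N} \<Longrightarrow> \<tau> l i > 0"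
  using tbest_Suc_le_\<tau>[of l i] tbest_bounds[of i] by linarith+

lemma restart_decrease: "l \<in> {1..N} \<Longrightarrow> restart l i \<Longrightarrow> \<tau> l (Suc i) \<le> \<tau> l i / (1 + accuracy b l)"
  using restart_run[of l i] by (simp add: restart_def)

lemma \<tau>_Suc_le: "l \<in> {1..N} \<Longrightarrow> \<tau> l (Suc i) \<le> \<tau> l i"
proof (cases "restart l i")
  case True
  assume l: "l \<in> {1..N}"
  have "\<tau> l i / (1 + accuracy b l) \<le> \<tau> l i"
    using \<tau>_bounds(2)[OF l, of i] accuracy_bounds(1)[of l] by (simp add: divide_le_eq)
  with restart_decrease[OF l True] show ?thesis by linarith
qed (use continue_run in auto)

lemma \<tau>_antimono: "l \<in> {1..N} \<Longrightarrow> i \<le> j \<Longrightarrow> \<tau> l j \<le> \<tau> l i"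
  using lift_Suc_antimono_le[of "\<tau> l"] \<tau>_Suc_le by blast

lemma \<tau>_le: "l \<in> {1..N} \<Longrightarrow> \<tau> l i \<le> 1 / enn2real (f x0)"
  using \<tau>_antimono[of l 0 i] init_run by simp

lemma tbest_le_\<tau>: "l \<in> {1..N} \<Longrightarrow> tbest (Suc i) \<le> \<tau> l (Suc i)"
  using restart_run[of l i] continue_run[of l i] tbest_Suc_le_\<tau>[of l i] by (cases "restart l i") auto

text \<open>An instance lagging behind by more than the factor 1 + \<delta> would have been
  restarted. This transfers the progress of any instance to instance l.\<close>

lemma \<tau>_le_tbest: "l \<in> {1..N} \<Longrightarrow> \<tau> l (Suc i) \<le> (1 + accuracy b l) * tbest (Suc i)"
proof (cases "restart l i")
  case True
  assume "l \<in> {1..N}"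
  thus ?thesis using restart_run[OF _ True] tbest_bounds(3)[of i] accuracy_bounds(1)[of l]
    by (simp add: less_imp_le mult_le_cancel_right1)
next
  case False
  assume "l \<in> {1..N}"
  with False show ?thesis using continue_run[OF _ False] accuracy_bounds(1)[of l]
    by (simp add: restart_def pos_le_divide_eq mult.commute)
qed

text \<open>Instance l has just been initialized, at the very start or by a restart, at a point to
  which \<open>progress\<close> applies.\<close>

definition fresh :: "nat \<Rightarrow> nat \<Rightarrow> bool" where
  "fresh l s \<longleftrightarrow> (\<exists>x\<in>S. f x0 \<le> f x \<and> \<sigma> l s = init x)"

lemma last_fresh:
  assumes l: "l \<in> {1..N}"
  shows "\<exists>s\<le>i. fresh l s \<and> (\<forall>k. s \<le> k \<and> k < i \<longrightarrow> \<not> restart l k)"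
proof (induction i)
  case 0
  show ?case using init_run(1)[OF l] x0 by (auto simp: fresh_def)
next
  case (Suc i)
  show ?case
  proof (cases "restart l i")
    case True
    hence "fresh l (Suc i)" using restart_run[OF l True] ybest_in f_x0_le by (auto simp: fresh_def)
    thus ?thesis by (intro exI[of _ "Suc i"]) auto
  next
    case False
    with Suc show ?thesis by (metis le_SucI less_Suc_eq)
  qed
qed

lemma iterate_run:
  assumes l: "l \<in> {1..N}" and nr: "\<And>k. s \<le> k \<Longrightarrow> k < s + j \<Longrightarrow> \<not> restart l k"
  shows "\<tau> l (s + j) = \<tau> l s \<and> \<sigma> l (s + j) = (step (\<tau> l s) (accuracy b l) ^^ j) (\<sigma> l s)"
  using nr by (induction j) (auto simp: continue_run[OF l])

text \<open>Without a restart the instance performs \<open>K l\<close> undisturbed steps, and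
  \<open>progress\<close> makes their result beat the restart threshold.\<close>

lemma restart_after_fresh:
  assumes l: "l \<in> {1..N}" and s: "fresh l s" and gap: "a * accuracy b l \<le> \<tau> l s * p - 1"
  shows "\<exists>k. s \<le> k \<and> k < s + K l \<and> restart l k"
proof (rule ccontr)
  assume "\<not> ?thesis"
  hence nr: "\<not> restart l k" if "s \<le> k" "k < s + K l" for k using that by blast
  from s obtain x where x: "x \<in> S" "f x0 \<le> f x" "\<sigma> l s = init x" by (auto simp: fresh_def)
  \<comment> \<open>The restart test in iteration k already sees the outcome of the step taken from
    state k, so the state after \<open>K l - 1\<close> steps is the relevant one.\<close>
  define k where "k = s + (K l - 1)"
  have it: "\<tau> l k = \<tau> l s" "\<sigma> l k = (step (\<tau> l s) (accuracy b l) ^^ (K l - 1)) (init x)"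
    using iterate_run[OF l, of s "K l - 1"] nr x by (auto simp: k_def)
  define y where "y = out ((step (\<tau> l s) (accuracy b l) ^^ K l) (init x))"
  have y: "y \<in> S" "1 + accuracy b l \<le> \<tau> l s * enn2real (f y)"
    using progress[of l "\<tau> l s" x] l x gap \<tau>_bounds[OF l] \<tau>_le[OF l] by (auto simp: y_def)
  have "K l = Suc (K l - 1)" using K(1)[of l] by simp
  hence "y = out (step (\<tau> l k) (accuracy b l) (\<sigma> l k))"
    unfolding y_def it by (metis comp_apply funpow.simps(2))
  hence "y \<in> produced k" using l by (auto simp: produced_def)
  hence "enn2real (f y) \<le> enn2real (f (ybest (Suc k)))"
    using y f_le_ybest by (intro enn2real_mono_S ybest_in) auto
  hence "\<tau> l s * enn2real (f y) \<le> \<tau> l s * enn2real (f (ybest (Suc k)))"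
    using \<tau>_bounds(2)[OF l] by (simp add: mult_left_mono)
  with y have "1 + accuracy b l \<le> \<tau> l s * enn2real (f (ybest (Suc k)))" by linarith
  hence "restart l k"
    using ybest_pos[of k] accuracy_bounds(1)[of l] unfolding restart_def tbest_def it(1)
    by (simp add: field_simps)
  moreover have "s \<le> k" "k < s + K l" using K(1)[of l] by (auto simp: k_def)
  ultimately show False using nr by blast
qed

text \<open>Time i need not be fresh. Going back to the last fresh time leaves the parameter
  unchanged, and the restart promised from there cannot precede i.\<close>

lemma restart_soon:
  assumes l: "l \<in> {1..N}" and gap: "a * accuracy b l \<le> \<tau> l i * p - 1"
  shows "\<exists>j. i \<le> j \<and> j \<le> i + K l \<and> \<tau> l j \<le> \<tau> l i / (1 + accuracy b l)"
proof -
  obtain s where s: "s \<le> i" "fresh l s" "\<And>k. s \<le> k \<Longrightarrow> k < i \<Longrightarrow> \<not> restart l k"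
    using last_fresh[OF l, of i] by blast
  have "\<tau> l i = \<tau> l s" using iterate_run[OF l, of s "i - s"] s by auto
  with gap have "a * accuracy b l \<le> \<tau> l s * p - 1" by simp
  from restart_after_fresh[OF l s(2) this] obtain k
    where k: "s \<le> k" "k < s + K l" "restart l k" by blast
  have "i \<le> k" using s(3) k by (meson not_le)
  have "\<tau> l (Suc k) \<le> \<tau> l k / (1 + accuracy b l)" by (rule restart_decrease[OF l k(3)])
  also have "\<dots> \<le> \<tau> l i / (1 + accuracy b l)"
    using \<tau>_antimono[OF l \<open>i \<le> k\<close>] accuracy_bounds(1)[of l] by (intro divide_right_mono) auto
  finally show ?thesis using \<open>i \<le> k\<close> k s(1) by (intro exI[of _ "Suc k"]) auto
qed

lemma gap_closed_after:
  assumes l: "l \<in> {1..N}"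
  shows "\<tau> l i * p - 1 \<le> real n * accuracy b l / 2 \<Longrightarrow>
    \<exists>j. i \<le> j \<and> j \<le> i + n * K l \<and> \<tau> l j * p - 1 < a * accuracy b l"
proof (induction n arbitrary: i)
  case 0
  moreover have "a * accuracy b l > 0" using a accuracy_bounds by simp
  ultimately have "\<tau> l i * p - 1 < a * accuracy b l" by simp
  thus ?case by auto
next
  case (Suc n)
  define \<delta> where "\<delta> = accuracy b l"
  have \<delta>: "0 < \<delta>" "\<delta> \<le> 1" using accuracy_bounds by (auto simp: \<delta>_def)
  show ?case
  proof (cases "a * accuracy b l \<le> \<tau> l i * p - 1")
    case True
    from restart_soon[OF l this] obtain j where
      j: "i \<le> j" "j \<le> i + K l" "\<tau> l j \<le> \<tau> l i / (1 + \<delta>)" by (auto simp: \<delta>_def)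
    have "\<tau> l j * p \<le> \<tau> l i / (1 + \<delta>) * p" using j p by (intro mult_right_mono) auto
    also have "\<dots> = \<tau> l i * p - \<tau> l i * p * (\<delta> / (1 + \<delta>))"
      using \<delta> by (simp add: field_simps)
    finally have "\<tau> l j * p \<le> \<tau> l i * p - \<tau> l i * p * (\<delta> / (1 + \<delta>))" .
    \<comment> \<open>Uses \<tau> p \<ge> 1 and \<delta> \<le> 1: the decrease is bounded below
      independently of the current gap.\<close>
    moreover have "\<tau> l i * p * (\<delta> / (1 + \<delta>)) \<ge> 1 * (\<delta> / 2)"
      using \<tau>_bounds(1)[OF l, of i] p \<delta> by (intro mult_mono frac_le) (auto simp: field_simps)
    ultimately have "\<tau> l j * p - 1 \<le> real n * accuracy b l / 2"
      using Suc.prems by (simp add: \<delta>_def distrib_right add_divide_distrib)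
    from Suc.IH[OF this] obtain k where "j \<le> k" "k \<le> j + n * K l" "\<tau> l k * p - 1 < a * accuracy b l"
      by blast
    with j show ?thesis by (intro exI[of _ k]) auto
  next
    case False
    thus ?thesis by (intro exI[of _ i]) auto
  qed
qed

text \<open>When level l is done, the gap of instance l + 1 is at most (1 + 2 a b) \<delta>, where
  \<delta> is the accuracy of level l + 1, and every restart removes at least \<delta>/2.\<close>

definition restarts :: nat where "restarts = nat \<lceil>2 * (1 + 2 * a * b)\<rceil>"

lemma \<kappa>_pos: "\<kappa> > 0"
  using K(1)[of 0] K(2)[of 0] by simp

text \<open>The induction is on the gap of the common best point, which passes from one instance to
  the next.\<close>

lemma level_time:
  "l \<le> N \<Longrightarrow> \<exists>i\<ge>1. tbest i * p - 1 \<le> a * accuracy b l \<and> real i \<le> 1 + 2 * restarts * \<kappa> * b ^ l"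
proof (induction l)
  case 0
  have "tbest 1 * p \<le> 1 / enn2real (f x0) * p"
    using tbest_bounds(2)[of 0] p by (intro mult_right_mono) auto
  hence "tbest 1 * p - 1 \<le> a * accuracy b 0" using a by (simp add: accuracy_def)
  moreover have "0 \<le> 2 * real restarts * \<kappa> * b ^ 0" using \<kappa>_pos by simp
  ultimately show ?case by (intro exI[of _ 1]) auto
next
  case (Suc l)
  then obtain i where i: "i \<ge> 1" "tbest i * p - 1 \<le> a * accuracy b l"
    "real i \<le> 1 + 2 * restarts * \<kappa> * b ^ l" by auto
  have l: "Suc l \<in> {1..N}" using Suc by simp
  define \<delta> where "\<delta> = accuracy b (Suc l)"
  have \<delta>: "0 < \<delta>" "\<delta> \<le> 1" using accuracy_bounds by (auto simp: \<delta>_def)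
  have acc: "accuracy b l = b * \<delta>" using b by (simp add: \<delta>_def accuracy_def)
  obtain i' where i': "i = Suc i'" using i by (cases i) auto
  have "\<tau> (Suc l) i * p \<le> (1 + \<delta>) * tbest i * p"
    using \<tau>_le_tbest[OF l, of i'] p unfolding i' \<delta>_def by (intro mult_right_mono) auto
  also have "\<dots> = (1 + \<delta>) * (tbest i * p)" by simp
  also have "\<dots> \<le> (1 + \<delta>) * (1 + a * (b * \<delta>))" using i acc \<delta> by (intro mult_left_mono) auto
  also have "\<dots> = 1 + \<delta> + a * b * \<delta> + a * b * (\<delta> * \<delta>)" by (simp add: algebra_simps)
  also have "\<dots> \<le> 1 + \<delta> + a * b * \<delta> + a * b * (\<delta> * 1)"
    using a b \<delta> by (intro add_left_mono mult_left_mono) auto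
  finally have "\<tau> (Suc l) i * p - 1 \<le> 2 * (1 + 2 * a * b) * \<delta> / 2" by (simp add: algebra_simps)
  also have "\<dots> \<le> real restarts * \<delta> / 2"
    using \<delta> unfolding restarts_def by (intro divide_right_mono mult_right_mono real_nat_ceiling_ge) auto
  finally obtain j where j: "i \<le> j" "j \<le> i + restarts * K (Suc l)" "\<tau> (Suc l) j * p - 1 < a * \<delta>"
    using gap_closed_after[OF l, of i restarts] by (auto simp: \<delta>_def)
  obtain j' where j': "j = Suc j'" using i j by (cases j) auto
  have "tbest j * p \<le> \<tau> (Suc l) j * p" using tbest_le_\<tau>[OF l, of j'] p unfolding j' by simp
  hence "tbest j * p - 1 \<le> a * \<delta>" using j by linarith
  moreover have "real j \<le> 1 + 2 * restarts * \<kappa> * b ^ Suc l"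
  proof -
    have "real j \<le> real i + real restarts * real (K (Suc l))"
      using j(2) by (metis of_nat_add of_nat_mono of_nat_mult)
    also have "\<dots> \<le> 1 + 2 * restarts * \<kappa> * b ^ l + restarts * (\<kappa> * b ^ Suc l)"
      using i K(2)[of "Suc l"] by (intro add_mono mult_left_mono) auto
    \<comment> \<open>Since b \<ge> 2, the time spent on all earlier levels is at most that of the
      new one; this is the geometric sum.\<close>
    also have "2 * restarts * \<kappa> * b ^ l \<le> restarts * \<kappa> * b ^ Suc l"
    proof -
      have "2 * b ^ l \<le> b ^ Suc l" using b by simp
      from mult_left_mono[OF this, of "real restarts * \<kappa>"] show ?thesis using \<kappa>_pos by (simp add: mult_ac)
    qed
    finally show ?thesis by (simp add: mult_ac)
  qed
  ultimately show ?case using i j by (intro exI[of _ j]) (auto simp: \<delta>_def)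
qed

lemma eps_time:
  assumes eps: "\<epsilon> > 0" and N: "a * p \<le> \<epsilon> * b ^ N"
  shows "\<exists>i\<ge>1. ybest i \<in> S \<and> p - enn2real (f (ybest i)) \<le> \<epsilon> \<and>
    (\<epsilon> \<le> a * p \<longrightarrow> real i \<le> (1 + 2 * restarts * \<kappa>) * (b * a * p) / \<epsilon>)"
proof -
  \<comment> \<open>The coarsest sufficient level: minimality bounds b^l by b a p/\<epsilon>,
    whatever N is.\<close>
  define l where "l = (LEAST l. a * p \<le> \<epsilon> * b ^ l)"
  have l: "a * p \<le> \<epsilon> * b ^ l" unfolding l_def using N by (rule LeastI)
  have "l \<le> N" unfolding l_def using N by (rule Least_le)
  from level_time[OF this] obtain i where i: "i \<ge> 1" "tbest i * p - 1 \<le> a * accuracy b l"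
    "real i \<le> 1 + 2 * restarts * \<kappa> * b ^ l" by blast
  obtain i' where i': "i = Suc i'" using i by (cases i) auto
  define w where "w = enn2real (f (ybest i))"
  have w: "0 < w" "w \<le> p" using ybest_pos enn2real_le_p[OF ybest_in] by (auto simp: w_def i')
  have "a * accuracy b l \<le> \<epsilon> / p"
    using l b p by (simp add: accuracy_def field_simps)
  with i have "p / w - 1 \<le> \<epsilon> / p" by (simp add: tbest_def w_def)
  hence "w * (p / w - 1) \<le> w * (\<epsilon> / p)" using w by (intro mult_left_mono) auto
  also have "\<dots> \<le> p * (\<epsilon> / p)" using w eps p by (intro mult_right_mono) auto
  finally have "p - w \<le> \<epsilon>" using w p by (simp add: algebra_simps)
  moreover have "real i \<le> (1 + 2 * restarts * \<kappa>) * (b * a * p) / \<epsilon>" if "\<epsilon> \<le> a * p"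
  proof -
    have "\<epsilon> * b ^ l \<le> b * (a * p)"
    \<comment> \<open>For l = 0 minimality says nothing, and \<epsilon> \<le> a p is used
      instead.\<close>
    proof (cases l)
      case 0
      have "1 * \<epsilon> \<le> b * (a * p)" using that b eps by (intro mult_mono) auto
      thus ?thesis using 0 by simp
    next
      case (Suc k)
      have "\<not> a * p \<le> \<epsilon> * b ^ k" 
        using not_less_Least[of k "\<lambda>l. a * p \<le> \<epsilon> * b ^ l"] Suc unfolding l_def by simp
      hence "b * (\<epsilon> * b ^ k) \<le> b * (a * p)" using b by (intro mult_left_mono) auto
      thus ?thesis using Suc by (simp add: mult_ac)
    qed
    hence bl: "b ^ l \<le> b * a * p / \<epsilon>" using eps by (simp add: field_simps)
    have "real i \<le> 1 * b ^ l + 2 * restarts * \<kappa> * b ^ l" using i(3) b one_le_power[of b l] by linarith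
    also have "\<dots> = (1 + 2 * restarts * \<kappa>) * b ^ l" by (simp add: algebra_simps)
    also have "\<dots> \<le> (1 + 2 * restarts * \<kappa>) * (b * a * p / \<epsilon>)"
      using bl \<kappa>_pos by (intro mult_left_mono) auto
    finally show ?thesis by simp
  qed
  ultimately show ?thesis using i(1) ybest_in by (intro exI[of _ i]) (auto simp: w_def i')
qed

end

section \<open>Assumptions on the objective\<close>

locale smooth_concave_objective =
  fixes f :: "'a::euclidean_space \<Rightarrow> ennreal" and S0 :: "'a set" and e0 :: 'a and R0 D0 \<beta> :: real
    and x0 :: 'a
  assumes concave_f: "concave_ennreal f" and usc: "upper_semicontinuous f"
    and S0: "S0 = closure (eff_dom f)" "bounded S0" "D0 = diameter S0"
    and e0: "e0 \<in> interior S0" and R0: "R0 = inner_radius e0 S0" "R0 > 0"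
    and C2: "twice_cont_diff f"
    and smooth_f: "smooth_fun_on \<beta> (eff_dom f) (\<lambda>x. enn2real (f x))"
    and x0_dom: "x0 \<in> eff_dom f"
begin

text \<open>At a point of infinite value the hypograph contains all heights. Concavity would lift f
  above every bound at a point w close to x0, where f is finite because dom f is open.\<close>

lemma f_finite: "f z < \<infinity>"
proof (rule ccontr)
  assume "\<not> f z < \<infinity>"
  hence z: "f z = \<infinity>" by (simp add: less_top[symmetric])
  have "open (eff_dom f)" using C2 by (simp add: twice_cont_diff_def)
  then obtain t where t: "t > 0" "ball x0 t \<subseteq> eff_dom f" using x0_dom open_contains_ball by blast
  define s where "s = min 1 (t / (2 * (norm (z - x0) + 1)))"
  have s: "0 < s" "s \<le> 1" using t by (auto simp: s_def add_nonneg_pos intro!: divide_pos_pos)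
  define w where "w = (1 - s) *\<^sub>R x0 + s *\<^sub>R z"
  have "norm (w - x0) = s * norm (z - x0)"
  proof -
    have "w - x0 = s *\<^sub>R (z - x0)" by (simp add: w_def algebra_simps)
    thus ?thesis using s by simp
  qed
  also have "\<dots> \<le> t / (2 * (norm (z - x0) + 1)) * norm (z - x0)"
    by (intro mult_right_mono) (auto simp: s_def)
  also have "\<dots> < t" using t by (simp add: divide_less_eq add_nonneg_pos)
  finally have "w \<in> eff_dom f" using t by (auto simp: dist_norm norm_minus_commute)
  hence fw: "f w < \<infinity>" by (simp add: eff_dom_def)
  \<comment> \<open>Chosen so that s u exceeds f(w) by 1.\<close>
  define u where "u = (enn2real (f w) + 1) / s"
  have u: "u > 0" using s by (simp add: u_def add_nonneg_pos)
  have x0f: "0 < enn2real (f x0)" "f x0 = ennreal (enn2real (f x0))"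
    using x0_dom by (auto simp: eff_dom_def enn2real_positive_iff)
  have "(x0, enn2real (f x0)) \<in> hypograph f" using x0f by (simp add: hypograph_def)
  moreover have "(z, u) \<in> hypograph f" using u z by (simp add: hypograph_def)
  ultimately have "(1 - s) *\<^sub>R (x0, enn2real (f x0)) + s *\<^sub>R (z, u) \<in> hypograph f"
    using concave_f s unfolding concave_ennreal_def by (intro convexD_alt) auto
  hence "ennreal ((1 - s) * enn2real (f x0) + s * u) \<le> f w" by (simp add: hypograph_def w_def)
  also have "f w = ennreal (enn2real (f w))" using fw by simp
  finally have "(1 - s) * enn2real (f x0) + s * u \<le> enn2real (f w)" by (subst (asm) ennreal_le_iff) auto
  moreover have "s * u = enn2real (f w) + 1" using s by (simp add: u_def)
  moreover have "(1 - s) * enn2real (f x0) \<ge> 0" using s by simp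
  ultimately show False by linarith
qed

definition F :: "'a \<Rightarrow> real" where "F x = enn2real (f x)"

lemma F_nonneg: "F x \<ge> 0"
  by (simp add: F_def)

lemma f_eq: "f x = ennreal (F x)"
  using f_finite[of x] by (simp add: F_def)

lemma eff_dom_eq: "eff_dom f = {x. F x > 0}"
  using f_finite by (auto simp: eff_dom_def F_def enn2real_positive_iff)

lemma F_concave:
  assumes "F x > 0" "F y > 0" "0 \<le> s" "s \<le> 1"
  shows "(1 - s) * F x + s * F y \<le> F ((1 - s) *\<^sub>R x + s *\<^sub>R y)"
proof -
  have "(x, F x) \<in> hypograph f" "(y, F y) \<in> hypograph f"
    using assms by (auto simp: hypograph_def f_eq)
  hence "(1 - s) *\<^sub>R (x, F x) + s *\<^sub>R (y, F y) \<in> hypograph f"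
    using concave_f assms unfolding concave_ennreal_def by (intro convexD_alt) auto
  hence "ennreal ((1 - s) * F x + s * F y) \<le> ennreal (F ((1 - s) *\<^sub>R x + s *\<^sub>R y))"
    by (simp add: hypograph_def flip: f_eq)
  thus ?thesis by (subst (asm) ennreal_le_iff) (auto simp: F_def)
qed

lemma F_gderiv: "F x > 0 \<Longrightarrow> GDERIV F x :> grad F x"
  using smooth_fun_on_gderiv[OF smooth_f] unfolding eff_dom_eq F_def[symmetric] by simp

text \<open>Differentiability gives continuity in the domain; at a zero of F, upper semicontinuity
  and F \<ge> 0 suffice.\<close>

lemma F_continuous: "continuous_on UNIV F"
proof -
  have "isCont F x" for x
  proof (cases "F x > 0")
    case True
    from F_gderiv[OF this] show ?thesis unfolding gderiv_def by (rule has_derivative_continuous)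
  next
    case False
    hence Fx: "F x = 0" using F_nonneg[of x] by simp
    have "(F \<longlongrightarrow> 0) (nhds x)"
    proof (rule order_tendstoI)
      fix u :: real assume "0 < u"
      hence "f x < ennreal u" by (simp add: f_eq Fx)
      hence "\<forall>\<^sub>F y in nhds x. f y < ennreal u" using usc by (auto simp: upper_semicontinuous_def)
      thus "\<forall>\<^sub>F y in nhds x. F y < u"
        by eventually_elim (simp add: f_eq F_nonneg ennreal_less_iff)
    next
      fix u :: real assume "u < 0"
      thus "\<forall>\<^sub>F y in nhds x. u < F y"
        by (intro always_eventually) (auto simp: F_def intro: less_le_trans)
    qed
    thus ?thesis unfolding isCont_def Fx by (rule filterlim_mono) (auto simp: at_within_def)
  qed
  thus ?thesis by (simp add: continuous_on_eq_continuous_at)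
qed

lemma interior_S0: "interior S0 = {x. F x > 0}"
proof -
  have "convex (eff_dom f)" unfolding eff_dom_eq using F_concave by (rule convex_Collect_pos)
  hence "interior S0 = interior (eff_dom f)" unfolding S0(1) by (rule convex_interior_closure)
  also have "\<dots> = eff_dom f" using C2 by (simp add: twice_cont_diff_def interior_open)
  finally show ?thesis by (simp add: eff_dom_eq)
qed

lemma profile: "smooth_concave_profile F e0 R0 D0 (grad F) \<beta>"
proof
  show "F x \<ge> 0" for x by (rule F_nonneg)
  show "continuous_on UNIV F" by (rule F_continuous)
  show "R0 > 0" by (rule R0)
  show "0 < F x" if "norm (x - e0) < R0" for x
  proof -
    have "ball e0 R0 \<subseteq> S0"
    proof
      fix y assume y: "y \<in> ball e0 R0"
      show "y \<in> S0"
      proof (rule ccontr)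
        assume "y \<notin> S0"
        hence "R0 \<le> norm (y - e0)" unfolding R0(1) inner_radius_def
          by (intro cINF_lower bdd_belowI2[of _ 0]) auto
        thus False using y by (simp add: dist_norm norm_minus_commute)
      qed
    qed
    hence "ball e0 R0 \<subseteq> interior S0" by (simp add: interior_maximal)
    thus ?thesis using that by (auto simp: interior_S0 dist_norm norm_minus_commute)
  qed
  show "norm (x - y) \<le> D0" if "F x > 0" "F y > 0" for x y
  proof -
    have "x \<in> S0" "y \<in> S0" using that closure_subset[of "{x. F x > 0}"] by (auto simp: S0(1) eff_dom_eq)
    from diameter_bounded_bound[OF S0(2) this] show ?thesis by (simp add: S0(3) dist_norm)
  qed
  show "norm (grad F x - grad F y) \<le> \<beta> * norm (x - y)" if "F x > 0" "F y > 0" for x y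
  proof -
    have "\<beta>-lipschitz_on {x. F x > 0} (grad F)"
      using smooth_f unfolding smooth_fun_on_def eff_dom_eq F_def[symmetric] by simp
    from lipschitz_on_normD[OF this] that show ?thesis by simp
  qed
  show "\<beta> \<ge> 0" using smooth_f lipschitz_on_nonneg by (auto simp: smooth_fun_on_def)
qed (use F_concave F_gderiv in auto)

end

lemma ex_smooth_convex_body:
  fixes S :: "'a::euclidean_space set"
  assumes "compact S" "convex S" "e \<in> interior S" "smooth_set \<beta> S" "\<beta> \<ge> 0"
  shows "\<exists>r \<Delta>. smooth_convex_body S e r \<Delta> \<beta>"
proof -
  obtain r where r: "r > 0" "cball e r \<subseteq> S" using assms(3) mem_interior_cball by blast
  obtain B where B: "\<And>x. x \<in> S \<Longrightarrow> norm x \<le> B"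
    using compact_imp_bounded[OF assms(1)] by (auto simp: bounded_iff)
  have "norm (x - e) \<le> \<bar>B\<bar> + norm e + 1" if "x \<in> S" for x
    using B[OF that] norm_triangle_ineq4[of x e] by linarith
  moreover have "\<bar>B\<bar> + norm e + 1 > 0" by (simp add: add_nonneg_pos)
  ultimately have "smooth_convex_body S e r (\<bar>B\<bar> + norm e + 1) \<beta>"
    using r assms by unfold_locales auto
  thus ?thesis by blast
qed

section \<open>The radial components\<close>

text \<open>Here \<gamma> is the gauge of the maximizer and \<sigma> the slack of the Slater point,
  so that \<eta> = (1 - \<gamma>) \<sigma>.\<close>

locale radial_problem = smooth_concave_profile F "e 0" R0 D0 g \<beta>
  for F :: "'a::euclidean_space \<Rightarrow> real" and e :: "nat \<Rightarrow> 'a" and R0 D0 g \<beta> +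
  fixes m :: nat and S :: "nat \<Rightarrow> 'a set" and x_star x_SL x0 :: 'a and p \<gamma> \<sigma> :: real
  assumes m: "m \<ge> 1"
    and bodies: "\<And>j. j \<in> {1..m} \<Longrightarrow> \<exists>r \<Delta>. smooth_convex_body (S j) (e j) r \<Delta> \<beta>"
    and x_star: "F x_star = p" "p > 0" "\<And>j. j \<in> {1..m} \<Longrightarrow> x_star \<in> S j"
    and x_SL: "F x_SL > 0" "\<And>j. j \<in> {1..m} \<Longrightarrow> phi_set (S j) (e j) x_SL \<le> 1 - \<sigma>"
    and \<gamma>: "\<gamma> = gauge_at (closure {x. F x > 0}) (e 0) x_star" "0 \<le> \<gamma>" "\<gamma> < 1"
    and \<sigma>: "0 < \<sigma>" "\<sigma> \<le> 1"
    and x0: "F x0 > 0" "F x0 \<le> p"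
begin

abbreviation component :: "real \<Rightarrow> nat \<Rightarrow> 'a \<Rightarrow> real" where
  "component \<equiv> radial_components (\<lambda>x. ennreal (F x)) S e"

lemma component_0: "component \<tau> 0 = rad \<tau>"
  by (auto simp: radial_components_def rad_def)

lemma component_pos: "j \<in> {1..m} \<Longrightarrow> component \<tau> j = phi_set (S j) (e j)"
  by (auto simp: radial_components_def)

definition \<rho> :: real where "\<rho> = R0 / (D0 + R0)"

lemma \<rho>: "0 < \<rho>" "\<rho> \<le> 1"
  using R_pos \<Delta>_nonneg by (auto simp: \<rho>_def divide_le_eq)

text \<open>The constant \<open>c_\<tau>\<close> at \<tau> = 1/F(x0), where it is smallest over the
  admissible parameters.\<close>

definition c :: real where "c = 1 / (p / F x0) * \<rho> * ((1 - \<gamma>) * \<sigma>)"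

lemma c_pos: "c > 0"
  using x0 \<rho> \<gamma>(2,3) \<sigma> x_star(2) unfolding c_def by simp

lemma parameter_pos: "\<tau> \<in> {1 / p..1 / F x0} \<Longrightarrow> \<tau> > 0"
  using x_star by (simp add: less_le_trans[of 0 "1 / p"])

lemma ex_method_constants:
  "\<exists>L M. method_constants m (\<lambda>x. ennreal (F x)) S e {1 / p..1 / F x0} L M"
proof -
  have "\<exists>L M. \<forall>\<tau>\<in>{1 / p..1 / F x0}. smooth_fun_on L UNIV (component \<tau> j) \<and> M-lipschitz_on UNIV (component \<tau> j)"
    if j: "j \<in> {0..m}" for j
  proof (cases "j = 0")
    case True
    show ?thesis
      unfolding True component_0
      using lipschitz_subgradient_smooth(2)[OF rad_subgradient rad_slope_lipschitz] rad_lipschitz parameter_pos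
      by (metis atLeastAtMost_iff)
  next
    case False
    hence j': "j \<in> {1..m}" using j by simp
    then obtain r \<Delta> where "smooth_convex_body (S j) (e j) r \<Delta> \<beta>" using bodies by blast
    then interpret B: smooth_convex_body "S j" "e j" r \<Delta> \<beta> .
    show ?thesis unfolding component_pos[OF j']
      using lipschitz_subgradient_smooth(2)[OF B.phi_subgradient B.phi_slope_lipschitz] B.phi_lipschitz
      by blast
  qed
  then obtain Lf Mf where LM: "\<And>j \<tau>. j \<in> {0..m} \<Longrightarrow> \<tau> \<in> {1 / p..1 / F x0} \<Longrightarrow>
      smooth_fun_on (Lf j) UNIV (component \<tau> j) \<and> (Mf j)-lipschitz_on UNIV (component \<tau> j)" by metis
  have "Lf j \<le> Max (Lf ` {0..m})" "Mf j \<le> Max (Mf ` {0..m})" if "j \<in> {0..m}" for j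
    using that by (auto intro!: Max_ge)
  hence "method_constants m (\<lambda>x. ennreal (F x)) S e {1 / p..1 / F x0}
      (Max (Lf ` {0..m})) (Max (Mf ` {0..m}))"
    using LM unfolding method_constants_def smooth_fun_on_def by (meson lipschitz_on_le)
  thus ?thesis by blast
qed

lemma component_above_tangent:
  assumes \<tau>: "\<tau> \<in> {1 / p..1 / F x0}" and j: "j \<le> m"
  shows "component \<tau> j z + grad (component \<tau> j) z \<bullet> (w - z) \<le> component \<tau> j w"
proof (cases "j = 0")
  case True
  have "grad (rad \<tau>) = rad_slope \<tau>"
    using lipschitz_subgradient_smooth(1)[OF rad_subgradient rad_slope_lipschitz] parameter_pos[OF \<tau>] by blast
  thus ?thesis using rad_subgradient[OF parameter_pos[OF \<tau>]] by (simp add: True component_0)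
next
  case False
  hence j': "j \<in> {1..m}" using j by simp
  then obtain r \<Delta> where "smooth_convex_body (S j) (e j) r \<Delta> \<beta>" using bodies by blast
  then interpret B: smooth_convex_body "S j" "e j" r \<Delta> \<beta> .
  have "grad (phi_set (S j) (e j)) = B.phi_slope"
    using lipschitz_subgradient_smooth(1)[OF B.phi_subgradient B.phi_slope_lipschitz] .
  thus ?thesis using B.phi_subgradient by (simp add: component_pos[OF j'])
qed

lemma phi_le_1: "j \<in> {1..m} \<Longrightarrow> phi_set (S j) (e j) y \<le> 1 \<longleftrightarrow> y \<in> S j"
  using bodies[of j] convex_body.phi_le_1_iff smooth_convex_body.axioms(1) by metis

lemma lipschitz_constant_pos:
  assumes "method_constants m (\<lambda>x. ennreal (F x)) S e {1 / p..1 / F x0} L M"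
  shows "M > 0"
proof -
  have j: "1 \<in> {1..m}" using m by simp
  then obtain r \<Delta> where "smooth_convex_body (S 1) (e 1) r \<Delta> \<beta>" using bodies by blast
  then interpret B: smooth_convex_body "S 1" "e 1" r \<Delta> \<beta> .
  have "1 / p \<in> {1 / p..1 / F x0}" using x0 by (simp add: frac_le)
  hence "M-lipschitz_on UNIV (component (1 / p) 1)" using assms m by (auto simp: method_constants_def)
  hence M: "M-lipschitz_on UNIV (phi_set (S 1) (e 1))" unfolding component_pos[OF j] .
  hence "M \<noteq> 0" using B.phi_nonconstant by blast
  thus ?thesis using lipschitz_on_nonneg[OF M] by simp
qed

text \<open>The comparison point lies on the segment from the maximizer to the Slater point; its position
  balances the decrease of the constraint gauges against the growth of the radial transform, which
  is \<open>1/R\<^sub>0\<close>-Lipschitz.\<close>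

lemma comparison_point:
  assumes \<tau>: "\<tau> \<in> {1 / p..1 / F x0}"
  obtains u where "F u > 0" "\<And>j. j \<le> m \<Longrightarrow> component \<tau> j u \<le> 1 - c * (\<tau> * p - 1)"
proof -
  have \<tau>0: "\<tau> > 0" by (rule parameter_pos[OF \<tau>])
  have tp: "\<tau> * p \<ge> 1" using \<tau> x_star by (simp add: field_simps)
  \<comment> \<open>By \<open>rad_le_of_gauge\<close> the transform is at most 1 - d at the
    maximizer.\<close>
  define d where "d = (1 - \<gamma>) * ((\<tau> * p - 1) / (\<tau> * p))"
  have d: "0 \<le> d" "d \<le> 1"
  proof -
    have "(\<tau> * p - 1) / (\<tau> * p) \<le> 1" "0 \<le> (\<tau> * p - 1) / (\<tau> * p)" using tp by (auto simp: divide_le_eq)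
    thus "0 \<le> d" "d \<le> 1" unfolding d_def using \<gamma>(2,3)
      by (intro mult_nonneg_nonneg mult_le_one; simp)+
  qed
  \<comment> \<open>Moving by the fraction l raises the transform by at most l D0/R0 = d (1 -
    \<rho>), which leaves 1 - \<rho> d = 1 - l.\<close>
  define l where "l = \<rho> * d"
  have l: "0 \<le> l" "l \<le> 1" using d \<rho> by (auto simp: l_def intro!: mult_le_one)
  define u where "u = (1 - l) *\<^sub>R x_star + l *\<^sub>R x_SL"
  have Fs: "F x_star > 0" using x_star by simp
  have Fu: "F u > 0"
    using convexD_alt[OF convex_pos, of x_star x_SL l] Fs x_SL l by (simp add: u_def)
  have main: "c * (\<tau> * p - 1) \<le> l * \<sigma>"
  proof -
    have "p / F x0 \<ge> \<tau> * p" using \<tau> x_star x0 by (simp add: field_simps)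
    hence "1 / (p / F x0) \<le> 1 / (\<tau> * p)" using tp by (intro frac_le) auto
    hence "1 / (p / F x0) * (\<rho> * ((1 - \<gamma>) * \<sigma>) * (\<tau> * p - 1)) \<le>
        1 / (\<tau> * p) * (\<rho> * ((1 - \<gamma>) * \<sigma>) * (\<tau> * p - 1))"
      using \<rho> \<gamma>(2,3) \<sigma> tp by (intro mult_right_mono) auto
    thus ?thesis by (simp add: c_def l_def d_def mult_ac)
  qed
  have "component \<tau> j u \<le> 1 - l * \<sigma>" if "j \<le> m" for j
  proof (cases "j = 0")
    case True
    have "rad \<tau> x_star \<le> \<gamma> + (1 - \<gamma>) / (\<tau> * F x_star)"
      using \<tau>0 Fs tp \<gamma> x_star by (intro rad_le_of_gauge) auto
    also have "\<dots> = 1 - d"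
    proof -
      have "d = (1 - \<gamma>) * (1 - 1 / (\<tau> * p))" 
        unfolding d_def diff_divide_distrib using \<tau>0 x_star(2) by simp
      thus ?thesis by (simp add: x_star algebra_simps)
    qed
    finally have 1: "rad \<tau> x_star \<le> 1 - d" .
    have "rad \<tau> u - rad \<tau> x_star \<le> 1 / R0 * norm (u - x_star)"
      using lipschitz_on_normD[OF rad_lipschitz[OF \<tau>0], of u x_star] by simp
    also have "u - x_star = l *\<^sub>R (x_SL - x_star)" by (simp add: u_def algebra_simps)
    also have "1 / R0 * norm (l *\<^sub>R (x_SL - x_star)) \<le> 1 / R0 * (l * D0)"
      using diam[OF x_SL(1) Fs] l R_pos by (intro mult_left_mono) (auto intro: mult_left_mono)
    also have "\<dots> = d * (1 - \<rho>)"
      using R_pos \<Delta>_nonneg by (simp add: l_def \<rho>_def field_simps)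
    finally have "rad \<tau> u \<le> 1 - l" using 1 by (simp add: l_def algebra_simps)
    also have "\<dots> \<le> 1 - l * \<sigma>" using l \<sigma> by (simp add: mult_left_le)
    finally show ?thesis by (simp add: True component_0)
  next
    case False
    hence j: "j \<in> {1..m}" using that by simp
    let ?h = "phi_set (S j) (e j)"
    have t: "?h u + grad ?h u \<bullet> (w - u) \<le> ?h w" for w
      using component_above_tangent[OF \<tau> that, of u w] by (simp add: component_pos[OF j])
    \<comment> \<open>Convexity of ?h is available through tangents at u; averaged with weights 1 -
      l and l, their linear parts cancel.\<close>
    have "(1 - l) * (?h u + grad ?h u \<bullet> (x_star - u)) + l * (?h u + grad ?h u \<bullet> (x_SL - u)) \<le>
        (1 - l) * 1 + l * (1 - \<sigma>)"
    proof (intro add_mono mult_left_mono)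
      show "?h u + grad ?h u \<bullet> (x_star - u) \<le> 1"
        using t[of x_star] phi_le_1[OF j, of x_star] x_star(3)[OF j] by linarith
      show "?h u + grad ?h u \<bullet> (x_SL - u) \<le> 1 - \<sigma>" using t[of x_SL] x_SL(2)[OF j] by linarith
    qed (use l in auto)
    moreover have "(1 - l) * (?h u + grad ?h u \<bullet> (x_star - u)) + l * (?h u + grad ?h u \<bullet> (x_SL - u)) =
       ?h u + grad ?h u \<bullet> ((1 - l) *\<^sub>R (x_star - u) + l *\<^sub>R (x_SL - u))"
      by (simp add: inner_add_right algebra_simps)
    moreover have "(1 - l) *\<^sub>R (x_star - u) + l *\<^sub>R (x_SL - u) = 0" by (simp add: u_def algebra_simps)
    ultimately have "?h u + grad ?h u \<bullet> 0 \<le> (1 - l) * 1 + l * (1 - \<sigma>)" by metis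
    hence "?h u \<le> 1 - l * \<sigma>" by (simp add: algebra_simps)
    thus ?thesis by (simp add: component_pos[OF j])
  qed
  with main have "\<And>j. j \<le> m \<Longrightarrow> component \<tau> j u \<le> 1 - c * (\<tau> * p - 1)" by fastforce
  with Fu that show ?thesis by blast
qed

section \<open>Progress of one instance and the bound for a run\<close>

text \<open>The square root of the quantity required in \<open>smooth_accuracy\<close>; times b^l,
  it gives the number of steps for accuracy b^(-l).\<close>

definition iteration_scale :: "real \<Rightarrow> real \<Rightarrow> real" where
  "iteration_scale L M = sqrt (8 * (M * D0 + (L + 2 * M\<^sup>2 * ln (real m + 1)) / 2 * D0\<^sup>2))"

definition iterations :: "real \<Rightarrow> real \<Rightarrow> real \<Rightarrow> nat \<Rightarrow> nat" where
  "iterations L M b l = Suc (nat \<lceil>iteration_scale L M * b ^ l\<rceil>)"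

text \<open>An accuracy of \<open>\<delta>\<close> for the smoothed problem leaves the margin \<open>\<delta>/\<rho>\<close> in the radial
  transform. It turns into an increase of \<open>\<tau> f\<close> by \<open>\<delta>\<close> because \<open>f(e\<^sub>0) \<ge> \<rho> p\<close>.\<close>

lemma smooth_progress:
  assumes mc: "method_constants m (\<lambda>x. ennreal (F x)) S e {1 / p..1 / F x0} L M"
    and \<tau>: "\<tau> \<in> {1 / p..1 / F x0}" and x: "F x > 0" and b: "b \<ge> 2"
    and gap: "2 / (c * \<rho>) * accuracy b l \<le> \<tau> * p - 1"
  defines "y \<equiv> fst ((smooth_step m L M (component \<tau>) (accuracy b l) ^^ iterations L M b l) (smooth_init x))"
  shows "\<And>j. j \<in> {1..m} \<Longrightarrow> y \<in> S j" "1 + accuracy b l \<le> \<tau> * F y"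
proof -
  define \<delta> where "\<delta> = accuracy b l"
  have \<delta>: "0 < \<delta>" "\<delta> \<le> 1" using b by (auto simp: \<delta>_def accuracy_def intro: one_le_power)
  have \<delta>\<rho>: "\<delta> \<le> \<delta> / \<rho>" using \<delta> \<rho> by (simp add: le_divide_eq mult_left_le)
  obtain u where u: "F u > 0" "\<And>j. j \<le> m \<Longrightarrow> component \<tau> j u \<le> 1 - c * (\<tau> * p - 1)"
    using comparison_point[OF \<tau>] by blast
  have "c * (2 / (c * \<rho>) * \<delta>) \<le> c * (\<tau> * p - 1)"
    using gap c_pos unfolding \<delta>_def by (intro mult_left_mono) auto
  moreover have "c * (2 / (c * \<rho>) * \<delta>) = 2 * \<delta> / \<rho>" using c_pos by simp
  ultimately have "2 * \<delta> / \<rho> \<le> c * (\<tau> * p - 1)" by simp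
  hence u': "component \<tau> j u \<le> 1 - 2 * \<delta> / \<rho>" if "j \<le> m" for j using u(2)[OF that] by linarith
  have sm: "smooth_fun_on L UNIV (component \<tau> j)" "M-lipschitz_on UNIV (component \<tau> j)" if "j \<le> m" for j
    using mc \<tau> that by (auto simp: method_constants_def)
  have L: "L \<ge> 0" using sm(1)[of 0] lipschitz_on_nonneg by (auto simp: smooth_fun_on_def)
  have M: "M > 0" by (rule lipschitz_constant_pos[OF mc])
  define A where "A = M * D0 + (L + 2 * M\<^sup>2 * ln (real m + 1)) / 2 * D0\<^sup>2"
  have A: "A \<ge> 0" using M L m \<Delta>_nonneg by (simp add: A_def)
  have k: "8 * A \<le> ((real (iterations L M b l) + 1) * \<delta>)\<^sup>2"
  proof -
    have "iteration_scale L M = sqrt (8 * A)" by (simp only: iteration_scale_def A_def)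
    hence "sqrt (8 * A) * b ^ l \<le> real (iterations L M b l) + 1"
      using real_nat_ceiling_ge[of "sqrt (8 * A) * b ^ l"] by (simp add: iterations_def)
    hence "sqrt (8 * A) * b ^ l * \<delta> \<le> (real (iterations L M b l) + 1) * \<delta>"
      using \<delta> by (intro mult_right_mono) auto
    hence "sqrt (8 * A) \<le> (real (iterations L M b l) + 1) * \<delta>" using b by (simp add: \<delta>_def accuracy_def)
    hence "(sqrt (8 * A))\<^sup>2 \<le> ((real (iterations L M b l) + 1) * \<delta>)\<^sup>2" using A by (intro power_mono) auto
    thus ?thesis using A by simp
  qed
  have le: "component \<tau> j y \<le> 1 - \<delta> / \<rho>" if "j \<le> m" for j
  proof -
    \<comment> \<open>The starting point and u both lie in dom f, so D0 bounds their
      distance.\<close>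
    have "component \<tau> j y \<le> (1 - 2 * \<delta> / \<rho>) + \<delta>"
      unfolding y_def \<delta>_def[symmetric]
      using sm component_above_tangent[OF \<tau>] m M \<delta> diam[OF x u(1)] u' k[unfolded A_def] that
      by (rule smooth_accuracy)
    thus ?thesis using \<delta>\<rho> by simp
  qed
  show "y \<in> S j" if j: "j \<in> {1..m}" for j
  proof -
    have "phi_set (S j) (e j) y \<le> 1 - \<delta> / \<rho>" using le[of j] j by (simp add: component_pos[OF j])
    hence "phi_set (S j) (e j) y \<le> 1" using \<delta> \<rho> by (simp add: order_trans)
    thus ?thesis using phi_le_1[OF j] by blast
  qed
  have \<tau>0: "\<tau> > 0" by (rule parameter_pos[OF \<tau>])
  have r: "rad \<tau> y \<le> 1 - \<delta> / \<rho>" using le[of 0] by (simp add: component_0)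
  hence r1: "rad \<tau> y \<le> 1" using \<delta> \<rho> by (smt (verit) divide_pos_pos)
  have "\<rho> * p \<le> F (e 0)"
    using F_le_center[of x_star] R_pos \<Delta>_nonneg by (simp add: x_star \<rho>_def divide_le_eq mult.commute)
  hence "\<tau> * (\<rho> * p) \<le> \<tau> * F (e 0)" using \<tau>0 by simp
  moreover have "1 \<le> \<tau> * p" using \<tau> x_star by (simp add: field_simps)
  hence "\<rho> * 1 \<le> \<rho> * (\<tau> * p)" using \<rho> by (intro mult_left_mono) auto
  ultimately have "\<rho> \<le> \<tau> * F (e 0)" by (simp add: mult_ac)
  hence "\<delta> / \<rho> * \<rho> \<le> (1 - rad \<tau> y) * (\<tau> * F (e 0))"
    using r r1 \<delta> \<rho> by (intro mult_mono) auto
  with rad_gain[OF \<tau>0 r1] show "1 + accuracy b l \<le> \<tau> * F y" using \<rho> by (simp add: \<delta>_def)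
qed

lemma run_bound:
  assumes mc: "method_constants m (\<lambda>x. ennreal (F x)) S e {1 / p..1 / F x0} L M"
    and b: "b \<ge> 2" and x0_in: "x0 \<in> (\<Inter>j\<in>{1..m}. S j)"
    and max: "\<And>x. x \<in> (\<Inter>j\<in>{1..m}. S j) \<Longrightarrow> F x \<le> p"
  shows "\<exists>C \<epsilon>0. C > 0 \<and> \<epsilon>0 > 0 \<and> (\<forall>\<epsilon> > 0. \<forall>N > 0. \<forall>\<sigma> \<tau> ybest.
           real N \<ge> log b (b * p / (c * \<rho> * \<epsilon>)) \<longrightarrow>
           parallel_multiradial_smooth_run m L M (\<lambda>x. ennreal (F x)) S e x0 b N \<sigma> \<tau> ybest \<longrightarrow>
           (\<exists>i \<ge> 1. ybest i \<in> (\<Inter>j\<in>{1..m}. S j) \<and> p - F (ybest i) \<le> \<epsilon> \<and>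
                     (\<epsilon> \<le> \<epsilon>0 \<longrightarrow> real i \<le> C / \<epsilon>)))"
proof -
  define a where "a = 2 / (c * \<rho>)"
  define \<kappa> where "\<kappa> = iteration_scale L M + 2"
  have a: "a > 0" using c_pos \<rho> by (simp add: a_def)
  have scale: "iteration_scale L M \<ge> 0"
  proof -
    have "1 / p \<in> {1 / p..1 / F x0}" using x0 by (simp add: frac_le)
    hence "smooth_fun_on L UNIV (component (1 / p) 0)" using mc by (simp add: method_constants_def)
    hence "L \<ge> 0" unfolding smooth_fun_on_def using lipschitz_on_nonneg by blast
    moreover have "M > 0" by (rule lipschitz_constant_pos[OF mc])
    ultimately show ?thesis using m \<Delta>_nonneg by (simp add: iteration_scale_def)
  qed
  \<comment> \<open>C has to be fixed before \<epsilon>, N and the run; \<open>restarts\<close>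
    depends only on a and b and can be named outside the locale.\<close>
  define C where "C = (1 + 2 * multiradial_run.restarts b a * \<kappa>) * (b * a * p)"
  have "C > 0" unfolding C_def
    using scale a b x_star by (intro mult_pos_pos) (auto simp: \<kappa>_def intro!: add_pos_nonneg)
  moreover have "a * p > 0" using a x_star by simp
  moreover have "\<exists>i\<ge>1. ybest i \<in> (\<Inter>j\<in>{1..m}. S j) \<and> p - F (ybest i) \<le> \<epsilon> \<and>
      (\<epsilon> \<le> a * p \<longrightarrow> real i \<le> C / \<epsilon>)"
    if eps: "\<epsilon> > 0" and N: "real N \<ge> log b (b * p / (c * \<rho> * \<epsilon>))"
      and run: "parallel_multiradial_smooth_run m L M (\<lambda>x. ennreal (F x)) S e x0 b N \<sigma>' \<tau> ybest"
    for \<epsilon> N \<sigma>' \<tau> ybest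
  proof -
    interpret multiradial_run smooth_init "\<lambda>\<tau>. smooth_step m L M (component \<tau>)" fst "\<lambda>x. ennreal (F x)"
      "\<Inter>j\<in>{1..m}. S j" x0 b N \<sigma>' \<tau> ybest p a \<kappa> "iterations L M b"
    proof
      show "parallel_multiradial_run smooth_init (\<lambda>\<tau>. smooth_step m L M (component \<tau>)) fst
          (\<lambda>x. ennreal (F x)) (\<Inter>j\<in>{1..m}. S j) x0 b N \<sigma>' \<tau> ybest"
        using run by (simp add: parallel_multiradial_smooth_run_def)
      show "b \<ge> 2" "x0 \<in> (\<Inter>j\<in>{1..m}. S j)" "ennreal (F x0) > 0" "p > 0" "a > 0"
        using b x0_in x0 x_star a by auto
      show "ennreal (F x) \<le> ennreal p" if "x \<in> (\<Inter>j\<in>{1..m}. S j)" for x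
        using max[OF that] by (rule ennreal_leI)
      \<comment> \<open>The factor F(x0)/p in c cancels p/F(x0), and what remains is a product of
        numbers at most 1.\<close>
      show "p / enn2real (ennreal (F x0)) - 1 \<le> a"
      proof -
        have "\<rho> * ((1 - \<gamma>) * \<sigma>) * \<rho> \<le> 1"
          using \<rho> \<gamma>(2,3) \<sigma> by (intro mult_le_one) auto
        moreover have "c * \<rho> * (p / F x0) = \<rho> * ((1 - \<gamma>) * \<sigma>) * \<rho>"
          using x0 x_star by (simp add: c_def)
        ultimately have "p / F x0 \<le> a"
          using c_pos \<rho> by (simp add: a_def pos_le_divide_eq mult.commute)
        thus ?thesis using x0 by simp
      qed
      show "1 \<le> iterations L M b l" for l by (simp add: iterations_def)
      show "real (iterations L M b l) \<le> \<kappa> * b ^ l" for l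
      proof -
        have bl: "b ^ l \<ge> 1" using b by (intro one_le_power) auto
        have "real (nat \<lceil>iteration_scale L M * b ^ l\<rceil>) \<le> iteration_scale L M * b ^ l + 1"
          using scale bl by (simp add: of_nat_ceiling)
        thus ?thesis using bl by (simp add: iterations_def \<kappa>_def distrib_right)
      qed
      show "fst ((smooth_step m L M (component t) (accuracy b l) ^^ iterations L M b l) (smooth_init x))
              \<in> (\<Inter>j\<in>{1..m}. S j) \<and>
          1 + accuracy b l \<le> t * enn2real (ennreal (F
            (fst ((smooth_step m L M (component t) (accuracy b l) ^^ iterations L M b l) (smooth_init x)))))"
        if "1 / p \<le> t" "t \<le> 1 / enn2real (ennreal (F x0))" "ennreal (F x0) \<le> ennreal (F x)"
          "a * accuracy b l \<le> t * p - 1" for l t x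
      proof -
        have "F x0 \<le> F x" using that(3) x0 by (simp add: ennreal_le_iff2)
        hence "F x > 0" using x0 by linarith
        moreover have "t \<in> {1 / p..1 / F x0}" using that x0 by simp
        ultimately show ?thesis
          using smooth_progress[OF mc _ _ b, of t x l] that(4) nonneg by (simp add: a_def)
      qed
    qed
    \<comment> \<open>The factor b inside the logarithm pays for the 2 in a = 2/(c \<rho>).\<close>
    have "a * p \<le> \<epsilon> * b ^ N"
    proof -
      have "b * p / (c * \<rho> * \<epsilon>) \<le> b powr real N"
        using N b x_star c_pos \<rho> eps by (simp add: log_le_iff)
      also have "b powr real N = b ^ N" using b by (simp add: powr_realpow)
      finally have "b * p / (c * \<rho>) \<le> \<epsilon> * b ^ N"
        using eps c_pos \<rho> by (simp add: field_simps)
      moreover have "2 * p / (c * \<rho>) \<le> b * p / (c * \<rho>)"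
        using b x_star c_pos \<rho> by (intro divide_right_mono mult_right_mono) auto
      ultimately show ?thesis by (simp add: a_def)
    qed
    from eps_time[OF eps this] show ?thesis using nonneg by (simp add: C_def)
  qed
  ultimately show ?thesis by blast
qed

end

section \<open>Transfer to the original hypotheses\<close>

lemma phi_set_nonneg: "phi_set S e x \<ge> 0"
  by (auto simp: phi_set_def)

lemma le_phi_max: "j \<in> {1..m} \<Longrightarrow> phi_set (S j) (e j) x \<le> phi_max m S e x"
  unfolding phi_max_def by (intro Max_ge) auto

text \<open>The first conjunct keeps the claim for all valid L and M from being vacuous. C and
  \<epsilon>0 are chosen before \<epsilon>, N and the run, which expresses the O-bound as \<epsilon>
  tends to 0, while a feasible \<epsilon>-minimizer is found for every \<epsilon>.\<close>

theorem corollary4p2: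
  fixes f :: "'a::euclidean_space \<Rightarrow> ennreal"
    and S :: "nat \<Rightarrow> 'a set" and S0 SS :: "'a set"
    and e :: "nat \<Rightarrow> 'a"
    and x_star x_SL x0 :: 'a
    and m :: nat
    and D0 R0 p_star \<eta> \<beta> \<tau>0 \<rho> c b :: real
  assumes "concave_ennreal f" and "upper_semicontinuous f"
    and "S0 = closure (eff_dom f)" and "bounded S0" and "D0 = diameter S0"
    and "m \<ge> 1"
    and "\<And>j. j \<in> {1..m} \<Longrightarrow> closed (S j) \<and> convex (S j)"
    and "SS = (\<Inter>j\<in>{1..m}. S j)"
    and "e 0 \<in> interior S0" and "R0 = inner_radius (e 0) S0" and "R0 > 0"
    and "\<And>j. j \<in> {1..m} \<Longrightarrow> e j \<in> interior (S j)"
    and "x_star \<in> SS" and "\<And>x. x \<in> SS \<Longrightarrow> f x \<le> f x_star" and "f x_star > 0"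
    and "p_star = enn2real (f x_star)"
    and "x_SL \<in> interior SS \<inter> eff_dom f"
    and "\<eta> = (1 - gauge_at S0 (e 0) x_star) * (1 - phi_max m S e x_SL)" and "\<eta> > 0"
    and "twice_cont_diff f"
    and "smooth_fun_on \<beta> (eff_dom f) (\<lambda>x. enn2real (f x))"
    and "\<And>j. j \<in> {1..m} \<Longrightarrow> smooth_set \<beta> (S j) \<and> compact (S j)"
    and "x0 \<in> eff_dom f \<inter> SS" and "\<tau>0 = 1 / enn2real (f x0)"
    and "b \<ge> 2"
    and "\<rho> = R0 / (D0 + R0)"
    and "c = 1 / (\<tau>0 * p_star) * (R0 / (D0 + R0)) * \<eta>"
  shows "(\<exists>L M. method_constants m f S e {1 / p_star..\<tau>0} L M) \<and>
    (\<forall>L M. method_constants m f S e {1 / p_star..\<tau>0} L M \<longrightarrow>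
      (\<exists>C \<epsilon>0. C > 0 \<and> \<epsilon>0 > 0 \<and>
        (\<forall>\<epsilon> > 0. \<forall>N > 0. \<forall>\<sigma> \<tau> ybest.
           real N \<ge> log b (b * p_star / (c * \<rho> * \<epsilon>)) \<longrightarrow>
           parallel_multiradial_smooth_run m L M f S e x0 b N \<sigma> \<tau> ybest \<longrightarrow>
           (\<exists>i \<ge> 1. ybest i \<in> SS \<and> p_star - enn2real (f (ybest i)) \<le> \<epsilon> \<and>
                     (\<epsilon> \<le> \<epsilon>0 \<longrightarrow> real i \<le> C / \<epsilon>)))))"
proof -
  interpret obj: smooth_concave_objective f S0 "e 0" R0 D0 \<beta> x0
    using assms by unfold_locales auto
  interpret profile: smooth_concave_profile obj.F "e 0" R0 D0 "grad obj.F" \<beta> by (rule obj.profile)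
  define \<gamma> where "\<gamma> = gauge_at S0 (e 0) x_star"
  define \<sigma> where "\<sigma> = 1 - phi_max m S e x_SL"
  have f_eq: "f = (\<lambda>x. ennreal (obj.F x))" using obj.f_eq by blast
  have S0_eq: "S0 = closure {x. obj.F x > 0}" using assms(3) by (simp add: obj.eff_dom_eq)
  have x_star: "obj.F x_star = p_star" using assms(16) by (simp add: obj.F_def)
  moreover have "0 < obj.F x_star" 
    using assms(15) obj.f_finite[of x_star] by (simp add: obj.F_def enn2real_positive_iff)
  ultimately have "p_star > 0" by simp
  have "x_star \<in> S0" using closure_subset[of "{x. obj.F x > 0}"] x_star \<open>p_star > 0\<close> by (auto simp: S0_eq)
  hence one: "1 \<in> {v. 0 < v \<and> e 0 + (x_star - e 0) /\<^sub>R v \<in> S0}" by simp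
  have "0 \<le> \<gamma>" unfolding \<gamma>_def gauge_at_def by (rule cInf_greatest) (use one in blast, simp)
  \<comment> \<open>Excludes that both factors of \<eta> are negative.\<close>
  have "\<gamma> \<le> 1" unfolding \<gamma>_def gauge_at_def by (rule cInf_lower[OF one bdd_belowI[of _ 0]]) simp
  have \<eta>: "(1 - \<gamma>) * \<sigma> > 0" using assms(18,19) by (simp add: \<gamma>_def \<sigma>_def)
  hence "\<gamma> < 1" "\<sigma> > 0" using \<open>\<gamma> \<le> 1\<close> by (auto simp: zero_less_mult_iff)
  have "phi_max m S e x_SL \<ge> 0"
    using le_phi_max[of 1 m S e x_SL] phi_set_nonneg[of "S 1" "e 1" x_SL] assms(6) by auto
  hence "\<sigma> \<le> 1" by (simp add: \<sigma>_def)
  have max: "obj.F x \<le> p_star" if "x \<in> SS" for x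
    using enn2real_mono[OF assms(14)[OF that]] obj.f_finite[of x_star] assms(16) by (simp add: obj.F_def)
  interpret prob: radial_problem obj.F e R0 D0 "grad obj.F" \<beta> m S x_star x_SL x0 p_star \<gamma> \<sigma>
  proof
    show "m \<ge> 1" by (rule assms(6))
    show "\<exists>r \<Delta>. smooth_convex_body (S j) (e j) r \<Delta> \<beta>" if "j \<in> {1..m}" for j
      using assms(7,12,22)[OF that] profile.\<beta>_nonneg by (intro ex_smooth_convex_body) auto
    show "phi_set (S j) (e j) x_SL \<le> 1 - \<sigma>" if "j \<in> {1..m}" for j
      using le_phi_max[OF that] by (simp add: \<sigma>_def)
    show "0 < obj.F x_SL" using assms(17) by (simp add: obj.eff_dom_eq)
    show "0 < obj.F x0" using assms(23) by (simp add: obj.eff_dom_eq)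
    show "obj.F x0 \<le> p_star" using assms(23) by (intro max) auto
    show "x_star \<in> S j" if "j \<in> {1..m}" for j using assms(8,13) that by auto
    show "\<gamma> = gauge_at (closure {x. 0 < obj.F x}) (e 0) x_star" by (simp add: \<gamma>_def S0_eq)
  qed fact+
  have \<tau>0: "\<tau>0 = 1 / obj.F x0" using assms(24) by (simp add: obj.F_def)
  have \<rho>: "\<rho> = prob.\<rho>" using assms(26) by (simp add: prob.\<rho>_def)
  have c: "c = prob.c"
    unfolding prob.c_def prob.\<rho>_def using assms(18,27) by (simp add: \<tau>0 \<gamma>_def \<sigma>_def mult_ac)
  have x0: "x0 \<in> (\<Inter>j\<in>{1..m}. S j)" using assms(8,23) by simp
  have max': "obj.F x \<le> p_star" if "x \<in> (\<Inter>j\<in>{1..m}. S j)" for x using max that assms(8) by simp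
  have mc: "method_constants m f S e {1 / p_star..\<tau>0} =
      method_constants m (\<lambda>x. ennreal (obj.F x)) S e {1 / p_star..1 / obj.F x0}"
    by (simp add: f_eq[symmetric] \<tau>0)
  show ?thesis
    using prob.ex_method_constants prob.run_bound[OF _ assms(25) x0 max']
    unfolding mc \<rho> c assms(8) obj.F_def[symmetric] f_eq[symmetric] by blast
qed

end
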